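(* Suppose that $f \in C^4(\mathbb{R})$, $g \in C^3(\mathbb{R})$. Let $u(x,t) = \varphi (x-ct)$ be a periodic traveling wave solution with speed $c \in \mathbb{R}$ to the viscous balance law $$u_t + f(u)_x = u_{xx} + g(u),$$ where the profile function $\varphi = \varphi(\cdot)$ is of class $C^2$ and has fundamental period $L > 0$. Assume that the following spectral instability property holds: the linearized operator around the wave, $\mathcal{L}_0^c : L^2_{\mathrm{per}}([0,L]) \to L^2_{\mathrm{per}}([0,L])$ with domain $\mathcal{D}(\mathcal{L}_0^c)=H^2_{\mathrm{per}}([0,L])$, $$\mathcal{L}_0^c := \partial_x^2 + a_1(x)\partial_x + a_0(x)\,\mathrm{Id},\qquad a_1(x) := c - f'(\varphi(x)),\qquad a_0(x) := g'(\varphi(x)) - \partial_x\big(f'(\varphi(x))\big),$$ has an unstable eigenvalue, that is, there exist $\lambda \in \mathbb{C}$ with $\mathrm{Re}\,\lambda > 0$ and some eigenfunction $\Psi \in H^2_{\mathrm{per}}([0,L])$ such that $\mathcal{L}_0^c \Psi = \lambda \Psi$. Then the periodic traveling wave is orbitally unstable in $X = H^2_{\mathrm{per}}([0,L])$ under the flow of the viscous balance law.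
   Context: For $L>0$ and $s\in\mathbb{R}$, $H^s_{\mathrm{per}}([0,L])$ is the Sobolev space of $L$-periodic distributions $u$ with $\|u\|_s^2 := L\sum_{k\in\mathbb{Z}}(1+|k|^2)^s|\widehat u(k)|^2<\infty$, and $L^2_{\mathrm{per}}=H^0_{\mathrm{per}}$. Orbital (in)stability: a traveling wave $\varphi\in X=H^2_{\mathrm{per}}([0,L])$ is orbitally stable in $X$ by the flow of $u_t + f(u)_x = u_{xx} + g(u)$ if for each $\varepsilon>0$ there exists $\delta>0$ such that whenever $\psi\in X$ satisfies $\inf_{r\in\mathbb{R}}\|\psi(\cdot)-\varphi(\cdot+r)\|_X<\delta$, the solution $u(x,t)$ of the equation with initial condition $u(0)=\psi$ exists globally in time and satisfies $\sup_{t>0}\inf_{r\in\mathbb{R}}\|u(\cdot,t)-\varphi(\cdot+r)\|_X<\varepsilon$. Otherwise $\varphi$ is orbitally unstable in $X$. Solutions with data in $H^2_{\mathrm{per}}([0,L])$ are the unique local solutions in $C([0,T];H^2_{\mathrm{per}}([0,L]))\cap C^1((0,T];L^2_{\mathrm{per}}([0,L]))$. *)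

theory Defs
  imports "HOL-Analysis.Analysis"
begin

definition C_k :: "nat \<Rightarrow> (real \<Rightarrow> real) \<Rightarrow> bool" where
  "C_k k h \<longleftrightarrow>
     (\<forall>j<k. \<forall>x. (deriv ^^ j) h field_differentiable at x) \<and>
     continuous_on UNIV ((deriv ^^ k) h)"

(* The clause on smaller T excludes constant functions. *)
definition fundamental_period :: "(real \<Rightarrow> real) \<Rightarrow> real \<Rightarrow> bool" where
  "fundamental_period h L \<longleftrightarrow>
     L > 0 \<and> (\<forall>x. h (x + L) = h x) \<and>
     (\<forall>T. 0 < T \<and> T < L \<longrightarrow> (\<exists>x. h (x + T) \<noteq> h x))"


(* Elements of the periodic spaces are represented by periodic Borel functions; every notion
   below is insensitive to changes on null sets, so that "norm" means the seminorm on
   representatives. *)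

definition L2_per :: "real \<Rightarrow> (real \<Rightarrow> 'a :: {banach, second_countable_topology}) set" where
  "L2_per L = {u. u \<in> borel_measurable borel \<and> (\<forall>x. u (x + L) = u x) \<and>
     set_integrable lborel {0..L} (\<lambda>x. (norm (u x))\<^sup>2)}"

definition fourier_coeff :: "real \<Rightarrow> (real \<Rightarrow> complex) \<Rightarrow> int \<Rightarrow> complex" where
  "fourier_coeff L u k =
     (1 / complex_of_real L) *
     (LINT x:{0..L}|lborel. u x * cis (- (2 * pi * real_of_int k * x / L)))"

(* For s \<ge> 0 a periodic distribution with finite H^s norm is an L^2 function, so Hs_per L s
   is the Sobolev space of order s in that range; for s = 0 it is all of L2_per L. *)
definition Hs_per :: "real \<Rightarrow> real \<Rightarrow> (real \<Rightarrow> complex) set" where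
  "Hs_per L s = {u \<in> L2_per L.
     (\<lambda>k::int. (1 + \<bar>real_of_int k\<bar>\<^sup>2) powr s * (norm (fourier_coeff L u k))\<^sup>2) summable_on UNIV}"

definition Hs_norm :: "real \<Rightarrow> real \<Rightarrow> (real \<Rightarrow> complex) \<Rightarrow> real" where
  "Hs_norm L s u = sqrt (L *
     (\<Sum>\<^sub>\<infinity>k::int. (1 + \<bar>real_of_int k\<bar>\<^sup>2) powr s * (norm (fourier_coeff L u k))\<^sup>2))"

text \<open>The real-valued elements of these spaces, in which the nonlinear flow takes place.\<close>

definition real_Hs_per :: "real \<Rightarrow> real \<Rightarrow> (real \<Rightarrow> real) set" where
  "real_Hs_per L s = {u. (\<lambda>x. complex_of_real (u x)) \<in> Hs_per L s}"

definition real_Hs_norm :: "real \<Rightarrow> real \<Rightarrow> (real \<Rightarrow> real) \<Rightarrow> real" where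
  "real_Hs_norm L s u = Hs_norm L s (\<lambda>x. complex_of_real (u x))"


(* v is the derivative of u in the sense of L-periodic distributions, and lies in L^2 *)
definition has_weak_deriv ::
  "real \<Rightarrow> (real \<Rightarrow> 'a :: {banach, second_countable_topology}) \<Rightarrow> (real \<Rightarrow> 'a) \<Rightarrow> bool" where
  "has_weak_deriv L u v \<longleftrightarrow> u \<in> L2_per L \<and> v \<in> L2_per L \<and>
     (\<forall>\<eta>. (\<forall>k. C_k k \<eta>) \<and> (\<forall>x. \<eta> (x + L) = \<eta> x) \<longrightarrow>
        (LINT x:{0..L}|lborel. deriv \<eta> x *\<^sub>R u x) =
        - (LINT x:{0..L}|lborel. \<eta> x *\<^sub>R v x))"

(* Determined up to a null set whenever a weak derivative in L^2 exists, arbitrary otherwise. *)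
definition weak_deriv ::
  "real \<Rightarrow> (real \<Rightarrow> 'a :: {banach, second_countable_topology}) \<Rightarrow> real \<Rightarrow> 'a" where
  "weak_deriv L u = (SOME v. has_weak_deriv L u v)"


(* u t x; the equation u_t + f(u)_x = u_xx + g(u) in the pointwise classical sense *)
definition classical_solution ::
  "(real \<Rightarrow> real) \<Rightarrow> (real \<Rightarrow> real) \<Rightarrow> (real \<Rightarrow> real \<Rightarrow> real) \<Rightarrow> bool" where
  "classical_solution f g u \<longleftrightarrow>
     (\<forall>t x. (\<lambda>s. u s x) field_differentiable at t \<and>
            (\<lambda>y. f (u t y)) field_differentiable at x \<and>
            u t field_differentiable at x \<and>
            deriv (u t) field_differentiable at x \<and>
            deriv (\<lambda>s. u s x) t + deriv (\<lambda>y. f (u t y)) x = deriv (deriv (u t)) x + g (u t x))"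

definition periodic_traveling_wave ::
  "(real \<Rightarrow> real) \<Rightarrow> (real \<Rightarrow> real) \<Rightarrow> real \<Rightarrow> real \<Rightarrow> (real \<Rightarrow> real) \<Rightarrow> bool" where
  "periodic_traveling_wave f g c L \<phi> \<longleftrightarrow>
     C_k 2 \<phi> \<and> fundamental_period \<phi> L \<and> classical_solution f g (\<lambda>t x. \<phi> (x - c * t))"


definition lin_op ::
  "(real \<Rightarrow> real) \<Rightarrow> (real \<Rightarrow> real) \<Rightarrow> real \<Rightarrow> real \<Rightarrow> (real \<Rightarrow> real) \<Rightarrow>
   (real \<Rightarrow> complex) \<Rightarrow> real \<Rightarrow> complex" where
  "lin_op f g c L \<phi> \<Psi> = (\<lambda>x.
     let a1 = c - deriv f (\<phi> x);
         a0 = deriv g (\<phi> x) - deriv (\<lambda>y. deriv f (\<phi> y)) x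
     in weak_deriv L (weak_deriv L \<Psi>) x
        + complex_of_real a1 * weak_deriv L \<Psi> x
        + complex_of_real a0 * \<Psi> x)"

definition is_eigenpair ::
  "(real \<Rightarrow> real) \<Rightarrow> (real \<Rightarrow> real) \<Rightarrow> real \<Rightarrow> real \<Rightarrow> (real \<Rightarrow> real) \<Rightarrow>
   complex \<Rightarrow> (real \<Rightarrow> complex) \<Rightarrow> bool" where
  "is_eigenpair f g c L \<phi> \<mu> \<Psi> \<longleftrightarrow>
     \<Psi> \<in> Hs_per L 2 \<and> \<not> (AE x in lborel. \<Psi> x = 0) \<and>
     (AE x in lborel. lin_op f g c L \<phi> \<Psi> x = \<mu> * \<Psi> x)"

definition spectrally_unstable ::
  "(real \<Rightarrow> real) \<Rightarrow> (real \<Rightarrow> real) \<Rightarrow> real \<Rightarrow> real \<Rightarrow> (real \<Rightarrow> real) \<Rightarrow> bool" where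
  "spectrally_unstable f g c L \<phi> \<longleftrightarrow> (\<exists>\<mu> \<Psi>. Re \<mu> > 0 \<and> is_eigenpair f g c L \<phi> \<mu> \<Psi>)"


(* u \<in> C([0,T]; H^2) \<inter> C^1((0,T]; L^2), with time derivative v, solving the equation as an
   identity in L^2 for every t in (0,T] *)
definition solution_on ::
  "(real \<Rightarrow> real) \<Rightarrow> (real \<Rightarrow> real) \<Rightarrow> real \<Rightarrow> real \<Rightarrow> (real \<Rightarrow> real \<Rightarrow> real) \<Rightarrow> bool" where
  "solution_on f g L T u \<longleftrightarrow>
     (\<forall>t\<in>{0..T}. u t \<in> real_Hs_per L 2) \<and>
     (\<forall>t\<in>{0..T}. ((\<lambda>s. real_Hs_norm L 2 (\<lambda>x. u s x - u t x)) \<longlongrightarrow> 0) (at t within {0..T})) \<and>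
     (\<exists>v.
        (\<forall>t\<in>{0<..T}. v t \<in> real_Hs_per L 0) \<and>
        (\<forall>t\<in>{0<..T}. ((\<lambda>s. real_Hs_norm L 0 (\<lambda>x. (u s x - u t x) / (s - t) - v t x)) \<longlongrightarrow> 0)
           (at t within {0<..T})) \<and>
        (\<forall>t\<in>{0<..T}. ((\<lambda>s. real_Hs_norm L 0 (\<lambda>x. v s x - v t x)) \<longlongrightarrow> 0)
           (at t within {0<..T})) \<and>
        (\<forall>t\<in>{0<..T}. \<exists>w. has_weak_deriv L (\<lambda>x. f (u t x)) w \<and>
           (AE x in lborel. v t x + w x = weak_deriv L (weak_deriv L (u t)) x + g (u t x))))"

definition global_solution ::
  "(real \<Rightarrow> real) \<Rightarrow> (real \<Rightarrow> real) \<Rightarrow> real \<Rightarrow> (real \<Rightarrow> real) \<Rightarrow> (real \<Rightarrow> real \<Rightarrow> real) \<Rightarrow> bool" where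
  "global_solution f g L \<psi> u \<longleftrightarrow>
     (AE x in lborel. u 0 x = \<psi> x) \<and> (\<forall>T>0. solution_on f g L T u)"

definition orbit_dist :: "real \<Rightarrow> (real \<Rightarrow> real) \<Rightarrow> (real \<Rightarrow> real) \<Rightarrow> real" where
  "orbit_dist L \<phi> \<psi> = (INF r::real. real_Hs_norm L 2 (\<lambda>x. \<psi> x - \<phi> (x + r)))"

(* Solutions with a given initial condition being unique, "the solution exists globally and
   stays close" is the existence of a global solution that stays close. The supremum is taken
   in the extended reals because it may be infinite. *)
definition orbitally_stable ::
  "(real \<Rightarrow> real) \<Rightarrow> (real \<Rightarrow> real) \<Rightarrow> real \<Rightarrow> (real \<Rightarrow> real) \<Rightarrow> bool" where
  "orbitally_stable f g L \<phi> \<longleftrightarrow>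
     (\<forall>\<epsilon>>0. \<exists>\<delta>>0. \<forall>\<psi> \<in> real_Hs_per L 2. orbit_dist L \<phi> \<psi> < \<delta> \<longrightarrow>
        (\<exists>u. global_solution f g L \<psi> u \<and>
             (SUP t\<in>{0<..}. ereal (orbit_dist L \<phi> (u t))) < ereal \<epsilon>))"

definition orbitally_unstable ::
  "(real \<Rightarrow> real) \<Rightarrow> (real \<Rightarrow> real) \<Rightarrow> real \<Rightarrow> (real \<Rightarrow> real) \<Rightarrow> bool" where
  "orbitally_unstable f g L \<phi> \<longleftrightarrow> \<not> orbitally_stable f g L \<phi>"

end

theory Submission
  imports Defs
begin

text \<open>
  The linearised operator is of second order with real coefficients, so by Kato's inequality the
  modulus of the eigenfunction \<open>\<Psi>\<close> is a subsolution of the linearised equation with growth rate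
  \<open>Re \<mu>\<close>. Hence \<open>\<phi> + \<alpha>(t) |\<Psi>|\<close> with \<open>\<alpha>(t) = \<delta> exp (Re \<mu> t / 2)\<close>, taken in the moving frame, is a
  subsolution of the nonlinear equation as long as \<open>\<alpha>\<close> stays below a threshold \<open>A\<close> that does not
  depend on \<open>\<delta>\<close>. By comparison, a solution that starts above \<open>\<phi> + \<delta> |\<Psi>|\<close> lies above \<open>\<phi> + A |\<Psi>|\<close>
  when \<open>\<alpha>\<close> reaches \<open>A\<close>, so its integral over a period exceeds that of \<open>\<phi>\<close> by at least \<open>A\<close> times that of
  \<open>|\<Psi>|\<close>. All translates of \<open>\<phi>\<close> have the same integral, and integrals are controlled by the norm of
  \<open>H\<^sup>2\<close>; so the solution has left a neighbourhood of the orbit whose size does not depend on \<open>\<delta>\<close>.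

  As \<open>|\<Psi>|\<close> may have kinks, it is replaced by \<open>sqrt (|\<Psi>|\<^sup>2 + \<eta>\<^sup>2)\<close>, with \<open>\<eta> = 1\<close> in the initial datum and
  \<open>\<eta>\<close> tending to 0 in the subsolution. Comparison is an energy estimate for the cube of the
  positive part of the difference.
\<close>

subsection \<open>Periodic functions and trigonometric polynomials\<close>

text \<open>Assuming stability, its definition itself hands over a global solution, and staying
  within distance 1 of the orbit bounds this solution uniformly in the sup norm, so that
  \<open>f\<close> and \<open>g\<close> can be treated as Lipschitz functions in the comparison.
  Half of the growth rate \<open>Re \<mu>\<close> is sacrificed: the linear gain has to pay for
  remainders that are quadratic in \<alpha>, and below the threshold \<open>A\<close> these cost at
  most \<open>Re \<mu> / 2\<close>. Regularising the modulus leaves a defect proportional to \<eta>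
  in the subsolution inequality. Over the fixed time interval Gronwall's inequality turns it into an
  energy of order \<eta>, which becomes negligible because \<eta> is chosen after everything else. A
  large part of the development is Fourier analysis: norms are given by Fourier coefficients,
  derivatives by smooth test functions and \<open>weak_deriv\<close> by a choice, and the comparison
  has to move freely between these notions and C1 representatives.\<close>

locale period =
  fixes L :: real
  assumes L_pos: "0 < L"
begin

definition mu :: "real measure" where
  "mu = restrict_space lborel {0..L}"

lemma space_mu [simp]: "space mu = {0..L}"
  by (simp add: mu_def space_restrict_space)

lemma measurable_mu: "h \<in> borel_measurable borel \<Longrightarrow> h \<in> borel_measurable mu"
  unfolding mu_def by (simp add: measurable_restrict_space1)

lemma measurable_mu_cont:
  fixes h :: "real \<Rightarrow> 'a :: topological_space"
  shows "continuous_on UNIV h \<Longrightarrow> h \<in> borel_measurable mu"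
  by (intro measurable_mu borel_measurable_continuous_onI)

lemma measure_mu [simp]: "measure mu {0..L} = L"
  unfolding mu_def using L_pos by (simp add: measure_restrict_space)

lemma emeasure_mu: "emeasure mu {0..L} = ennreal L"
  unfolding mu_def using L_pos by (simp add: emeasure_restrict_space)

sublocale mu: finite_measure mu
  by standard (simp add: emeasure_mu)

lemma integral_mu_const [simp]: "integral\<^sup>L mu (\<lambda>x. c :: 'a :: {banach, second_countable_topology}) = L *\<^sub>R c"
  by (simp add: lebesgue_integral_const measure_mu)

lemma LINT_mu:
  fixes h :: "real \<Rightarrow> 'a :: {banach, second_countable_topology}"
  shows "(LINT x:{0..L}|lborel. h x) = integral\<^sup>L mu h"
  unfolding mu_def set_lebesgue_integral_def by (simp add: integral_restrict_space)

lemma set_integrable_mu: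
  fixes h :: "real \<Rightarrow> 'a :: {banach, second_countable_topology}"
  shows "set_integrable lborel {0..L} h \<longleftrightarrow> integrable mu h"
  unfolding mu_def set_integrable_def by (simp add: integrable_restrict_space)

lemma AE_mu: "(AE x in lborel. P x) \<Longrightarrow> AE x in mu. P x"
  unfolding mu_def by (subst AE_restrict_space_iff) auto

lemma integrable_mu_cont:
  fixes h :: "real \<Rightarrow> 'a :: {banach, second_countable_topology}"
  assumes "continuous_on UNIV h"
  shows "integrable mu h"
  using borel_integrable_compact[of "{0..L}" h] continuous_on_subset[OF assms]
  by (simp add: mu_def integrable_restrict_space)

lemma integral_mu_FTC:
  fixes F :: "real \<Rightarrow> 'a :: euclidean_space"
  assumes "\<And>x. (F has_vector_derivative h x) (at x)" "continuous_on UNIV h"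
  shows "integral\<^sup>L mu h = F L - F 0"
  using integral_FTC_Icc[of 0 L F h] assms L_pos
  by (simp add: mu_def integral_restrict_space has_vector_derivative_at_within
      continuous_on_subset[OF assms(2)])

definition periodic :: "(real \<Rightarrow> 'a) \<Rightarrow> bool" where
  "periodic h \<longleftrightarrow> (\<forall>x. h (x + L) = h x)"

lemma periodic_int:
  assumes "periodic h" shows "h (x + of_int n * L) = h x"
proof -
  have 1: "h (y + real m * L) = h y" for m y
  proof (induction m)
    case (Suc m)
    have "h (y + real (Suc m) * L) = h ((y + real m * L) + L)" by (simp add: algebra_simps)
    also have "\<dots> = h y" using Suc assms by (simp add: periodic_def)
    finally show ?case .
  qed auto
  show ?thesis
  proof (cases "n \<ge> 0")
    case True
    then show ?thesis using 1[of x "nat n"] by simp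
  next
    case False
    then show ?thesis using 1[of "x + of_int n * L" "nat (- n)"] by (simp add: algebra_simps)
  qed
qed

lemma periodic_reduce: "\<exists>y\<in>{0..<L}. \<exists>n::int. x = y + of_int n * L"
proof -
  define n where "n = \<lfloor>x / L\<rfloor>"
  have "of_int n \<le> x / L" "x / L < of_int n + 1" unfolding n_def by linarith+
  then have "of_int n * L \<le> x" "x < (of_int n + 1) * L" using L_pos by (auto simp: field_simps)
  then have "x - of_int n * L \<in> {0..<L}" by (auto simp: algebra_simps)
  moreover have "x = (x - of_int n * L) + of_int n * L" by simp
  ultimately show ?thesis by blast
qed

lemma periodic_cont_bounded:
  fixes h :: "real \<Rightarrow> 'a :: real_normed_vector"
  assumes "periodic h" "continuous_on UNIV h"
  obtains B where "B > 0" "\<And>x. norm (h x) \<le> B"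
proof -
  have "compact (h ` {0..L})"
    by (intro compact_continuous_image continuous_on_subset[OF assms(2)]) auto
  then have "bounded (h ` {0..L})" by (rule compact_imp_bounded)
  then obtain B where B: "B > 0" "\<And>y. y \<in> {0..L} \<Longrightarrow> norm (h y) \<le> B"
    unfolding bounded_pos by auto
  have "norm (h x) \<le> B" for x
  proof -
    obtain y n where "y \<in> {0..<L}" "x = y + of_int n * L" using periodic_reduce by blast
    then show ?thesis using B(2)[of y] periodic_int[OF assms(1), of y n] by auto
  qed
  with B(1) that show ?thesis by blast
qed

text \<open>The exceptional set is covered by the translates, by integer multiples of
  \<open>L\<close>, of one null set. This relates the nontriviality of the eigenfunction, stated on
  the whole line, to a single period.\<close>

lemma AE_mu_imp_AE_lborel:
  assumes "AE x in mu. P x" "periodic P"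
  shows "AE x in lborel. P x"
proof -
  from assms(1) have "AE x in lborel. x \<in> {0..L} \<longrightarrow> P x"
    unfolding mu_def by (subst (asm) AE_restrict_space_iff) auto
  then obtain N where N: "N \<in> null_sets lborel" "{x. \<not> (x \<in> {0..L} \<longrightarrow> P x)} \<subseteq> N"
    unfolding eventually_ae_filter by auto
  have "(\<Union>n::int. {x. x - of_int n * L \<in> N}) \<in> null_sets lborel"
    by (intro null_sets_UN null_sets_translation N)
  moreover have "{x \<in> space lborel. \<not> P x} \<subseteq> (\<Union>n::int. {x. x - of_int n * L \<in> N})"
  proof
    fix x assume x: "x \<in> {x \<in> space lborel. \<not> P x}"
    obtain y n where y: "y \<in> {0..<L}" "x = y + of_int n * L" using periodic_reduce by blast
    then have "\<not> P y" using x periodic_int[OF assms(2), of y n] by auto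
    then have "y \<in> N" using N(2) y(1) by auto
    then show "x \<in> (\<Union>n::int. {x. x - of_int n * L \<in> N})" using y(2) by (intro UN_I[of n]) auto
  qed
  ultimately show ?thesis unfolding eventually_ae_filter by blast
qed

lemma antiderivative_exists:
  fixes h :: "real \<Rightarrow> 'a :: euclidean_space"
  assumes "continuous_on UNIV h"
  obtains F where "\<And>x. (F has_vector_derivative h x) (at x)"
  using einterval_antiderivative[of "-\<infinity>" "\<infinity>" h] assms
  by (auto simp: continuous_on_eq_continuous_at)

text \<open>\<open>F (y + L) - F y\<close> has derivative zero, so the increment of an
  antiderivative over a period does not depend on where the period starts.\<close>

lemma integral_mu_shift:
  fixes h :: "real \<Rightarrow> 'a :: euclidean_space"
  assumes "periodic h" "continuous_on UNIV h"
  shows "integral\<^sup>L mu (\<lambda>x. h (x + r)) = integral\<^sup>L mu h"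
proof -
  obtain F where F: "\<And>x. (F has_vector_derivative h x) (at x)"
    using antiderivative_exists[OF assms(2)] by blast
  have sh: "((\<lambda>y. F (y + a)) has_vector_derivative h (x + a)) (at x)" for x a
  proof -
    have "((\<lambda>y. y + a) has_vector_derivative 1) (at x)" by (auto intro!: derivative_eq_intros)
    from vector_diff_chain_at[OF this F] show ?thesis by (simp add: o_def)
  qed
  have c: "continuous_on UNIV (\<lambda>x. h (x + r))"
    by (intro continuous_on_compose2[OF assms(2)] continuous_intros) auto
  have "((\<lambda>y. F (y + L) - F y) has_vector_derivative 0) (at x within UNIV)" for x
    using has_vector_derivative_diff[OF sh[of L x] F[of x]] assms(1) by (simp add: periodic_def)
  then obtain b where "\<And>y. F (y + L) - F y = b"
    using has_vector_derivative_zero_constant[of UNIV "\<lambda>y. F (y + L) - F y"] by auto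
  then have "F (r + L) - F r = F (0 + L) - F 0" by metis
  moreover have "integral\<^sup>L mu (\<lambda>x. h (x + r)) = F (L + r) - F (0 + r)"
    by (rule integral_mu_FTC[OF sh c])
  moreover have "integral\<^sup>L mu h = F L - F 0"
    by (rule integral_mu_FTC[OF F assms(2)])
  ultimately show ?thesis by (simp add: add.commute)
qed

section \<open>Exponential monomials and trigonometric polynomials\<close>

definition e :: "int \<Rightarrow> real \<Rightarrow> complex" where
  "e k x = cis (2 * pi * real_of_int k * x / L)"

lemma norm_e [simp]: "norm (e k x) = 1"
  by (simp add: e_def)

lemma e_0 [simp]: "e 0 x = 1"
  by (simp add: e_def)

lemma e_at_0 [simp]: "e k 0 = 1"
  by (simp add: e_def)

lemma e_mult: "e j x * e k x = e (j + k) x"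
  by (simp add: e_def cis_mult add_divide_distrib distrib_left distrib_right)

lemma e_cnj: "cnj (e k x) = e (- k) x"
  by (simp add: e_def cis_cnj)

lemma e_periodic: "e k (x + L) = e k x"
proof -
  have "e k (x + L) = cis (2 * pi * real_of_int k * x / L + 2 * pi * real_of_int k)"
    using L_pos by (simp add: e_def field_simps)
  also have "\<dots> = e k x"
    unfolding e_def cis_mult[symmetric] by (simp add: cis_multiple_2pi)
  finally show ?thesis .
qed

lemma e_at_L [simp]: "e k L = 1"
  using e_periodic[of k 0] by simp

text \<open>The angular frequency of the first mode: differentiation multiplies the
  \<open>k\<close>-th Fourier coefficient by \<open>\<i> * w * k\<close>, whereas the Sobolev
  weights use the bare integer \<open>k\<close>.\<close>

definition w :: real where "w = 2 * pi / L"

lemma w_pos: "w > 0" using L_pos by (simp add: w_def)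

lemma e_deriv: "(e k has_vector_derivative \<i> * of_real (w * of_int k) * e k x) (at x)"
proof -
  have "((\<lambda>x. exp (\<i> * of_real (w * of_int k) * of_real x)) has_vector_derivative
     \<i> * of_real (w * of_int k) * exp (\<i> * of_real (w * of_int k) * of_real x)) (at x)"
    by (rule has_vector_derivative_real_field) (auto intro!: derivative_eq_intros)
  moreover have "e k = (\<lambda>x. exp (\<i> * of_real (w * of_int k) * of_real x))"
    by (auto simp: e_def cis_conv_exp w_def field_simps)
  ultimately show ?thesis by simp
qed

lemma e_cont: "continuous_on UNIV (e k)"
  by (rule continuous_at_imp_continuous_on) (auto intro: has_vector_derivative_continuous[OF e_deriv])

lemma integral_e: "integral\<^sup>L mu (e k) = (if k = 0 then of_real L else 0)"
proof (cases "k = 0")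
  case True
  have "e k = (\<lambda>x. 1)" using True by (auto simp: e_def)
  then show ?thesis using True by (simp add: scaleR_conv_of_real)
next
  case False
  then have nz: "\<i> * of_real (w * of_int k) \<noteq> 0" using w_pos by simp
  have "integral\<^sup>L mu (\<lambda>x. \<i> * of_real (w * of_int k) * e k x) = e k L - e k 0"
    by (rule integral_mu_FTC[OF e_deriv]) (auto intro!: continuous_intros e_cont)
  then have "\<i> * of_real (w * of_int k) * integral\<^sup>L mu (e k) = 0" by simp
  then show ?thesis using nz False by simp
qed

lemma fourier_coeff_mu:
  "fourier_coeff L u k = (1 / of_real L) * integral\<^sup>L mu (\<lambda>x. u x * e (- k) x)"
  unfolding fourier_coeff_def LINT_mu by (simp add: e_def)

text \<open>Finite sums of monomials without a record of the coefficients; each closure property is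
  then a short induction.\<close>

inductive trig :: "(real \<Rightarrow> complex) \<Rightarrow> bool" where
  trig_e: "trig (\<lambda>x. a * e k x)"
| trig_add: "trig p \<Longrightarrow> trig q \<Longrightarrow> trig (\<lambda>x. p x + q x)"

lemma trig_const: "trig (\<lambda>x. a)"
  using trig_e[of a 0] by simp

lemma trig_mult_e: "trig p \<Longrightarrow> trig (\<lambda>x. (a * e k x) * p x)"
proof (induction rule: trig.induct)
  case (trig_e b j)
  then show ?case using trig.trig_e[of "a * b" "k + j"] by (simp add: e_mult[symmetric] mult_ac)
qed (auto simp: distrib_left intro: trig.trig_add)

lemma trig_mult: "trig p \<Longrightarrow> trig q \<Longrightarrow> trig (\<lambda>x. p x * q x)"
  by (induction rule: trig.induct) (auto simp: distrib_right intro: trig.trig_add trig_mult_e)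

lemma trig_cmult: "trig p \<Longrightarrow> trig (\<lambda>x. a * p x)"
  using trig_mult[OF trig_const] .

lemma trig_periodic: "trig p \<Longrightarrow> periodic p"
  by (induction rule: trig.induct) (auto simp: periodic_def e_periodic)

lemma trig_deriv: "trig p \<Longrightarrow> \<exists>p'. trig p' \<and> (\<forall>x. (p has_vector_derivative p' x) (at x))"
proof (induction rule: trig.induct)
  case (trig_e a k)
  have "trig (\<lambda>x. a * (\<i> * of_real (w * of_int k)) * e k x)" by (rule trig.trig_e)
  moreover have "((\<lambda>x. a * e k x) has_vector_derivative a * (\<i> * of_real (w * of_int k)) * e k x) (at x)" for x
    unfolding mult.assoc by (rule has_vector_derivative_mult_right) (use e_deriv in \<open>simp add: mult_ac\<close>)
  ultimately show ?case by blast
next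
  case (trig_add p q)
  then obtain p' q' where "trig p'" "trig q'" "\<And>x. (p has_vector_derivative p' x) (at x)"
     "\<And>x. (q has_vector_derivative q' x) (at x)" by blast
  then show ?case
    by (intro exI[of _ "\<lambda>x. p' x + q' x"] conjI allI trig.trig_add has_vector_derivative_add) auto
qed

lemma trig_cont: "trig p \<Longrightarrow> continuous_on UNIV p"
  by (induction rule: trig.induct) (auto intro!: continuous_intros e_cont)

text \<open>The mode \<open>k = 0\<close> has no periodic antiderivative, so its coefficient
  \<open>m\<close> is subtracted; every other mode is divided by
  \<open>\<i> * w * k\<close>.\<close>

lemma trig_antideriv:
  "trig p \<Longrightarrow> \<exists>m P. trig P \<and> (\<forall>x. (P has_vector_derivative p x - m) (at x))"
proof (induction rule: trig.induct)
  case (trig_e a k)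
  show ?case
  proof (cases "k = 0")
    case True
    show ?thesis
      by (rule exI[of _ a], rule exI[of _ "\<lambda>x. 0"]) (use True trig_const in simp)
  next
    case False
    define b where "b = \<i> * of_real (w * of_int k)"
    have nz: "b \<noteq> 0" using w_pos False by (simp add: b_def)
    have "((\<lambda>x. a / b * e k x) has_vector_derivative a / b * (b * e k x)) (at x)" for x
      by (rule has_vector_derivative_mult_right) (use e_deriv in \<open>simp add: mult_ac b_def\<close>)
    then have "((\<lambda>x. a / b * e k x) has_vector_derivative a * e k x - 0) (at x)" for x
      using nz by simp
    then show ?thesis using trig.trig_e by blast
  qed
next
  case (trig_add p q)
  then obtain m P n Q where "trig P" "trig Q" "\<And>x. (P has_vector_derivative p x - m) (at x)"
     "\<And>x. (Q has_vector_derivative q x - n) (at x)" by blast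
  moreover from this have "((\<lambda>x. P x + Q x) has_vector_derivative (p x + q x) - (m + n)) (at x)" for x
    by (auto intro!: derivative_eq_intros)
  ultimately show ?case
    by (intro exI[of _ "m + n"] exI[of _ "\<lambda>x. P x + Q x"] conjI allI trig.trig_add) auto
qed

text \<open>Equality of \<open>e 1\<close> forces \<open>x - y\<close> to be an integer multiple of
  \<open>L\<close>; inside one closed period this leaves \<open>x = y\<close> or the two endpoints,
  where \<open>h\<close> agrees. Hence such an \<open>h\<close> descends to the unit circle.\<close>

lemma e_1_eqD:
  assumes "e 1 x = e 1 y" "x \<in> {0..L}" "y \<in> {0..L}" "h 0 = h L"
  shows "h x = h y"
proof -
  from assms(1) have "cis (w * x - w * y) = 1"
    by (simp add: e_def w_def cis_divide[symmetric] diff_divide_distrib)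
  then obtain n :: int where "w * x - w * y = of_int n * 2 * pi"
    by (auto simp: complex_eq_iff cos_one_2pi_int)
  then have "w * x = w * (y + of_int n * L)" using L_pos by (simp add: w_def field_simps)
  then have n: "x = y + of_int n * L" using w_pos by simp
  then have "of_int n * L \<le> 1 * L" "(-1) * L \<le> of_int n * L" using assms(2,3) by auto
  then have "real_of_int n \<le> 1" "-1 \<le> real_of_int n" using L_pos mult_le_cancel_right_pos by blast+
  then have "n = 0 \<or> n = 1 \<or> n = -1" by linarith
  then show ?thesis
  proof (elim disjE)
    assume "n = 1"
    then have "x = L" "y = 0" using n assms(2,3) by auto
    then show ?thesis using assms by simp
  next
    assume "n = -1"
    then have "x = 0" "y = L" using n assms(2,3) by auto
    then show ?thesis using assms by simp
  qed (use n in simp)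
qed

text \<open>A real linear form on the plane is a combination of \<open>z\<close> and its conjugate,
  that is, of \<open>e 1\<close> and \<open>e (-1)\<close> on the circle; sums and products stay
  trigonometric.\<close>

lemma real_polynomial_trig:
  assumes "real_polynomial_function g"
  shows "trig (\<lambda>x. of_real (g (e 1 x)))"
  using assms
proof (induction rule: real_polynomial_function.induct)
  case (linear h)
  interpret bounded_linear h by fact
  have h: "h z = Re z * h 1 + Im z * h \<i>" for z
  proof -
    have "z = Re z *\<^sub>R 1 + Im z *\<^sub>R \<i>" by (simp add: complex_eq_iff)
    then have "h z = h (Re z *\<^sub>R 1 + Im z *\<^sub>R \<i>)" by simp
    then show ?thesis by (simp add: add scale)
  qed
  have "complex_of_real (h (e 1 x)) = (h 1 / 2 - \<i> * h \<i> / 2) * e 1 x + (h 1 / 2 + \<i> * h \<i> / 2) * e (-1) x" for x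
    unfolding h[of "e 1 x"] e_cnj[symmetric] by (simp add: complex_eq_iff field_simps)
  then show ?case using trig_add[OF trig_e trig_e] by simp
next
  case (const c) then show ?case by (rule trig_const)
qed (auto intro: trig_add trig_mult)

text \<open>The function is moved to the circle traced by \<open>e 1\<close>, approximated there by
  a real polynomial in the plane, and pulled back.\<close>

lemma Stone_Weierstrass_trig:
  fixes h :: "real \<Rightarrow> real"
  assumes "h 0 = h L" "continuous_on {0..L} h" "0 < d"
  shows "\<exists>q. trig q \<and> (\<forall>x\<in>{0..L}. norm (of_real (h x) - q x) < d)"
proof -
  define S where "S = e 1 ` {0..L}"
  define H where "H z = h (SOME x. x \<in> {0..L} \<and> e 1 x = z)" for z
  have H: "H (e 1 x) = h x" if "x \<in> {0..L}" for x
  proof -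
    have "(SOME y. y \<in> {0..L} \<and> e 1 y = e 1 x) \<in> {0..L} \<and> e 1 (SOME y. y \<in> {0..L} \<and> e 1 y = e 1 x) = e 1 x"
      by (rule someI[of _ x]) (use that in simp)
    then show ?thesis unfolding H_def using e_1_eqD[where h = h, OF _ _ that assms(1)] by blast
  qed
  \<comment> \<open>\<open>e 1\<close> is a closed map on the compact period: the preimage of a
    closed set under \<open>H\<close> is the image of a compact set.\<close>
  have "continuous_on S H"
  proof (subst continuous_on_closed_vimage)
    show "closed S" unfolding S_def
      by (intro compact_imp_closed compact_continuous_image continuous_on_subset[OF e_cont]) auto
    show "\<forall>B. closed B \<longrightarrow> closed (H -` B \<inter> S)"
    proof (intro allI impI)
      fix B :: "real set" assume "closed B"
      then have "closed (h -` B \<inter> {0..L})"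
        using assms(2) by (simp add: continuous_on_closed_vimage)
      then have "compact ((h -` B \<inter> {0..L}) \<inter> {0..L})" by (intro closed_Int_compact) auto
      then have "compact (e 1 ` ((h -` B) \<inter> {0..L}))"
        by (intro compact_continuous_image continuous_on_subset[OF e_cont]) (auto simp: Int_assoc)
      moreover have "e 1 ` ((h -` B) \<inter> {0..L}) = H -` B \<inter> S" by (auto simp: S_def H)
      ultimately show "closed (H -` B \<inter> S)" by (simp add: compact_imp_closed)
    qed
  qed
  moreover have "compact S" unfolding S_def
      by (intro compact_continuous_image continuous_on_subset[OF e_cont]) auto
  ultimately obtain g where g: "real_polynomial_function g" "\<And>z. z \<in> S \<Longrightarrow> \<bar>H z - g z\<bar> < d"
    using Stone_Weierstrass_real_polynomial_function[OF _ _ assms(3), of S H] by blast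
  have "norm (of_real (h x) - complex_of_real (g (e 1 x))) < d" if "x \<in> {0..L}" for x
  proof -
    have "\<bar>H (e 1 x) - g (e 1 x)\<bar> < d" using g(2)[of "e 1 x"] that by (simp add: S_def)
    then show ?thesis unfolding H[OF that] of_real_diff[symmetric] norm_of_real .
  qed
  with real_polynomial_trig[OF g(1)] show ?thesis by blast
qed

subsection \<open>Fourier coefficients of square integrable functions\<close>

lemma integrable_bounded_mult:
  fixes h :: "real \<Rightarrow> complex"
  assumes "integrable mu h" "q \<in> borel_measurable mu" "\<And>x. x \<in> {0..L} \<Longrightarrow> norm (q x) \<le> B"
  shows "integrable mu (\<lambda>x. h x * q x)"
proof (rule Bochner_Integration.integrable_bound)
  show "integrable mu (\<lambda>x. B * norm (h x))" using assms(1) by simp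
  show "(\<lambda>x. h x * q x) \<in> borel_measurable mu" using assms by simp
  show "AE x in mu. norm (h x * q x) \<le> norm (B * norm (h x))"
  proof (rule AE_I2)
    fix x assume "x \<in> space mu"
    then have "norm (h x * q x) \<le> norm (h x) * B"
      by (simp add: norm_mult mult_left_mono assms(3))
    also have "\<dots> \<le> norm (B * norm (h x))" by (simp add: mult.commute)
    finally show "norm (h x * q x) \<le> norm (B * norm (h x))" .
  qed
qed

lemma integrable_mult_e: "integrable mu h \<Longrightarrow> integrable mu (\<lambda>x. h x * e k x)"
  by (rule integrable_bounded_mult[where B = 1]) (auto intro: measurable_mu_cont e_cont)

lemma measurable_mu_cont_on:
  fixes q :: "real \<Rightarrow> 'a :: topological_space"
  shows "continuous_on {0..L} q \<Longrightarrow> q \<in> borel_measurable mu"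
  using borel_measurable_continuous_on_restrict[of "{0..L}" q]
    measurable_cong_sets[OF sets_restrict_space_cong[OF sets_lborel] refl]
  unfolding mu_def by blast

lemma integrable_mult_cont:
  fixes h q :: "real \<Rightarrow> complex"
  assumes "integrable mu h" "continuous_on {0..L} q"
  shows "integrable mu (\<lambda>x. h x * q x)"
proof -
  have "bounded (q ` {0..L})"
    by (intro compact_imp_bounded compact_continuous_image assms) auto
  then obtain B where "\<And>x. x \<in> {0..L} \<Longrightarrow> norm (q x) \<le> B"
    unfolding bounded_iff by blast
  then show ?thesis by (rule integrable_bounded_mult[OF assms(1) measurable_mu_cont_on[OF assms(2)]])
qed

lemma trig_cont_on: "trig q \<Longrightarrow> continuous_on A q"
  using trig_cont continuous_on_subset by blast

lemma integral_mult_trig_0: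
  assumes "integrable mu h" "\<And>k. integral\<^sup>L mu (\<lambda>x. h x * e k x) = 0" "trig q"
  shows "integral\<^sup>L mu (\<lambda>x. h x * q x) = 0"
  using assms(3)
proof (induction rule: trig.induct)
  case (trig_e a k)
  have "integral\<^sup>L mu (\<lambda>x. h x * (a * e k x)) = integral\<^sup>L mu (\<lambda>x. a * (h x * e k x))"
    by (simp add: mult_ac)
  then show ?case using assms(2) by simp
next
  case (trig_add p q)
  have "integrable mu (\<lambda>x. h x * p x)" "integrable mu (\<lambda>x. h x * q x)"
    using integrable_mult_cont assms(1) trig_add.hyps trig_cont_on by blast+
  with trig_add show ?case by (simp add: distrib_left)
qed

text \<open>Uniform approximation suffices for a merely integrable \<open>h\<close>, since the error
  is at most the sup distance times the integral of \<open>norm (h x)\<close>.\<close>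

lemma integral_mult_cont_0:
  fixes q :: "real \<Rightarrow> real"
  assumes h: "integrable mu h" "\<And>k. integral\<^sup>L mu (\<lambda>x. h x * e k x) = 0"
    and q: "q 0 = q L" "continuous_on {0..L} q"
  shows "integral\<^sup>L mu (\<lambda>x. h x * of_real (q x)) = 0"
proof -
  define N where "N = integral\<^sup>L mu (\<lambda>x. norm (h x))"
  have "N \<ge> 0" by (simp add: N_def)
  have "norm (integral\<^sup>L mu (\<lambda>x. h x * of_real (q x))) \<le> d" if "d > 0" for d
  proof -
    \<comment> \<open>\<open>N + 1\<close> rather than \<open>N\<close>, which may vanish.\<close>
    define d' where "d' = d / (N + 1)"
    have "d' > 0" using that \<open>N \<ge> 0\<close> by (simp add: d'_def)
    then obtain p where p: "trig p" "\<And>x. x \<in> {0..L} \<Longrightarrow> norm (of_real (q x) - p x) < d'"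
      using Stone_Weierstrass_trig[OF q] by blast
    have i1: "integrable mu (\<lambda>x. h x * of_real (q x))"
      by (rule integrable_mult_cont[OF h(1)]) (intro continuous_intros q)
    have i2: "integrable mu (\<lambda>x. h x * p x)"
      by (rule integrable_mult_cont[OF h(1) trig_cont_on[OF p(1)]])
    have "integral\<^sup>L mu (\<lambda>x. h x * of_real (q x)) = integral\<^sup>L mu (\<lambda>x. h x * of_real (q x)) - integral\<^sup>L mu (\<lambda>x. h x * p x)"
      using integral_mult_trig_0[OF h p(1)] by simp
    also have "\<dots> = integral\<^sup>L mu (\<lambda>x. h x * (of_real (q x) - p x))"
      using i1 i2 by (simp add: right_diff_distrib)
    finally have "norm (integral\<^sup>L mu (\<lambda>x. h x * of_real (q x))) \<le> integral\<^sup>L mu (\<lambda>x. norm (h x * (of_real (q x) - p x)))"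
      by simp
    also have "\<dots> \<le> integral\<^sup>L mu (\<lambda>x. d' * norm (h x))"
    proof (rule integral_mono)
      have "integrable mu (\<lambda>x. h x * of_real (q x) - h x * p x)" using i1 i2 by simp
      then show "integrable mu (\<lambda>x. norm (h x * (of_real (q x) - p x)))"
        by (intro integrable_norm) (simp add: right_diff_distrib)
      show "integrable mu (\<lambda>x. d' * norm (h x))" using h(1) by simp
      fix x assume "x \<in> space mu"
      then show "norm (h x * (of_real (q x) - p x)) \<le> d' * norm (h x)"
        using p(2)[of x] by (simp add: norm_mult mult.commute[of d'] mult_left_mono less_imp_le)
    qed
    also have "\<dots> = d' * N" by (simp add: N_def)
    also have "\<dots> \<le> d" using \<open>N \<ge> 0\<close> that by (simp add: d'_def field_simps)
    finally show ?thesis .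
  qed
  then have "norm (integral\<^sup>L mu (\<lambda>x. h x * of_real (q x))) \<le> 0" by (rule field_le_epsilon[of _ 0, simplified])
  then show ?thesis by simp
qed

text \<open>An integral over the whole period cut off by an indicator, rather than one over a
  variable interval, so that Fubini applies directly in \<open>prim_mult_e\<close>.\<close>

definition prim :: "(real \<Rightarrow> 'a :: {banach, second_countable_topology}) \<Rightarrow> real \<Rightarrow> 'a" where
  "prim h x = integral\<^sup>L mu (\<lambda>y. indicator {..x} y *\<^sub>R h y)"

lemma integrable_indicator_mu:
  fixes h :: "real \<Rightarrow> 'a :: {banach, second_countable_topology}"
  assumes "integrable mu h" "A \<in> sets borel"
  shows "integrable mu (\<lambda>y. indicator A y *\<^sub>R h y)"
proof (rule Bochner_Integration.integrable_bound[OF assms(1)])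
  show "(\<lambda>y. indicator A y *\<^sub>R h y) \<in> borel_measurable mu"
    using assms
    by (intro borel_measurable_scaleR measurable_mu[OF borel_measurable_indicator] borel_measurable_integrable) auto
qed (auto simp: indicator_def)

lemma integral_e_tail:
  assumes "y \<in> {0..L}"
  shows "of_real (w * of_int k) * \<i> * integral\<^sup>L mu (\<lambda>x. indicator {y..} x *\<^sub>R e k x) = 1 - e k y"
proof -
  have "integral\<^sup>L mu (\<lambda>x. indicator {y..} x *\<^sub>R (\<i> * of_real (w * of_int k) * e k x))
     = integral\<^sup>L lborel (\<lambda>x. indicator {y..L} x *\<^sub>R (\<i> * of_real (w * of_int k) * e k x))"
    unfolding mu_def using assms
    by (subst integral_restrict_space) (auto intro!: Bochner_Integration.integral_cong simp: indicator_def)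
  also have "\<dots> = e k L - e k y"
    by (rule integral_FTC_Icc[OF _ has_vector_derivative_at_within[OF e_deriv]])
       (use assms in \<open>auto intro!: continuous_intros continuous_on_subset[OF e_cont]\<close>)
  finally have "integral\<^sup>L mu (\<lambda>x. \<i> * of_real (w * of_int k) * (indicator {y..} x *\<^sub>R e k x)) = 1 - e k y"
    by (simp only: mult_scaleR_right e_at_L)
  then show ?thesis by (simp only: integral_mult_right_zero mult_ac)
qed

text \<open>Integration by parts for an \<open>h\<close> that is only integrable, by Fubini on the
  triangle \<open>y \<le> x\<close>. The inner integral of \<open>e k\<close> from \<open>y\<close>
  to \<open>L\<close> supplies \<open>1 - e k y\<close>, and the summand 1 becomes the integral of
  \<open>h\<close>.\<close>

lemma prim_mult_e:
  fixes h :: "real \<Rightarrow> complex"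
  assumes "integrable mu h"
  shows "of_real (w * of_int k) * \<i> * integral\<^sup>L mu (\<lambda>x. prim h x * e k x)
    = integral\<^sup>L mu h - integral\<^sup>L mu (\<lambda>x. h x * e k x)"
proof -
  interpret pp: pair_sigma_finite mu mu ..
  have sets_mu [measurable_cong]: "sets mu = sets (restrict_space borel {0..L})"
    unfolding mu_def by (rule sets_restrict_space_cong) simp
  have [measurable]: "h \<in> borel_measurable mu" using assms by simp
  have [measurable]: "e k \<in> borel_measurable mu" by (intro measurable_mu_cont e_cont)
  have idm [measurable]: "(\<lambda>x. x) \<in> borel_measurable mu" by (intro measurable_mu) simp
  have m: "(\<lambda>(x, y). (if y \<le> x then h y * e k x else 0)) \<in> borel_measurable (mu \<Otimes>\<^sub>M mu)"
    by measurable
  have int: "integrable (mu \<Otimes>\<^sub>M mu) (\<lambda>(x, y). (if y \<le> x then h y * e k x else 0))"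
  proof (rule Bochner_Integration.integrable_bound)
    show "integrable (mu \<Otimes>\<^sub>M mu) (\<lambda>(x, y). h y)"
      by (rule pp.Fubini_integrable) (use assms in \<open>auto simp: case_prod_beta\<close>)
    show "AE x in mu \<Otimes>\<^sub>M mu. norm (case x of (x, y) \<Rightarrow> if y \<le> x then h y * e k x else 0)
       \<le> norm (case x of (x, y) \<Rightarrow> h y)"
      by (rule AE_I2) (auto simp: norm_mult)
  qed (rule m)
  have "integral\<^sup>L mu (\<lambda>x. prim h x * e k x) = integral\<^sup>L mu (\<lambda>x. integral\<^sup>L mu (\<lambda>y. if y \<le> x then h y * e k x else 0))"
  proof (rule Bochner_Integration.integral_cong[OF refl])
    fix x
    have "prim h x * e k x = integral\<^sup>L mu (\<lambda>y. (indicator {..x} y *\<^sub>R h y) * e k x)"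
      unfolding prim_def integral_mult_left_zero ..
    also have "\<dots> = integral\<^sup>L mu (\<lambda>y. if y \<le> x then h y * e k x else 0)"
      by (rule Bochner_Integration.integral_cong) (auto simp: indicator_def)
    finally show "prim h x * e k x = integral\<^sup>L mu (\<lambda>y. if y \<le> x then h y * e k x else 0)" .
  qed
  also have "\<dots> = integral\<^sup>L mu (\<lambda>y. integral\<^sup>L mu (\<lambda>x. if y \<le> x then h y * e k x else 0))"
    using pp.Fubini_integral[OF int] by simp
  also have "\<dots> = integral\<^sup>L mu (\<lambda>y. h y * integral\<^sup>L mu (\<lambda>x. indicator {y..} x *\<^sub>R e k x))"
  proof (rule Bochner_Integration.integral_cong[OF refl])
    fix y
    have "h y * integral\<^sup>L mu (\<lambda>x. indicator {y..} x *\<^sub>R e k x) = integral\<^sup>L mu (\<lambda>x. h y * (indicator {y..} x *\<^sub>R e k x))"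
      unfolding integral_mult_right_zero ..
    also have "\<dots> = integral\<^sup>L mu (\<lambda>x. if y \<le> x then h y * e k x else 0)"
      by (rule Bochner_Integration.integral_cong) (auto simp: indicator_def)
    finally show "integral\<^sup>L mu (\<lambda>x. if y \<le> x then h y * e k x else 0) = h y * integral\<^sup>L mu (\<lambda>x. indicator {y..} x *\<^sub>R e k x)" ..
  qed
  finally have "of_real (w * of_int k) * \<i> * integral\<^sup>L mu (\<lambda>x. prim h x * e k x)
     = integral\<^sup>L mu (\<lambda>y. of_real (w * of_int k) * \<i> * (h y * integral\<^sup>L mu (\<lambda>x. indicator {y..} x *\<^sub>R e k x)))"
    by simp
  also have "\<dots> = integral\<^sup>L mu (\<lambda>y. h y - h y * e k y)"
  proof (rule Bochner_Integration.integral_cong[OF refl])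
    fix y assume "y \<in> space mu"
    then have "of_real (w * of_int k) * \<i> * integral\<^sup>L mu (\<lambda>x. indicator {y..} x *\<^sub>R e k x) = 1 - e k y"
      by (intro integral_e_tail) simp
    then have "h y * (of_real (w * of_int k) * \<i> * integral\<^sup>L mu (\<lambda>x. indicator {y..} x *\<^sub>R e k x)) = h y * (1 - e k y)"
      by (rule arg_cong)
    then show "of_real (w * of_int k) * \<i> * (h y * integral\<^sup>L mu (\<lambda>x. indicator {y..} x *\<^sub>R e k x)) = h y - h y * e k y"
      by (simp only: mult_ac right_diff_distrib mult_1_right mult_1_left)
  qed
  also have "\<dots> = integral\<^sup>L mu h - integral\<^sup>L mu (\<lambda>x. h x * e k x)"
    using assms integrable_mult_e[OF assms] by simp
  finally show ?thesis .
qed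

lemma integral_indicator_HK:
  fixes h :: "real \<Rightarrow> complex"
  assumes "integrable mu h" "x \<in> {0..L}"
  shows "prim h x = integral {0..x} h" "h integrable_on {0..x}"
proof -
  have i: "set_integrable lborel {0..x} h"
    by (rule set_integrable_subset[of _ "{0..L}"]) (use assms in \<open>auto simp: set_integrable_mu\<close>)
  have "prim h x = (LINT y:{0..x}|lborel. h y)"
    unfolding prim_def mu_def set_lebesgue_integral_def using assms
    by (subst integral_restrict_space) (auto intro!: Bochner_Integration.integral_cong simp: indicator_def)
  then show "prim h x = integral {0..x} h"
    using set_borel_integral_eq_integral(2)[OF i] by simp
  show "h integrable_on {0..x}" using set_borel_integral_eq_integral(1)[OF i] .
qed

lemma prim_cont:
  fixes h :: "real \<Rightarrow> complex"
  assumes "integrable mu h"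
  shows "continuous_on {0..L} (prim h)"
proof -
  have "continuous_on {0..L} (\<lambda>x. integral {0..x} h)"
    by (rule indefinite_integral_continuous_1) (use integral_indicator_HK(2)[OF assms, of L] L_pos in simp)
  then show ?thesis
    by (rule continuous_on_eq) (use integral_indicator_HK(1)[OF assms] in simp)
qed

text \<open>The half-lines generate the Borel sets and are stable under intersection, so a Dynkin
  argument carries the vanishing of the integrals from half-lines to all Borel sets.\<close>

lemma AE_zero_if_prim_zero:
  fixes h :: "real \<Rightarrow> complex"
  assumes h: "integrable mu h" and z: "\<And>x. x \<in> {0..L} \<Longrightarrow> prim h x = 0"
  shows "AE x in mu. h x = 0"
proof (rule mu.density_zero[OF h])
  have zero: "prim h x = 0" for x
  proof -
    consider "x < 0" | "x \<in> {0..L}" | "x > L" by fastforce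
    then show ?thesis
    proof cases
      case 1
      have "prim h x = integral\<^sup>L mu (\<lambda>y. 0)" unfolding prim_def
        by (rule Bochner_Integration.integral_cong) (use 1 in \<open>auto simp: indicator_def\<close>)
      then show ?thesis by simp
    next
      case 3
      have "prim h x = prim h L" unfolding prim_def
        by (rule Bochner_Integration.integral_cong) (use 3 in \<open>auto simp: indicator_def\<close>)
      then show ?thesis using z[of L] L_pos by simp
    qed (use z in auto)
  qed
  \<comment> \<open>The complement step of the Dynkin argument requires the total integral to
    vanish.\<close>
  have tot: "integral\<^sup>L mu h = 0"
  proof -
    have "prim h L = integral\<^sup>L mu h" unfolding prim_def
      by (rule Bochner_Integration.integral_cong) (auto simp: indicator_def)
    then show ?thesis using zero by simp
  qed
  have borel: "integral\<^sup>L mu (\<lambda>y. indicator A y *\<^sub>R h y) = 0" if "A \<in> sets borel" for A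
  proof -
    have "Int_stable (range (\<lambda>a::real. {..a}))" by (auto simp: Int_stable_def)
    moreover have "range (\<lambda>a::real. {..a}) \<subseteq> Pow UNIV" by simp
    moreover have "A \<in> sigma_sets UNIV (range (\<lambda>a::real. {..a}))"
      using that by (simp add: borel_eq_atMost)
    ultimately show ?thesis
    proof (induction rule: sigma_sets_induct_disjoint)
      case (basic A)
      then show ?case using zero by (auto simp: prim_def)
    next
      case empty then show ?case by simp
    next
      case (compl A)
      then have "A \<in> sets borel" by (simp add: borel_eq_atMost)
      have "integral\<^sup>L mu (\<lambda>y. indicator (UNIV - A) y *\<^sub>R h y) = integral\<^sup>L mu (\<lambda>y. h y - indicator A y *\<^sub>R h y)"
        by (rule Bochner_Integration.integral_cong) (auto simp: indicator_def)
      also have "\<dots> = 0"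
        using compl tot h integrable_indicator_mu[OF h \<open>A \<in> sets borel\<close>] by simp
      finally show ?case .
    next
      case (union A)
      have A: "A i \<in> sets borel" for i using union(2) by (auto simp: borel_eq_atMost)
      have meas: "A i \<inter> {0..L} \<in> sets mu" for i
        using A by (auto simp: mu_def sets_restrict_space)
      have "integral\<^sup>L mu (\<lambda>y. indicator (\<Union>i. A i) y *\<^sub>R h y) = (LINT y:(\<Union>i. A i \<inter> {0..L})|mu. h y)"
        unfolding set_lebesgue_integral_def by (rule Bochner_Integration.integral_cong) (auto simp: indicator_def)
      also have "\<dots> = (\<Sum>i. (LINT y:A i \<inter> {0..L}|mu. h y))"
      proof (rule lebesgue_integral_countable_add[OF meas])
        show "\<And>i j. i \<noteq> j \<Longrightarrow> (A i \<inter> {0..L}) \<inter> (A j \<inter> {0..L}) = {}"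
          using union(1) by (auto simp: disjoint_family_on_def)
        show "set_integrable mu (\<Union>i. A i \<inter> {0..L}) h"
          unfolding set_integrable_def by (rule integrable_mult_indicator[OF _ h]) (use meas in blast)
      qed
      also have "(\<lambda>i. (LINT y:A i \<inter> {0..L}|mu. h y)) = (\<lambda>i. 0)"
      proof
        fix i
        have "(LINT y:A i \<inter> {0..L}|mu. h y) = integral\<^sup>L mu (\<lambda>y. indicator (A i) y *\<^sub>R h y)"
          unfolding set_lebesgue_integral_def by (rule Bochner_Integration.integral_cong) (auto simp: indicator_def)
        then show "(LINT y:A i \<inter> {0..L}|mu. h y) = 0" using union(3) by simp
      qed
      finally show ?case by simp
    qed
  qed
  fix A assume "A \<in> sets mu"
  then obtain B where "B \<in> sets borel" "A = B \<inter> {0..L}"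
    unfolding mu_def by (auto simp: sets_restrict_space)
  then have "set_lebesgue_integral mu A h = integral\<^sup>L mu (\<lambda>y. indicator B y *\<^sub>R h y)"
    unfolding set_lebesgue_integral_def by (intro Bochner_Integration.integral_cong) (auto simp: indicator_def)
  then show "set_lebesgue_integral mu A h = 0" using borel \<open>B \<in> sets borel\<close> by simp
qed

lemma integral_mu_HK:
  fixes h :: "real \<Rightarrow> 'a :: euclidean_space"
  assumes "integrable mu h"
  shows "integral\<^sup>L mu h = integral {0..L} h"
  using set_borel_integral_eq_integral(2)[of "{0..L}" h] assms
  by (simp add: set_integrable_mu LINT_mu)

lemma integral_mu_eq_0_cont:
  fixes h :: "real \<Rightarrow> real"
  assumes "continuous_on {0..L} h" "\<And>x. x \<in> {0..L} \<Longrightarrow> 0 \<le> h x" "integral\<^sup>L mu h = 0" "x \<in> {0..L}"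
  shows "h x = 0"
proof -
  have "integrable mu h"
    using borel_integrable_compact[of "{0..L}" h] assms(1)
    by (simp add: mu_def integrable_restrict_space)
  then have "integral {0..L} h = 0" using assms(3) integral_mu_HK by metis
  then show ?thesis using integral_eq_0_iff[of 0 L h] assms L_pos by simp
qed

text \<open>The primitive of \<open>h\<close> minus its mean is continuous and has no Fourier coefficients either, so it
  vanishes because trigonometric polynomials are uniformly dense.\<close>

lemma fourier_unique:
  assumes h: "integrable mu h" and z: "\<And>k. integral\<^sup>L mu (\<lambda>x. h x * e k x) = 0"
  shows "AE x in mu. h x = 0"
proof -
  have tot: "integral\<^sup>L mu h = 0" using z[of 0] by simp
  \<comment> \<open>\<open>prim_mult_e\<close> gives no information for \<open>k = 0\<close>;
    subtracting the mean makes this coefficient vanish as well.\<close>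
  define m where "m = integral\<^sup>L mu (prim h) / of_real L"
  define H where "H x = prim h x - m" for x
  have Hc: "continuous_on {0..L} H" unfolding H_def by (intro continuous_intros prim_cont h)
  have Hi: "integrable mu H"
    using integrable_mult_cont[of "\<lambda>_. 1", OF _ Hc] by simp
  have "prim h L = integral\<^sup>L mu h"
    unfolding prim_def by (rule Bochner_Integration.integral_cong) (auto simp: indicator_def)
  then have ends: "prim h 0 = 0" "prim h L = 0"
    using integral_indicator_HK(1)[OF h, of 0] L_pos tot by simp_all
  have Pi: "integrable mu (prim h)"
    using integrable_mult_cont[of "\<lambda>_. 1", OF _ prim_cont[OF h]] by simp
  have Hz: "integral\<^sup>L mu (\<lambda>x. H x * e k x) = 0" for k
  proof (cases "k = 0")
    case True
    then show ?thesis using L_pos Pi by (simp add: H_def m_def scaleR_conv_of_real)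
  next
    case False
    have "of_real (w * of_int k) * \<i> * integral\<^sup>L mu (\<lambda>x. prim h x * e k x) = 0"
      using prim_mult_e[OF h, of k] tot z[of k] by simp
    then have "integral\<^sup>L mu (\<lambda>x. prim h x * e k x) = 0" using False w_pos by simp
    moreover have "integral\<^sup>L mu (\<lambda>x. m * e k x) = 0" using False integral_e by simp
    ultimately show ?thesis unfolding H_def left_diff_distrib
      by (subst Bochner_Integration.integral_diff) (auto intro!: integrable_mult_e Pi)
  qed
  \<comment> \<open>\<open>H\<close> is tested against its own real and imaginary parts, since the
    density result concerns real functions with equal end values. The two identities combine to the
    integral of \<open>(norm (H x))\<^sup>2\<close>.\<close>
  have "integral\<^sup>L mu (\<lambda>x. H x * of_real (Re (H x))) = 0" "integral\<^sup>L mu (\<lambda>x. H x * of_real (Im (H x))) = 0"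
    by (rule integral_mult_cont_0[OF Hi Hz]; use ends in \<open>auto simp: H_def intro!: continuous_intros prim_cont h\<close>)+
  then have "integral\<^sup>L mu (\<lambda>x. H x * of_real (Re (H x)) - \<i> * (H x * of_real (Im (H x)))) = 0"
    by (subst Bochner_Integration.integral_diff) (auto intro!: integrable_mult_cont Hi Hc continuous_intros)
  also have "(\<lambda>x. H x * of_real (Re (H x)) - \<i> * (H x * of_real (Im (H x)))) = (\<lambda>x. of_real ((norm (H x))\<^sup>2))"
    by (rule ext, rule complex_eqI) (simp_all add: cmod_power2, simp_all add: power2_eq_square)
  finally have "integral\<^sup>L mu (\<lambda>x. (norm (H x))\<^sup>2) = 0"
    by (simp only: integral_complex_of_real of_real_eq_0_iff)
  then have H0: "H x = 0" if "x \<in> {0..L}" for x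
    using integral_mu_eq_0_cont[of "\<lambda>x. (norm (H x))\<^sup>2" x] that continuous_on_power[OF continuous_on_norm[OF Hc], of 2] by simp
  have "prim h x = 0" if "x \<in> {0..L}" for x
  proof -
    \<comment> \<open>The primitive vanishes at 0, so the subtracted mean is itself 0.\<close>
    have "m = 0" using H0[of 0] ends L_pos by (simp add: H_def)
    then show ?thesis using H0[OF that] by (simp add: H_def)
  qed
  then show ?thesis by (rule AE_zero_if_prim_zero[OF h])
qed

section \<open>Square integrable periodic functions\<close>

lemma L2_mu:
  fixes u :: "real \<Rightarrow> 'a :: {banach, second_countable_topology}"
  shows "u \<in> L2_per L \<longleftrightarrow> u \<in> borel_measurable borel \<and> periodic u \<and> integrable mu (\<lambda>x. (norm (u x))\<^sup>2)"
  by (auto simp: L2_per_def periodic_def set_integrable_mu)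

lemma square_integrable_imp_integrable:
  fixes u :: "real \<Rightarrow> 'a :: {banach, second_countable_topology}"
  assumes "u \<in> borel_measurable mu" "integrable mu (\<lambda>x. (norm (u x))\<^sup>2)"
  shows "integrable mu u"
proof (rule Bochner_Integration.integrable_bound[of mu "\<lambda>x. 1 + (norm (u x))\<^sup>2"])
  show "AE x in mu. norm (u x) \<le> norm (1 + (norm (u x))\<^sup>2)"
  proof (rule AE_I2)
    fix x
    have "0 \<le> (norm (u x) - 1)\<^sup>2" by simp
    then have "2 * norm (u x) \<le> 1 + (norm (u x))\<^sup>2" by (simp add: power2_eq_square algebra_simps)
    moreover have "norm (1 + (norm (u x))\<^sup>2) = 1 + (norm (u x))\<^sup>2" by simp
    ultimately show "norm (u x) \<le> norm (1 + (norm (u x))\<^sup>2)"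
      using norm_ge_zero[of "u x"] by linarith
  qed
qed (use assms in auto)

lemma L2_integrable:
  fixes u :: "real \<Rightarrow> 'a :: {banach, second_countable_topology}"
  assumes "u \<in> L2_per L" shows "integrable mu u"
  using assms square_integrable_imp_integrable measurable_mu unfolding L2_mu by blast

lemma norm_add_square:
  fixes a b :: "'a :: real_normed_vector"
  shows "(norm (a + b))\<^sup>2 \<le> 2 * (norm a)\<^sup>2 + 2 * (norm b)\<^sup>2"
proof -
  have "(norm (a + b))\<^sup>2 \<le> (norm a + norm b)\<^sup>2" by (simp add: norm_triangle_ineq power_mono)
  also have "\<dots> \<le> 2 * (norm a)\<^sup>2 + 2 * (norm b)\<^sup>2"
    using sum_squares_bound[of "norm a" "norm b"] by (simp add: power2_sum)
  finally show ?thesis .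
qed

lemma square_integrable_add:
  fixes u v :: "real \<Rightarrow> 'a :: {banach, second_countable_topology}"
  assumes "u \<in> borel_measurable mu" "integrable mu (\<lambda>x. (norm (u x))\<^sup>2)"
    and "v \<in> borel_measurable mu" "integrable mu (\<lambda>x. (norm (v x))\<^sup>2)"
  shows "integrable mu (\<lambda>x. (norm (u x + v x))\<^sup>2)"
proof (rule Bochner_Integration.integrable_bound)
  show "integrable mu (\<lambda>x. 2 * (norm (u x))\<^sup>2 + 2 * (norm (v x))\<^sup>2)" using assms by simp
  show "AE x in mu. norm ((norm (u x + v x))\<^sup>2) \<le> norm (2 * (norm (u x))\<^sup>2 + 2 * (norm (v x))\<^sup>2)"
    using norm_add_square by (intro AE_I2) auto
qed (use assms in measurable)

lemma L2_add:
  fixes u v :: "real \<Rightarrow> 'a :: {banach, second_countable_topology}"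
  assumes "u \<in> L2_per L" "v \<in> L2_per L" shows "(\<lambda>x. u x + v x) \<in> L2_per L"
  using assms square_integrable_add[of u v] measurable_mu unfolding L2_mu periodic_def by auto

lemma L2_bounded_linear:
  fixes T :: "'a :: {banach, second_countable_topology} \<Rightarrow> 'b :: {banach, second_countable_topology}"
  assumes "bounded_linear T" "u \<in> L2_per L" shows "(\<lambda>x. T (u x)) \<in> L2_per L"
proof -
  interpret bounded_linear T by fact
  have m: "(\<lambda>x. T (u x)) \<in> borel_measurable borel"
    using assms(2) unfolding L2_mu
    by (auto intro: borel_measurable_continuous_on[OF continuous_on_subset[OF linear_continuous_on[OF assms(1)]]])
  obtain K where K: "\<And>x. norm (T x) \<le> norm x * K" "K > 0" using pos_bounded by blast
  have "integrable mu (\<lambda>x. (norm (T (u x)))\<^sup>2)"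
  proof (rule Bochner_Integration.integrable_bound[of mu "\<lambda>x. K\<^sup>2 * (norm (u x))\<^sup>2"])
    show "integrable mu (\<lambda>x. K\<^sup>2 * (norm (u x))\<^sup>2)" using assms(2) by (simp add: L2_mu)
    show "AE x in mu. norm ((norm (T (u x)))\<^sup>2) \<le> norm (K\<^sup>2 * (norm (u x))\<^sup>2)"
    proof (rule AE_I2)
      fix x
      have "(norm (T (u x)))\<^sup>2 \<le> (norm (u x) * K)\<^sup>2" by (intro power_mono K) auto
      then show "norm ((norm (T (u x)))\<^sup>2) \<le> norm (K\<^sup>2 * (norm (u x))\<^sup>2)"
        by (simp add: power_mult_distrib mult.commute)
    qed
    show "(\<lambda>x. (norm (T (u x)))\<^sup>2) \<in> borel_measurable mu"
      using measurable_mu[OF m] by simp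
  qed
  then show ?thesis using m assms(2) by (auto simp: L2_mu periodic_def)
qed

lemma L2_scaleR:
  fixes u :: "real \<Rightarrow> 'a :: {banach, second_countable_topology}"
  assumes "u \<in> L2_per L" shows "(\<lambda>x. c *\<^sub>R u x) \<in> L2_per L"
  by (rule L2_bounded_linear[OF bounded_linear_scaleR_right assms])

lemma L2_diff:
  fixes u v :: "real \<Rightarrow> 'a :: {banach, second_countable_topology}"
  assumes "u \<in> L2_per L" "v \<in> L2_per L" shows "(\<lambda>x. u x - v x) \<in> L2_per L"
  using L2_add[OF assms(1) L2_scaleR[OF assms(2), of "-1"]] by simp

lemma L2_cont:
  fixes u :: "real \<Rightarrow> 'a :: {banach, second_countable_topology}"
  assumes "periodic u" "continuous_on UNIV u" shows "u \<in> L2_per L"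
  unfolding L2_mu using assms
  by (auto intro!: borel_measurable_continuous_onI integrable_mu_cont continuous_intros)

text \<open>Expands the nonnegative integral of the squared deviation of
  \<open>\<bar>u x\<bar>\<close> from its mean \<open>A / L\<close>.\<close>

lemma Cauchy_Schwarz_1:
  fixes u :: "real \<Rightarrow> real"
  assumes "u \<in> borel_measurable mu" "integrable mu (\<lambda>x. (u x)\<^sup>2)"
  shows "integral\<^sup>L mu (\<lambda>x. \<bar>u x\<bar>) \<le> sqrt L * sqrt (integral\<^sup>L mu (\<lambda>x. (u x)\<^sup>2))"
proof -
  have i: "integrable mu (\<lambda>x. \<bar>u x\<bar>)"
    using square_integrable_imp_integrable[of u] assms by simp
  define A where "A = integral\<^sup>L mu (\<lambda>x. \<bar>u x\<bar>)"
  define B where "B = integral\<^sup>L mu (\<lambda>x. (u x)\<^sup>2)"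
  have "0 \<le> integral\<^sup>L mu (\<lambda>x. (\<bar>u x\<bar> - A / L)\<^sup>2)" by simp
  also have "\<dots> = integral\<^sup>L mu (\<lambda>x. (u x)\<^sup>2 - (2 * A / L) * \<bar>u x\<bar> + (A / L)\<^sup>2)"
    by (simp add: power2_diff algebra_simps)
  also have "\<dots> = B - (2 * A / L) * A + L * (A / L)\<^sup>2"
    using assms i by (simp add: A_def B_def)
  also have "\<dots> = B - A\<^sup>2 / L" using L_pos by (simp add: power2_eq_square field_simps)
  finally have "A\<^sup>2 \<le> L * B" using L_pos by (simp add: field_simps)
  then have "A \<le> sqrt (L * B)" by (rule real_le_rsqrt)
  then show ?thesis by (simp add: A_def B_def real_sqrt_mult)
qed

section \<open>Orthogonality, Bessel, Riesz-Fischer and Parseval\<close>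

lemma integral_mult_cnj_trig:
  assumes "integrable mu u" "finite F"
  shows "integral\<^sup>L mu (\<lambda>x. u x * cnj (\<Sum>k\<in>F. c k * e k x)) = of_real L * (\<Sum>k\<in>F. cnj (c k) * fourier_coeff L u k)"
proof -
  have "integral\<^sup>L mu (\<lambda>x. u x * cnj (\<Sum>k\<in>F. c k * e k x)) = integral\<^sup>L mu (\<lambda>x. \<Sum>k\<in>F. cnj (c k) * (u x * e (- k) x))"
    by (simp add: cnj_sum e_cnj sum_distrib_left mult_ac)
  also have "\<dots> = (\<Sum>k\<in>F. cnj (c k) * integral\<^sup>L mu (\<lambda>x. u x * e (- k) x))"
    by (subst Bochner_Integration.integral_sum) (auto intro!: integrable_mult_e assms)
  also have "\<dots> = of_real L * (\<Sum>k\<in>F. cnj (c k) * fourier_coeff L u k)"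
    using L_pos by (simp add: fourier_coeff_mu sum_distrib_left)
  finally show ?thesis .
qed

lemma fourier_coeff_trig:
  assumes "finite F"
  shows "fourier_coeff L (\<lambda>x. \<Sum>k\<in>F. c k * e k x) j = (if j \<in> F then c j else 0)"
proof -
  have "integral\<^sup>L mu (\<lambda>x. (\<Sum>k\<in>F. c k * e k x) * e (- j) x) = integral\<^sup>L mu (\<lambda>x. \<Sum>k\<in>F. c k * e (k - j) x)"
    by (simp add: sum_distrib_right mult.assoc e_mult)
  also have "\<dots> = (\<Sum>k\<in>F. c k * integral\<^sup>L mu (e (k - j)))"
    by (subst Bochner_Integration.integral_sum) (auto intro!: integrable_mu_cont continuous_intros e_cont)
  also have "\<dots> = (\<Sum>k\<in>F. if k = j then c j * of_real L else 0)"
    by (rule sum.cong) (auto simp: integral_e)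
  also have "\<dots> = (if j \<in> F then c j * of_real L else 0)" using assms by (simp add: sum.delta)
  finally show ?thesis using L_pos by (simp add: fourier_coeff_mu)
qed

lemma trig_sum_cont: "continuous_on A (\<lambda>x. \<Sum>k\<in>F. c k * e k x)"
  by (intro continuous_intros continuous_on_subset[OF e_cont]) auto

lemma L2_trig_sum:
  assumes "finite F"
  shows "integral\<^sup>L mu (\<lambda>x. (norm (\<Sum>k\<in>F. c k * e k x))\<^sup>2) = L * (\<Sum>k\<in>F. (norm (c k))\<^sup>2)"
proof -
  define P where "P = (\<lambda>x. \<Sum>k\<in>F. c k * e k x)"
  have "complex_of_real (integral\<^sup>L mu (\<lambda>x. (norm (P x))\<^sup>2)) = integral\<^sup>L mu (\<lambda>x. P x * cnj (P x))"
    unfolding integral_complex_of_real[symmetric] complex_norm_square ..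
  also have "\<dots> = of_real L * (\<Sum>k\<in>F. cnj (c k) * fourier_coeff L P k)"
    unfolding P_def by (intro integral_mult_cnj_trig integrable_mu_cont trig_sum_cont assms)
  also have "\<dots> = of_real L * (\<Sum>k\<in>F. of_real ((norm (c k))\<^sup>2))"
    unfolding P_def fourier_coeff_trig[OF assms] complex_norm_square
    by (intro arg_cong[where f = "\<lambda>x. of_real L * x"] sum.cong) auto
  also have "\<dots> = of_real (L * (\<Sum>k\<in>F. (norm (c k))\<^sup>2))" by simp
  finally show ?thesis unfolding of_real_eq_iff P_def .
qed

text \<open>Pythagoras: the partial sum \<open>P\<close> has the coefficients of \<open>u\<close> on
  \<open>F\<close>, so the cross term equals the squared norm of \<open>P\<close>.\<close>

lemma Bessel_eq:
  assumes u: "u \<in> borel_measurable mu" "integrable mu (\<lambda>x. (norm (u x))\<^sup>2)"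
   and F: "finite F"
  shows "integral\<^sup>L mu (\<lambda>x. (norm (u x - (\<Sum>k\<in>F. fourier_coeff L u k * e k x)))\<^sup>2)
     = integral\<^sup>L mu (\<lambda>x. (norm (u x))\<^sup>2) - L * (\<Sum>k\<in>F. (norm (fourier_coeff L u k))\<^sup>2)"
proof -
  define P where "P = (\<lambda>x. \<Sum>k\<in>F. fourier_coeff L u k * e k x)"
  have Pc: "continuous_on A P" for A unfolding P_def by (rule trig_sum_cont)
  have ui: "integrable mu u" using square_integrable_imp_integrable[OF u] .
  have upi: "integrable mu (\<lambda>x. u x * cnj (P x))"
    by (rule integrable_mult_cont[OF ui]) (intro continuous_intros Pc)
  have PPi: "integrable mu (\<lambda>x. (norm (P x))\<^sup>2)" by (intro integrable_mu_cont continuous_intros Pc)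
  define h where "h x = Re (u x * cnj (P x))" for x
  have hi: "integrable mu h" "integral\<^sup>L mu h = Re (integral\<^sup>L mu (\<lambda>x. u x * cnj (P x)))"
    unfolding h_def using upi by (auto intro: integrable_Re integral_Re simp del: times_complex.simps)
  have "(norm (u x - P x))\<^sup>2 = (norm (u x))\<^sup>2 - 2 * h x + (norm (P x))\<^sup>2" for x
    unfolding h_def by (simp only: cmod_power2) (simp add: power2_eq_square algebra_simps)
  then have "integral\<^sup>L mu (\<lambda>x. (norm (u x - P x))\<^sup>2) = integral\<^sup>L mu (\<lambda>x. (norm (u x))\<^sup>2 - 2 * h x + (norm (P x))\<^sup>2)"
    by simp
  also have "\<dots> = integral\<^sup>L mu (\<lambda>x. (norm (u x))\<^sup>2) - 2 * integral\<^sup>L mu h + integral\<^sup>L mu (\<lambda>x. (norm (P x))\<^sup>2)"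
    using hi u PPi by simp
  also note hi(2)
  also have "integral\<^sup>L mu (\<lambda>x. u x * cnj (P x)) = of_real (L * (\<Sum>k\<in>F. (norm (fourier_coeff L u k))\<^sup>2))"
    unfolding P_def integral_mult_cnj_trig[OF ui F] of_real_mult of_real_sum complex_norm_square
    by (simp add: mult.commute)
  also have "integral\<^sup>L mu (\<lambda>x. (norm (P x))\<^sup>2) = L * (\<Sum>k\<in>F. (norm (fourier_coeff L u k))\<^sup>2)"
    unfolding P_def by (rule L2_trig_sum[OF F])
  finally show ?thesis by (simp add: P_def)
qed

lemma Bessel_summable:
  assumes u: "u \<in> borel_measurable mu" "integrable mu (\<lambda>x. (norm (u x))\<^sup>2)"
  shows "(\<lambda>k. (norm (fourier_coeff L u k))\<^sup>2) summable_on UNIV"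
proof (rule nonneg_bdd_above_summable_on)
  show "bdd_above (sum (\<lambda>k. (norm (fourier_coeff L u k))\<^sup>2) ` {F. F \<subseteq> UNIV \<and> finite F})"
  proof (rule bdd_aboveI2)
    fix F :: "int set" assume "F \<in> {F. F \<subseteq> UNIV \<and> finite F}"
    then have "finite F" by simp
    have "0 \<le> integral\<^sup>L mu (\<lambda>x. (norm (u x - (\<Sum>k\<in>F. fourier_coeff L u k * e k x)))\<^sup>2)" by simp
    then show "(\<Sum>k\<in>F. (norm (fourier_coeff L u k))\<^sup>2) \<le> integral\<^sup>L mu (\<lambda>x. (norm (u x))\<^sup>2) / L"
      unfolding Bessel_eq[OF u \<open>finite F\<close>] using L_pos by (simp add: field_simps)
  qed
qed auto

text \<open>Fatou's lemma for real integrals. Integrability of the limit is part of the conclusion,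
  and the bound on the integrals has to hold only eventually.\<close>

lemma Fatou_bound:
  fixes f :: "nat \<Rightarrow> real \<Rightarrow> real"
  assumes "\<And>i. integrable mu (f i)" "\<And>i x. 0 \<le> f i x" "AE x in mu. (\<lambda>i. f i x) \<longlonglongrightarrow> g x"
    and "g \<in> borel_measurable mu" "\<forall>\<^sub>F i in sequentially. integral\<^sup>L mu (f i) \<le> d" "\<And>x. 0 \<le> g x" "0 \<le> d"
  shows "integrable mu g" "integral\<^sup>L mu g \<le> d"
proof -
  have "(\<integral>\<^sup>+x. g x \<partial>mu) = (\<integral>\<^sup>+x. liminf (\<lambda>i. ennreal (f i x)) \<partial>mu)"
    using assms(3) by (intro nn_integral_cong_AE) (auto elim!: eventually_mono intro!: lim_imp_Liminf[OF _ tendsto_ennrealI, symmetric])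
  also have "\<dots> \<le> liminf (\<lambda>i. \<integral>\<^sup>+x. f i x \<partial>mu)"
    using assms(1) by (intro nn_integral_liminf) auto
  also have "\<dots> = liminf (\<lambda>i. ennreal (integral\<^sup>L mu (f i)))"
    using assms(1,2) by (simp add: nn_integral_eq_integral)
  also have "\<dots> \<le> liminf (\<lambda>i. ennreal d)"
    using assms(5) by (intro Liminf_mono) (auto elim!: eventually_mono simp: ennreal_leI)
  also have "\<dots> = ennreal d" by (simp add: Liminf_const)
  finally have le: "(\<integral>\<^sup>+x. g x \<partial>mu) \<le> ennreal d" .
  then show i: "integrable mu g"
    using assms(4,6) by (intro integrableI_nonneg) (auto intro: le_less_trans)
  show "integral\<^sup>L mu g \<le> d"
    using le assms(6,7) nn_integral_eq_integral[OF i] by simp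
qed

lemma fourier_coeff_diff:
  assumes "integrable mu u" "integrable mu v"
  shows "fourier_coeff L (\<lambda>x. u x - v x) k = fourier_coeff L u k - fourier_coeff L v k"
  unfolding fourier_coeff_mu left_diff_distrib
  by (subst Bochner_Integration.integral_diff) (auto intro!: integrable_mult_e assms simp: right_diff_distrib)

lemma fourier_coeff_add:
  assumes "integrable mu u" "integrable mu v"
  shows "fourier_coeff L (\<lambda>x. u x + v x) k = fourier_coeff L u k + fourier_coeff L v k"
  unfolding fourier_coeff_mu distrib_right
  by (subst Bochner_Integration.integral_add) (auto intro!: integrable_mult_e assms simp: distrib_left)

lemma fourier_coeff_cmult: "fourier_coeff L (\<lambda>x. a * u x) k = a * fourier_coeff L u k"
  unfolding fourier_coeff_mu by (simp add: mult.assoc)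

lemma norm_fourier_coeff_le:
  assumes "u \<in> borel_measurable mu" "integrable mu (\<lambda>x. (norm (u x))\<^sup>2)"
  shows "norm (fourier_coeff L u k) \<le> sqrt (integral\<^sup>L mu (\<lambda>x. (norm (u x))\<^sup>2)) / sqrt L"
proof -
  have "norm (fourier_coeff L u k) \<le> (1 / L) * integral\<^sup>L mu (\<lambda>x. norm (u x))"
    unfolding fourier_coeff_mu norm_mult using L_pos integral_norm_bound[of mu "\<lambda>x. u x * e (-k) x"]
    by (intro mult_mono) (auto simp: norm_mult norm_divide)
  also have "\<dots> \<le> (1 / L) * (sqrt L * sqrt (integral\<^sup>L mu (\<lambda>x. (norm (u x))\<^sup>2)))"
    using Cauchy_Schwarz_1[of "\<lambda>x. norm (u x)"] assms L_pos by (intro mult_left_mono) auto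
  also have "\<dots> = sqrt (integral\<^sup>L mu (\<lambda>x. (norm (u x))\<^sup>2)) / sqrt L"
    using L_pos by (simp add: field_simps)
  finally show ?thesis .
qed

lemma fourier_coeff_eq_imp_AE_eq:
  assumes "integrable mu u" "integrable mu v" "\<And>k. fourier_coeff L u k = fourier_coeff L v k"
  shows "AE x in mu. u x = v x"
proof -
  have "AE x in mu. u x - v x = 0"
  proof (rule fourier_unique)
    show "integrable mu (\<lambda>x. u x - v x)" using assms by simp
    show "integral\<^sup>L mu (\<lambda>x. (u x - v x) * e k x) = 0" for k
      using fourier_coeff_diff[OF assms(1,2), of "-k"] assms(3)[of "-k"] L_pos by (simp add: fourier_coeff_mu)
  qed
  then show ?thesis by simp
qed

text \<open>The partial sums are Cauchy in the mean, so a subsequence converges almost everywhere;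
  Fatou along it bounds the distance of the limit to each partial sum, which identifies the
  coefficients.\<close>

lemma Riesz_Fischer:
  fixes c :: "int \<Rightarrow> complex"
  assumes c: "(\<lambda>k. (norm (c k))\<^sup>2) summable_on UNIV"
  obtains W where "W \<in> L2_per L" "\<And>k. fourier_coeff L W k = c k"
    "integral\<^sup>L mu (\<lambda>x. (norm (W x))\<^sup>2) \<le> L * (\<Sum>\<^sub>\<infinity>k. (norm (c k))\<^sup>2)"
proof -
  define F where "F n = {- int n..int n}" for n
  have F: "finite (F n)" for n by (simp add: F_def)
  define S where "S n x = (\<Sum>k\<in>F n. c k * e k x)" for n x
  define a where "a n = (\<Sum>k\<in>F n. (norm (c k))\<^sup>2)" for n
  have Sc: "continuous_on A (S n)" for A n unfolding S_def by (rule trig_sum_cont)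
  have a_le: "a n \<le> (\<Sum>\<^sub>\<infinity>k. (norm (c k))\<^sup>2)" for n
    unfolding a_def by (rule finite_sum_le_infsum[OF c F]) auto
  have "incseq a" unfolding a_def F_def by (intro incseq_SucI sum_mono2) auto
  then obtain A where A: "a \<longlonglongrightarrow> A" "\<And>n. a n \<le> A"
    using incseq_convergent[OF \<open>incseq a\<close>] a_le by blast
  have A_le: "A \<le> (\<Sum>\<^sub>\<infinity>k. (norm (c k))\<^sup>2)" using A(1) a_le by (intro LIMSEQ_le_const2) auto
  have diff: "integral\<^sup>L mu (\<lambda>x. (norm (S i x - S j x))\<^sup>2) = L * (a i - a j)" if "j \<le> i" for i j
  proof -
    have sub: "F j \<subseteq> F i" using that by (auto simp: F_def)
    have "S i x - S j x = (\<Sum>k\<in>F i - F j. c k * e k x)" for x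
      unfolding S_def by (simp add: sum_diff[OF F sub])
    then have "integral\<^sup>L mu (\<lambda>x. (norm (S i x - S j x))\<^sup>2) = integral\<^sup>L mu (\<lambda>x. (norm (\<Sum>k\<in>F i - F j. c k * e k x))\<^sup>2)"
      by (simp only:)
    also have "\<dots> = L * (\<Sum>k\<in>F i - F j. (norm (c k))\<^sup>2)" by (rule L2_trig_sum[OF finite_Diff[OF F]])
    also have "\<dots> = L * (a i - a j)" by (simp add: a_def sum_diff[OF F sub])
    finally show ?thesis .
  qed
  have diff': "integral\<^sup>L mu (\<lambda>x. (norm (S i x - S j x))\<^sup>2) = L * \<bar>a i - a j\<bar>" for i j
  proof (cases "j \<le> i")
    case True
    then have "a j \<le> a i" using \<open>incseq a\<close> by (simp add: incseqD)
    then show ?thesis using diff[OF True] by simp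
  next
    case False
    then have "a i \<le> a j" using \<open>incseq a\<close> by (simp add: incseqD)
    then show ?thesis using diff[of i j] False by (simp add: norm_minus_commute)
  qed
  have "Cauchy a" using A(1) by (rule LIMSEQ_imp_Cauchy)
  \<comment> \<open>L1 Cauchy sequences have subsequences converging almost everywhere;
    Cauchy-Schwarz passes from the L2 identity \<open>diff'\<close> to the L1 distance.\<close>
  have "\<exists>N. \<forall>i\<ge>N. \<forall>j\<ge>N. LINT x|mu. norm (S i x - S j x) < d" if "d > 0" for d
  proof -
    have "(d / L)\<^sup>2 > 0" using that L_pos by simp
    then obtain N where N: "\<And>i j. i \<ge> N \<Longrightarrow> j \<ge> N \<Longrightarrow> \<bar>a i - a j\<bar> < (d / L)\<^sup>2"
      using \<open>Cauchy a\<close> unfolding Cauchy_def dist_real_def by blast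
    have "LINT x|mu. norm (S i x - S j x) < d" if ij: "i \<ge> N" "j \<ge> N" for i j
    proof -
      have "LINT x|mu. norm (S i x - S j x) \<le> sqrt L * sqrt (L * \<bar>a i - a j\<bar>)"
      proof -
        have c: "continuous_on UNIV (\<lambda>x. norm (S i x - S j x))"
          by (intro continuous_intros Sc)
        show ?thesis
          using Cauchy_Schwarz_1[OF measurable_mu_cont[OF c] integrable_mu_cont[OF continuous_on_power[OF c]]]
          unfolding diff' by simp
      qed
      also have "\<dots> = L * sqrt \<bar>a i - a j\<bar>" using L_pos by (simp add: real_sqrt_mult)
      also have "\<dots> < L * (d / L)"
        using N[OF ij] L_pos \<open>d > 0\<close> by (intro mult_strict_left_mono real_less_lsqrt) auto
      finally show ?thesis using L_pos by simp
    qed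
    then show ?thesis by blast
  qed
  then obtain r where r: "strict_mono r" "AE x in mu. Cauchy (\<lambda>i. S (r i) x)"
    using cauchy_L1_AE_cauchy_subseq[of mu S] integrable_mu_cont[OF Sc] by blast
  \<comment> \<open>\<open>lim\<close> has a value at every point, also where the sums diverge, so
    \<open>W\<close> is exactly periodic and Borel, not merely up to a null set.\<close>
  define W where "W x = lim (\<lambda>i. S (r i) x)" for x
  have conv: "AE x in mu. (\<lambda>i. S (r i) x) \<longlonglongrightarrow> W x"
    using r(2) unfolding W_def by eventually_elim (simp add: Cauchy_convergent_iff convergent_LIMSEQ_iff)
  have Wm: "W \<in> borel_measurable borel"
    unfolding W_def by (intro borel_measurable_lim_metric borel_measurable_continuous_onI Sc)
  have Wp: "periodic W" unfolding periodic_def W_def S_def by (simp add: e_periodic)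
  have *: "integrable mu (\<lambda>x. (norm (W x - S j x))\<^sup>2) \<and> integral\<^sup>L mu (\<lambda>x. (norm (W x - S j x))\<^sup>2) \<le> L * (A - a j)" for j
  proof -
    have "\<forall>\<^sub>F i in sequentially. r i \<ge> j"
      using filterlim_subseq[OF r(1)] by (auto simp: filterlim_at_top)
    then have ev: "\<forall>\<^sub>F i in sequentially. integral\<^sup>L mu (\<lambda>x. (norm (S (r i) x - S j x))\<^sup>2) \<le> L * (A - a j)"
      by eventually_elim (use diff A(2) L_pos in simp)
    have m: "(\<lambda>x. (norm (W x - S j x))\<^sup>2) \<in> borel_measurable mu"
      using measurable_mu[OF Wm] measurable_mu_cont[OF Sc[of UNIV j]] by measurable
    have lim: "AE x in mu. (\<lambda>i. (norm (S (r i) x - S j x))\<^sup>2) \<longlonglongrightarrow> (norm (W x - S j x))\<^sup>2"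
      using conv by eventually_elim (intro tendsto_intros)
    have int: "integrable mu (\<lambda>x. (norm (S (r i) x - S j x))\<^sup>2)" for i
      by (intro integrable_mu_cont continuous_intros Sc)
    show ?thesis using Fatou_bound[OF int _ lim m ev] A(2) L_pos by simp
  qed
  have WL2: "integrable mu (\<lambda>x. (norm (W x))\<^sup>2)"
    using square_integrable_add[of "\<lambda>x. W x - S 0 x" "S 0"] * measurable_mu[OF Wm] measurable_mu_cont[OF Sc]
    by (simp add: integrable_mu_cont continuous_intros Sc)
  have coeff: "fourier_coeff L W k = c k" for k
  proof -
    have Wi: "integrable mu W" using square_integrable_imp_integrable[OF measurable_mu[OF Wm] WL2] .
    have bd: "\<forall>\<^sub>F j in sequentially. norm (fourier_coeff L W k - c k) \<le> sqrt (A - a j)"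
      using eventually_ge_at_top[of "nat \<bar>k\<bar>"]
    proof eventually_elim
      fix j assume "nat \<bar>k\<bar> \<le> j"
      then have "k \<in> F j" by (auto simp: F_def)
      moreover have "S j = (\<lambda>x. \<Sum>k\<in>F j. c k * e k x)" by (auto simp: S_def)
      ultimately have "fourier_coeff L (S j) k = c k" using fourier_coeff_trig[OF F] by simp
      then have "fourier_coeff L W k - c k = fourier_coeff L (\<lambda>x. W x - S j x) k"
        using fourier_coeff_diff[OF Wi integrable_mu_cont[OF Sc]] by simp
      also have "norm \<dots> \<le> sqrt (integral\<^sup>L mu (\<lambda>x. (norm (W x - S j x))\<^sup>2)) / sqrt L"
        using * measurable_mu[OF Wm] measurable_mu_cont[OF Sc] by (intro norm_fourier_coeff_le) auto
      also have "\<dots> \<le> sqrt (L * (A - a j)) / sqrt L"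
        using * L_pos by (intro divide_right_mono) auto
      also have "\<dots> = sqrt (A - a j)" using L_pos by (simp add: real_sqrt_mult)
      finally show "norm (fourier_coeff L W k - c k) \<le> sqrt (A - a j)" .
    qed
    have "(\<lambda>j. sqrt (A - a j)) \<longlonglongrightarrow> sqrt (A - A)" by (intro tendsto_intros A)
    then have "norm (fourier_coeff L W k - c k) \<le> sqrt (A - A)"
      using bd by (rule tendsto_lowerbound) simp
    then show ?thesis by simp
  qed
  \<comment> \<open>Bessel's identity for the single mode in \<open>F 0\<close> converts the bound
    on the distance to \<open>S 0\<close> into one on the norm: the terms with \<open>a 0\<close>
    cancel.\<close>
  have "integral\<^sup>L mu (\<lambda>x. (norm (W x))\<^sup>2) \<le> L * A"
  proof -
    have "integral\<^sup>L mu (\<lambda>x. (norm (W x - S 0 x))\<^sup>2) = integral\<^sup>L mu (\<lambda>x. (norm (W x))\<^sup>2) - L * a 0"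
      using Bessel_eq[OF measurable_mu[OF Wm] WL2 F[of 0]] unfolding coeff S_def a_def .
    then show ?thesis using *[of 0] by (simp add: right_diff_distrib)
  qed
  also have "\<dots> \<le> L * (\<Sum>\<^sub>\<infinity>k. (norm (c k))\<^sup>2)" using A_le L_pos by simp
  finally show ?thesis using that[of W] coeff Wm Wp WL2 by (simp add: L2_mu)
qed

text \<open>The function rebuilt from the coefficients of \<open>u\<close> satisfies the bound, and
  by uniqueness of Fourier coefficients it equals \<open>u\<close> almost everywhere.\<close>

lemma Parseval_le:
  assumes "u \<in> L2_per L"
  shows "integral\<^sup>L mu (\<lambda>x. (norm (u x))\<^sup>2) \<le> L * (\<Sum>\<^sub>\<infinity>k. (norm (fourier_coeff L u k))\<^sup>2)"
proof -
  have u: "u \<in> borel_measurable mu" "integrable mu (\<lambda>x. (norm (u x))\<^sup>2)"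
    using assms by (auto simp: L2_mu measurable_mu)
  obtain W where W: "W \<in> L2_per L" "\<And>k. fourier_coeff L W k = fourier_coeff L u k"
    "integral\<^sup>L mu (\<lambda>x. (norm (W x))\<^sup>2) \<le> L * (\<Sum>\<^sub>\<infinity>k. (norm (fourier_coeff L u k))\<^sup>2)"
    using Riesz_Fischer[OF Bessel_summable[OF u]] by blast
  have "AE x in mu. u x = W x"
    by (rule fourier_coeff_eq_imp_AE_eq) (use L2_integrable assms W in auto)
  then have "integral\<^sup>L mu (\<lambda>x. (norm (u x))\<^sup>2) = integral\<^sup>L mu (\<lambda>x. (norm (W x))\<^sup>2)"
    using u W(1) by (intro integral_cong_AE) (auto simp: L2_mu measurable_mu)
  then show ?thesis using W(3) by simp
qed

subsection \<open>Weak derivatives\<close>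

lemma periodic_ends: "periodic h \<Longrightarrow> h L = h 0"
  unfolding periodic_def by (metis add_0)

text \<open>The derivative is approximated and then integrated, so that one polynomial serves the
  function and its derivative. The mean \<open>m\<close> of the approximation, which obstructs a
  periodic antiderivative, is small because \<open>p'\<close> has mean zero.\<close>

lemma trig_C1_approx:
  fixes p :: "real \<Rightarrow> real"
  assumes p: "periodic p" "\<And>x. (p has_real_derivative p' x) (at x)" "continuous_on UNIV p'" and "0 < d"
  obtains q q' where "trig q" "\<And>x. (q has_vector_derivative q' x) (at x)" "trig q'"
    "\<And>x. x \<in> {0..L} \<Longrightarrow> norm (of_real (p x) - q x) \<le> d"
    "\<And>x. x \<in> {0..L} \<Longrightarrow> norm (of_real (p' x) - q' x) \<le> d"
proof -
  \<comment> \<open>The derivative error is \<open>d1\<close> from the approximation plus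
    \<open>d1\<close> from its mean; integration over a period gives \<open>2 * d1 * L\<close>. Both
    are to stay below \<open>d\<close>.\<close>
  define d1 where "d1 = d / (2 * (1 + L))"
  have d1: "d1 > 0" "2 * d1 \<le> d" "2 * d1 * L \<le> d" using L_pos \<open>0 < d\<close> by (auto simp: d1_def field_simps)
  have p'_per: "p' (x + L) = p' x" for x
  proof -
    have "((\<lambda>y. p (y + L)) has_real_derivative p' (x + L)) (at x)"
      using DERIV_shift[of p "p' (x + L)" x L] p(2) by simp
    moreover have "(\<lambda>y. p (y + L)) = p" using p(1) by (auto simp: periodic_def)
    ultimately show ?thesis using p(2) DERIV_unique by metis
  qed
  obtain r where r: "trig r" "\<And>x. x \<in> {0..L} \<Longrightarrow> norm (of_real (p' x) - r x) < d1"
    using Stone_Weierstrass_trig[of p' d1] p'_per[of 0] p(3) d1 continuous_on_subset by fastforce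
  obtain m P where P: "trig P" "\<And>x. (P has_vector_derivative r x - m) (at x)"
    using trig_antideriv[OF r(1)] by blast
  have p'c: "continuous_on A p'" for A using p(3) continuous_on_subset by blast
  have "integral\<^sup>L mu (\<lambda>x. complex_of_real (p' x)) = of_real (p L) - of_real (p 0)"
    by (rule integral_mu_FTC) (use p in \<open>auto intro!: continuous_intros has_vector_derivative_of_real simp: has_real_derivative_iff_has_vector_derivative\<close>)
  then have p0: "integral\<^sup>L mu (\<lambda>x. complex_of_real (p' x)) = 0"
    using p(1)[unfolded periodic_def, rule_format, of 0] by simp
  have "integral\<^sup>L mu (\<lambda>x. r x - m) = P L - P 0"
    by (rule integral_mu_FTC[OF P(2)]) (intro continuous_intros trig_cont_on r)
  also have "\<dots> = 0" using periodic_ends[OF trig_periodic[OF P(1)]] by simp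
  finally have "integral\<^sup>L mu r = of_real L * m"
    using integrable_mu_cont[OF trig_cont[OF r(1)]] by (simp add: scaleR_conv_of_real)
  then have "of_real L * m = integral\<^sup>L mu (\<lambda>x. r x - of_real (p' x))"
    using integrable_mu_cont[OF trig_cont[OF r(1)]] p0
    by (subst Bochner_Integration.integral_diff) (auto intro!: integrable_mu_cont continuous_intros p)
  then have "L * norm m = norm (integral\<^sup>L mu (\<lambda>x. r x - of_real (p' x)))"
    using L_pos by (metis abs_of_pos norm_mult norm_of_real)
  also have "\<dots> \<le> integral\<^sup>L mu (\<lambda>x. norm (r x - of_real (p' x)))" by simp
  also have "\<dots> \<le> integral\<^sup>L mu (\<lambda>x. d1)"
    using r(2) by (intro integral_mono integrable_mu_cont continuous_intros trig_cont_on r p'c)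
      (auto simp: norm_minus_commute less_imp_le)
  finally have m: "norm m \<le> d1" using L_pos by simp
  \<comment> \<open>The constant makes \<open>q\<close> agree with \<open>p\<close> at 0, where the
    mean value estimate starts.\<close>
  define q where "q x = P x + (of_real (p 0) - P 0)" for x
  have q: "trig q" unfolding q_def by (intro trig_add trig_const P)
  have qd: "(q has_vector_derivative r x - m) (at x)" for x
    unfolding q_def by (auto intro!: derivative_eq_intros P)
  have q': "trig (\<lambda>x. r x - m)" using trig_add[OF r(1) trig_const[of "- m"]] by simp
  have b': "norm (of_real (p' x) - (r x - m)) \<le> 2 * d1" if "x \<in> {0..L}" for x
    using r(2)[OF that] m norm_triangle_ineq[of "of_real (p' x) - r x" m] by (simp add: algebra_simps)
  have b: "norm (of_real (p x) - q x) \<le> 2 * d1 * L" if "x \<in> {0..L}" for x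
  proof -
    have "norm ((of_real (p x) - q x) - (of_real (p 0) - q 0)) \<le> 2 * d1 * norm (x - 0)"
    proof (rule differentiable_bound[of "{0..L}"])
      show "((\<lambda>x. of_real (p x) - q x) has_derivative (\<lambda>h. h *\<^sub>R (of_real (p' x) - (r x - m)))) (at x within {0..L})"
        if "x \<in> {0..L}" for x
        using has_vector_derivative_diff[OF has_vector_derivative_of_real[OF p(2)] qd]
        by (simp add: has_vector_derivative_def has_derivative_at_withinI)
      show "onorm (\<lambda>h. h *\<^sub>R (of_real (p' x) - (r x - m))) \<le> 2 * d1" if "x \<in> {0..L}" for x
        using b'[OF that] by (intro onorm_le) (auto simp: mult.commute mult_left_mono)
    qed (use that in auto)
    also have "\<dots> \<le> 2 * d1 * L" using that d1 by (intro mult_left_mono) auto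
    finally show ?thesis by (simp add: q_def)
  qed
  show ?thesis
    using that[OF q qd q'] b b' d1 by (meson order_trans)
qed

lemma trig_cnj: "trig q \<Longrightarrow> trig (\<lambda>x. cnj (q x))"
proof (induction rule: trig.induct)
  case (trig_e a k)
  then show ?case using trig.trig_e[of "cnj a" "- k"] by (simp add: e_cnj)
qed (auto intro: trig.trig_add)

lemma Re_trig_deriv:
  assumes "trig q"
  obtains q' where "trig q'" "deriv (\<lambda>x. Re (q x)) = (\<lambda>x. Re (q' x))"
    "\<And>x. ((\<lambda>x. Re (q x)) has_real_derivative Re (q' x)) (at x)"
proof -
  obtain q' where q': "trig q'" "\<And>x. (q has_vector_derivative q' x) (at x)"
    using trig_deriv[OF assms] by blast
  have "((\<lambda>x. Re (q x)) has_real_derivative Re (q' x)) (at x)" for x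
    unfolding has_real_derivative_iff_has_vector_derivative
    by (rule bounded_linear.has_vector_derivative[OF bounded_linear_Re q'(2)])
  with q'(1) show ?thesis using that DERIV_imp_deriv by blast
qed

lemma Re_trig_deriv_iter: "trig q \<Longrightarrow> \<exists>q'. trig q' \<and> (deriv ^^ j) (\<lambda>x. Re (q x)) = (\<lambda>x. Re (q' x))"
proof (induction j)
  case (Suc j)
  then obtain q' where q': "trig q'" "(deriv ^^ j) (\<lambda>x. Re (q x)) = (\<lambda>x. Re (q' x))" by blast
  obtain q'' where "trig q''" "deriv (\<lambda>x. Re (q' x)) = (\<lambda>x. Re (q'' x))"
    using Re_trig_deriv[OF q'(1)] by metis
  then show ?case using q' by auto
qed auto

text \<open>These are the smooth periodic functions that are actually inserted into the definition
  of the weak derivative; density does the rest.\<close>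

lemma Re_trig_smooth:
  assumes "trig q" shows "C_k k (\<lambda>x. Re (q x))"
  unfolding C_k_def
proof (intro conjI allI impI)
  fix j x
  obtain q' where q': "trig q'" "(deriv ^^ j) (\<lambda>x. Re (q x)) = (\<lambda>x. Re (q' x))"
    using Re_trig_deriv_iter[OF assms] by blast
  show "(deriv ^^ j) (\<lambda>x. Re (q x)) field_differentiable at x"
    unfolding q'(2) using Re_trig_deriv[OF q'(1)] field_differentiable_def by metis
next
  obtain q' where q': "trig q'" "(deriv ^^ k) (\<lambda>x. Re (q x)) = (\<lambda>x. Re (q' x))"
    using Re_trig_deriv_iter[OF assms] by blast
  show "continuous_on UNIV ((deriv ^^ k) (\<lambda>x. Re (q x)))"
    unfolding q'(2) by (intro continuous_intros trig_cont q')
qed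

text \<open>The class of test functions for the energy estimate, whose test function has kinks in
  its derivative. The derivative is a second argument, which spares evaluating \<open>deriv\<close>
  of composite functions.\<close>

definition C1_per :: "(real \<Rightarrow> real) \<Rightarrow> (real \<Rightarrow> real) \<Rightarrow> bool" where
  "C1_per p p' \<longleftrightarrow> periodic p \<and> (\<forall>x. (p has_real_derivative p' x) (at x)) \<and> continuous_on UNIV p'"

lemma C1_per_cont: "C1_per p p' \<Longrightarrow> continuous_on A p"
  unfolding C1_per_def by (meson DERIV_isCont continuous_at_imp_continuous_on)

lemma integrable_scaleR_cont:
  fixes u :: "real \<Rightarrow> 'a :: {banach, second_countable_topology}"
  assumes "integrable mu u" "continuous_on {0..L} p"
  shows "integrable mu (\<lambda>x. p x *\<^sub>R u x)"
proof -
  have "bounded (p ` {0..L})"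
    by (intro compact_imp_bounded compact_continuous_image assms) auto
  then obtain B where B: "\<And>x. x \<in> {0..L} \<Longrightarrow> norm (p x) \<le> B"
    unfolding bounded_iff by blast
  show ?thesis
  proof (rule Bochner_Integration.integrable_bound[of mu "\<lambda>x. B * norm (u x)"])
    show "AE x in mu. norm (p x *\<^sub>R u x) \<le> norm (B * norm (u x))"
    proof (rule AE_I2)
      fix x assume "x \<in> space mu"
      then have "\<bar>p x\<bar> * norm (u x) \<le> B * norm (u x)" using B by (intro mult_right_mono) auto
      also have "\<dots> \<le> norm (B * norm (u x))" by simp
      finally show "norm (p x *\<^sub>R u x) \<le> norm (B * norm (u x))" by simp
    qed
    show "(\<lambda>x. p x *\<^sub>R u x) \<in> borel_measurable mu"
      by (rule borel_measurable_scaleR[OF measurable_mu_cont_on[OF assms(2)] borel_measurable_integrable[OF assms(1)]])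
  qed (use assms in simp)
qed

text \<open>For integrable \<open>u\<close> and \<open>v\<close> both sides are continuous in the C1
  norm of the test function, and trigonometric polynomials are dense in that norm. It serves the
  definition by smooth test functions as well as the Fourier characterisation.\<close>

lemma weak_deriv_extend:
  fixes u v :: "real \<Rightarrow> 'a :: {banach, second_countable_topology}"
  assumes u: "integrable mu u" and v: "integrable mu v"
    and H: "\<And>q q'. trig q \<Longrightarrow> trig q' \<Longrightarrow> (\<And>x. (q has_vector_derivative q' x) (at x)) \<Longrightarrow>
       integral\<^sup>L mu (\<lambda>x. Re (q x) *\<^sub>R v x) = - integral\<^sup>L mu (\<lambda>x. Re (q' x) *\<^sub>R u x)"
    and p: "C1_per p p'"
  shows "integral\<^sup>L mu (\<lambda>x. p x *\<^sub>R v x) = - integral\<^sup>L mu (\<lambda>x. p' x *\<^sub>R u x)"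
proof -
  define N where "N = integral\<^sup>L mu (\<lambda>x. norm (v x)) + integral\<^sup>L mu (\<lambda>x. norm (u x))"
  have "N \<ge> 0" unfolding N_def by (intro add_nonneg_nonneg) auto
  define I where "I = integral\<^sup>L mu (\<lambda>x. p x *\<^sub>R v x) + integral\<^sup>L mu (\<lambda>x. p' x *\<^sub>R u x)"
  have pc: "continuous_on A p" "continuous_on A p'" for A
    using C1_per_cont[OF p] p continuous_on_subset[of UNIV p' A] by (auto simp: C1_per_def)
  have "norm I \<le> d * N" if "d > 0" for d
  proof -
    obtain q q' where q: "trig q" "\<And>x. (q has_vector_derivative q' x) (at x)" "trig q'"
      "\<And>x. x \<in> {0..L} \<Longrightarrow> norm (of_real (p x) - q x) \<le> d"
      "\<And>x. x \<in> {0..L} \<Longrightarrow> norm (of_real (p' x) - q' x) \<le> d"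
      using trig_C1_approx[of p p' d] p \<open>d > 0\<close> unfolding C1_per_def by metis
    have qc: "continuous_on A (\<lambda>x. Re (q x))" "continuous_on A (\<lambda>x. Re (q' x))" for A
      by (intro continuous_intros trig_cont_on q)+
    have Re_le: "\<bar>a - Re z\<bar> \<le> norm (of_real a - z)" for a z
      using abs_Re_le_cmod[of "of_real a - z"] by simp
    note i = integrable_scaleR_cont[OF v pc(1)] integrable_scaleR_cont[OF u pc(2)]
       integrable_scaleR_cont[OF v qc(1)] integrable_scaleR_cont[OF u qc(2)]
    have "I = integral\<^sup>L mu (\<lambda>x. (p x *\<^sub>R v x - Re (q x) *\<^sub>R v x) + (p' x *\<^sub>R u x - Re (q' x) *\<^sub>R u x))"
      using i H[OF q(1,3,2)] by (simp add: I_def)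
    also have "norm \<dots> \<le> integral\<^sup>L mu (\<lambda>x. norm ((p x *\<^sub>R v x - Re (q x) *\<^sub>R v x) + (p' x *\<^sub>R u x - Re (q' x) *\<^sub>R u x)))"
      by simp
    also have "\<dots> \<le> integral\<^sup>L mu (\<lambda>x. d * norm (v x) + d * norm (u x))"
    proof (rule integral_mono)
      fix x assume "x \<in> space mu"
      then have x: "x \<in> {0..L}" by simp
      have "norm ((p x *\<^sub>R v x - Re (q x) *\<^sub>R v x) + (p' x *\<^sub>R u x - Re (q' x) *\<^sub>R u x))
         \<le> \<bar>p x - Re (q x)\<bar> * norm (v x) + \<bar>p' x - Re (q' x)\<bar> * norm (u x)"
        unfolding scaleR_left_diff_distrib[symmetric] norm_scaleR[symmetric] by (rule norm_triangle_ineq)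
      also have "\<dots> \<le> d * norm (v x) + d * norm (u x)"
        using Re_le q(4,5)[OF x] by (intro add_mono mult_right_mono) (auto intro: order_trans)
      finally show "norm ((p x *\<^sub>R v x - Re (q x) *\<^sub>R v x) + (p' x *\<^sub>R u x - Re (q' x) *\<^sub>R u x))
         \<le> d * norm (v x) + d * norm (u x)" .
    qed (use i u v in auto)
    also have "\<dots> = d * N" using u v by (simp add: N_def distrib_left)
    finally show ?thesis .
  qed
  note I_le = this
  have "norm I \<le> 0 + d" if "d > 0" for d
  proof -
    have "norm I \<le> d / (N + 1) * N" using that \<open>N \<ge> 0\<close> by (intro I_le) simp
    also have "\<dots> \<le> d" using that \<open>N \<ge> 0\<close> by (simp add: field_simps)
    finally show ?thesis by simp
  qed
  then have "norm I \<le> 0" by (rule field_le_epsilon)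
  then show ?thesis unfolding I_def by (simp add: eq_neg_iff_add_eq_0)
qed

text \<open>From left to right only real parts of trigonometric polynomials are tested, and density
  does the rest; from right to left, smooth test functions are special C1 ones.\<close>

lemma has_weak_deriv_mu:
  fixes u v :: "real \<Rightarrow> 'a :: {banach, second_countable_topology}"
  shows "has_weak_deriv L u v \<longleftrightarrow> u \<in> L2_per L \<and> v \<in> L2_per L \<and>
     (\<forall>p p'. C1_per p p' \<longrightarrow> integral\<^sup>L mu (\<lambda>x. p x *\<^sub>R v x) = - integral\<^sup>L mu (\<lambda>x. p' x *\<^sub>R u x))"
  (is "?A \<longleftrightarrow> ?B")
proof
  assume A: ?A
  then have L2: "u \<in> L2_per L" "v \<in> L2_per L" by (auto simp: has_weak_deriv_def)
  have "integral\<^sup>L mu (\<lambda>x. p x *\<^sub>R v x) = - integral\<^sup>L mu (\<lambda>x. p' x *\<^sub>R u x)" if "C1_per p p'" for p p'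
  proof (rule weak_deriv_extend[OF L2_integrable[OF L2(1)] L2_integrable[OF L2(2)] _ that])
    fix q q' assume q: "trig q" "trig q'" "\<And>x. (q has_vector_derivative q' x) (at x)"
    have "((\<lambda>x. Re (q x)) has_real_derivative Re (q' x)) (at x)" for x
      unfolding has_real_derivative_iff_has_vector_derivative
      by (rule bounded_linear.has_vector_derivative[OF bounded_linear_Re q(3)])
    then have "deriv (\<lambda>x. Re (q x)) = (\<lambda>x. Re (q' x))" using DERIV_imp_deriv by blast
    moreover have "(\<forall>k. C_k k (\<lambda>x. Re (q x))) \<and> (\<forall>x. Re (q (x + L)) = Re (q x))"
      using Re_trig_smooth[OF q(1)] trig_periodic[OF q(1)] by (simp add: periodic_def)
    ultimately have "integral\<^sup>L mu (\<lambda>x. Re (q' x) *\<^sub>R u x) = - integral\<^sup>L mu (\<lambda>x. Re (q x) *\<^sub>R v x)"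
      using A[unfolded has_weak_deriv_def LINT_mu, THEN conjunct2, THEN conjunct2, rule_format, of "\<lambda>x. Re (q x)"] by simp
    then show "integral\<^sup>L mu (\<lambda>x. Re (q x) *\<^sub>R v x) = - integral\<^sup>L mu (\<lambda>x. Re (q' x) *\<^sub>R u x)"
      by simp
  qed
  with L2 show ?B by blast
next
  assume B: ?B
  have "integral\<^sup>L mu (\<lambda>x. deriv p x *\<^sub>R u x) = - integral\<^sup>L mu (\<lambda>x. p x *\<^sub>R v x)"
    if "\<forall>k. C_k k p" "\<forall>x. p (x + L) = p x" for p
  proof -
    have "C_k 1 p" using that by blast
    then have "C1_per p (deriv p)" using that(2)
      by (auto simp: C_k_def C1_per_def periodic_def field_differentiable_derivI)
    then show ?thesis using B by simp
  qed
  with B show ?A unfolding has_weak_deriv_def LINT_mu by blast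
qed

lemma has_weak_deriv_L2:
  fixes u v :: "real \<Rightarrow> 'a :: {banach, second_countable_topology}"
  assumes "has_weak_deriv L u v" shows "u \<in> L2_per L" "v \<in> L2_per L"
  using assms by (auto simp: has_weak_deriv_def)

lemma has_weak_deriv_test:
  fixes u v :: "real \<Rightarrow> 'a :: {banach, second_countable_topology}"
  assumes "has_weak_deriv L u v" "C1_per p p'"
  shows "integral\<^sup>L mu (\<lambda>x. p x *\<^sub>R v x) = - integral\<^sup>L mu (\<lambda>x. p' x *\<^sub>R u x)"
  using assms unfolding has_weak_deriv_mu by blast

lemma has_weak_deriv_bounded_linear:
  fixes T :: "'a :: {banach, second_countable_topology} \<Rightarrow> 'b :: {banach, second_countable_topology}"
  assumes "bounded_linear T" "has_weak_deriv L u v"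
  shows "has_weak_deriv L (\<lambda>x. T (u x)) (\<lambda>x. T (v x))"
proof -
  interpret bounded_linear T by fact
  have u: "u \<in> L2_per L" "v \<in> L2_per L" using has_weak_deriv_L2[OF assms(2)] by auto
  have "integral\<^sup>L mu (\<lambda>x. p x *\<^sub>R T (v x)) = - integral\<^sup>L mu (\<lambda>x. p' x *\<^sub>R T (u x))" if p: "C1_per p p'" for p p'
  proof -
    have "continuous_on {0..L} p" "continuous_on {0..L} p'"
      using C1_per_cont[OF p] p continuous_on_subset[of UNIV p'] by (auto simp: C1_per_def)
    note i = integrable_scaleR_cont[OF L2_integrable[OF u(2)] this(1)] integrable_scaleR_cont[OF L2_integrable[OF u(1)] this(2)]
    have "integral\<^sup>L mu (\<lambda>x. p x *\<^sub>R T (v x)) = T (integral\<^sup>L mu (\<lambda>x. p x *\<^sub>R v x))"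
      using integral_bounded_linear[OF assms(1) i(1)] by (simp add: scale)
    also have "\<dots> = - T (integral\<^sup>L mu (\<lambda>x. p' x *\<^sub>R u x))"
      unfolding has_weak_deriv_test[OF assms(2) p] by (rule linear_neg[OF linear_axioms])
    also have "T (integral\<^sup>L mu (\<lambda>x. p' x *\<^sub>R u x)) = integral\<^sup>L mu (\<lambda>x. p' x *\<^sub>R T (u x))"
      using integral_bounded_linear[OF assms(1) i(2)] by (simp add: scale)
    finally show ?thesis .
  qed
  then show ?thesis unfolding has_weak_deriv_mu using L2_bounded_linear[OF assms(1)] u by blast
qed

text \<open>Testing against \<open>e k\<close> reads off the coefficient of index
  \<open>- k\<close>, and the factor \<open>- k\<close> supplies the sign of integration by parts.
  The induction produces some derivative of \<open>q\<close>, which uniqueness identifies with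
  \<open>q'\<close>.\<close>

lemma trig_weak_deriv:
  assumes u: "integrable mu u" "integrable mu v"
    and H: "\<And>k. fourier_coeff L v k = \<i> * of_real (w * of_int k) * fourier_coeff L u k"
    and q: "trig q" "\<And>x. (q has_vector_derivative q' x) (at x)"
  shows "integral\<^sup>L mu (\<lambda>x. q x * v x) = - integral\<^sup>L mu (\<lambda>x. q' x * u x)"
proof -
  have "\<exists>q'. trig q' \<and> (\<forall>x. (q has_vector_derivative q' x) (at x)) \<and>
    integral\<^sup>L mu (\<lambda>x. q x * v x) = - integral\<^sup>L mu (\<lambda>x. q' x * u x)"
    using q(1)
  proof (induction rule: trig.induct)
    case (trig_e a k)
    let ?b = "a * (\<i> * of_real (w * of_int k))"
    have "trig (\<lambda>x. ?b * e k x)" by (rule trig.trig_e)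
    moreover have "((\<lambda>x. a * e k x) has_vector_derivative ?b * e k x) (at x)" for x
      unfolding mult.assoc by (rule has_vector_derivative_mult_right) (use e_deriv in \<open>simp add: mult_ac\<close>)
    moreover have "integral\<^sup>L mu (\<lambda>x. (a * e k x) * v x) = - integral\<^sup>L mu (\<lambda>x. (?b * e k x) * u x)"
    proof -
      have "integral\<^sup>L mu (\<lambda>x. (a * e k x) * v x) = a * integral\<^sup>L mu (\<lambda>x. v x * e k x)"
        by (simp add: mult_ac)
      also have "\<dots> = a * (of_real L * fourier_coeff L v (- k))" using L_pos by (simp add: fourier_coeff_mu)
      also have "\<dots> = - (?b * (of_real L * fourier_coeff L u (- k)))" by (simp add: H)
      also have "\<dots> = - (?b * integral\<^sup>L mu (\<lambda>x. u x * e k x))" using L_pos by (simp add: fourier_coeff_mu)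
      also have "\<dots> = - integral\<^sup>L mu (\<lambda>x. (?b * e k x) * u x)"
        unfolding integral_mult_right_zero[symmetric] by (simp only: mult_ac)
      finally show ?thesis .
    qed
    ultimately show ?case by blast
  next
    case (trig_add p q)
    then obtain p' q' where *: "trig p'" "\<And>x. (p has_vector_derivative p' x) (at x)"
      "integral\<^sup>L mu (\<lambda>x. p x * v x) = - integral\<^sup>L mu (\<lambda>x. p' x * u x)" "trig q'"
      "\<And>x. (q has_vector_derivative q' x) (at x)"
      "integral\<^sup>L mu (\<lambda>x. q x * v x) = - integral\<^sup>L mu (\<lambda>x. q' x * u x)" by blast
    have i: "integrable mu (\<lambda>x. r x * h x)" if "trig r" "integrable mu h" for r h
      using integrable_mult_cont[OF that(2) trig_cont_on[OF that(1)]] by (simp add: mult.commute)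
    show ?case
    proof (intro exI[of _ "\<lambda>x. p' x + q' x"] conjI allI trig.trig_add has_vector_derivative_add)
      show "integral\<^sup>L mu (\<lambda>x. (p x + q x) * v x) = - integral\<^sup>L mu (\<lambda>x. (p' x + q' x) * u x)"
        using * trig_add.hyps u i by (simp add: distrib_right)
    qed (use * in auto)
  qed
  then obtain r where r: "\<And>x. (q has_vector_derivative r x) (at x)"
    "integral\<^sup>L mu (\<lambda>x. q x * v x) = - integral\<^sup>L mu (\<lambda>x. r x * u x)" by blast
  have "r = q'" using vector_derivative_unique_at[OF r(1) q(2)] by blast
  then show ?thesis using r(2) by simp
qed

lemma has_weak_deriv_fourierI:
  assumes u: "u \<in> L2_per L" "v \<in> L2_per L"
    and H: "\<And>k. fourier_coeff L v k = \<i> * of_real (w * of_int k) * fourier_coeff L u k"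
  shows "has_weak_deriv L u v"
proof -
  have "integral\<^sup>L mu (\<lambda>x. p x *\<^sub>R v x) = - integral\<^sup>L mu (\<lambda>x. p' x *\<^sub>R u x)" if p: "C1_per p p'" for p p'
  proof (rule weak_deriv_extend[OF L2_integrable[OF u(1)] L2_integrable[OF u(2)] _ p])
    fix q q' assume q: "trig q" "trig q'" "\<And>x. (q has_vector_derivative q' x) (at x)"
    \<comment> \<open>Half the sum of \<open>q x\<close> and its conjugate is
      \<open>Re (q x)\<close>, so the real test functions are themselves trigonometric.\<close>
    have t: "trig (\<lambda>x. complex_of_real (Re (q x)))"
    proof -
      have "trig (\<lambda>x. (1/2) * (q x + cnj (q x)))" by (intro trig_cmult trig_add trig_cnj q)
      moreover have "(\<lambda>x. (1/2) * (q x + cnj (q x))) = (\<lambda>x. complex_of_real (Re (q x)))"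
        by (auto simp: complex_eq_iff)
      ultimately show ?thesis by simp
    qed
    have d: "((\<lambda>x. complex_of_real (Re (q x))) has_vector_derivative complex_of_real (Re (q' x))) (at x)" for x
      using bounded_linear.has_vector_derivative[OF bounded_linear_compose[OF bounded_linear_of_real bounded_linear_Re] q(3)[of x]]
      by simp
    show "integral\<^sup>L mu (\<lambda>x. Re (q x) *\<^sub>R v x) = - integral\<^sup>L mu (\<lambda>x. Re (q' x) *\<^sub>R u x)"
      using trig_weak_deriv[OF L2_integrable[OF u(1)] L2_integrable[OF u(2)] H t d]
      by (simp add: scaleR_conv_of_real)
  qed
  then show ?thesis unfolding has_weak_deriv_mu using u by blast
qed

lemma has_weak_deriv_C1:
  fixes u :: "real \<Rightarrow> 'a :: euclidean_space"
  assumes "periodic u" "periodic v" "\<And>x. (u has_vector_derivative v x) (at x)" "continuous_on UNIV v"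
  shows "has_weak_deriv L u v"
proof -
  have uc: "continuous_on A u" for A
    by (rule continuous_at_imp_continuous_on) (auto intro: has_vector_derivative_continuous[OF assms(3)])
  have vc: "continuous_on A v" for A using assms(4) continuous_on_subset by blast
  have "integral\<^sup>L mu (\<lambda>x. p x *\<^sub>R v x) = - integral\<^sup>L mu (\<lambda>x. p' x *\<^sub>R u x)" if p: "C1_per p p'" for p p'
  proof -
    have pc: "continuous_on A p" "continuous_on A p'" for A
      using C1_per_cont[OF p] p continuous_on_subset[of UNIV p'] by (auto simp: C1_per_def)
    have "integral\<^sup>L mu (\<lambda>x. p x *\<^sub>R v x + p' x *\<^sub>R u x) = p L *\<^sub>R u L - p 0 *\<^sub>R u 0"
    proof (rule integral_mu_FTC)
      show "((\<lambda>x. p x *\<^sub>R u x) has_vector_derivative p x *\<^sub>R v x + p' x *\<^sub>R u x) (at x)" for x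
        using p assms(3) unfolding C1_per_def by (intro has_vector_derivative_scaleR) auto
    qed (intro continuous_intros pc uc vc)
    also have "\<dots> = 0"
      using p assms(1)[unfolded periodic_def, rule_format, of 0] spec[of "\<lambda>x. p (x + L) = p x" 0]
      by (simp add: C1_per_def periodic_def)
    also have "integral\<^sup>L mu (\<lambda>x. p x *\<^sub>R v x + p' x *\<^sub>R u x) = integral\<^sup>L mu (\<lambda>x. p x *\<^sub>R v x) + integral\<^sup>L mu (\<lambda>x. p' x *\<^sub>R u x)"
      by (rule Bochner_Integration.integral_add) (intro integrable_mu_cont continuous_intros pc uc vc)+
    finally show ?thesis by (simp add: eq_neg_iff_add_eq_0)
  qed
  then show ?thesis unfolding has_weak_deriv_mu using L2_cont assms uc by blast
qed

text \<open>Test functions are real, so \<open>e (- k)\<close> is inserted through its real and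
  imaginary parts.\<close>

lemma has_weak_deriv_fourier:
  assumes "has_weak_deriv L u v"
  shows "fourier_coeff L v k = \<i> * of_real (w * of_int k) * fourier_coeff L u k"
proof -
  have u: "integrable mu u" "integrable mu v"
    using has_weak_deriv_L2[OF assms] L2_integrable by auto
  define b where "b = \<i> * of_real (w * of_int (- k))"
  have Tp: "C1_per (\<lambda>x. T (e (- k) x)) (\<lambda>x. T (b * e (- k) x))" if T: "bounded_linear T" for T :: "complex \<Rightarrow> real"
    unfolding C1_per_def periodic_def has_real_derivative_iff_has_vector_derivative b_def
    by (intro conjI allI bounded_linear.has_vector_derivative[OF T e_deriv]
        continuous_intros e_cont bounded_linear.continuous_on[OF T]) (simp add: e_periodic)
  have spl: "integral\<^sup>L mu (\<lambda>x. h x * z x) = integral\<^sup>L mu (\<lambda>x. Re (z x) *\<^sub>R h x) + \<i> * integral\<^sup>L mu (\<lambda>x. Im (z x) *\<^sub>R h x)"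
    if "integrable mu h" "continuous_on {0..L} z" for h z :: "real \<Rightarrow> complex"
  proof -
    have "h x * z x = Re (z x) *\<^sub>R h x + \<i> * (Im (z x) *\<^sub>R h x)" for x
      by (simp add: complex_eq_iff)
    then have eq: "(\<lambda>x. h x * z x) = (\<lambda>x. Re (z x) *\<^sub>R h x + \<i> * (Im (z x) *\<^sub>R h x))"
      by (rule ext)
    have "integrable mu (\<lambda>x. Re (z x) *\<^sub>R h x)" "integrable mu (\<lambda>x. Im (z x) *\<^sub>R h x)"
      by (intro integrable_scaleR_cont continuous_intros that)+
    then show ?thesis unfolding eq
      by (subst Bochner_Integration.integral_add) (auto intro: integrable_mult_right simp only: integral_mult_right_zero)
  qed
  have "integral\<^sup>L mu (\<lambda>x. v x * e (- k) x) = integral\<^sup>L mu (\<lambda>x. Re (e (- k) x) *\<^sub>R v x) + \<i> * integral\<^sup>L mu (\<lambda>x. Im (e (- k) x) *\<^sub>R v x)"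
    by (rule spl[OF u(2) continuous_on_subset[OF e_cont]]) auto
  also have "\<dots> = - (integral\<^sup>L mu (\<lambda>x. Re (b * e (- k) x) *\<^sub>R u x) + \<i> * integral\<^sup>L mu (\<lambda>x. Im (b * e (- k) x) *\<^sub>R u x))"
    unfolding has_weak_deriv_test[OF assms Tp[OF bounded_linear_Re]] has_weak_deriv_test[OF assms Tp[OF bounded_linear_Im]]
    by (simp only: mult_minus_right minus_add_distrib)
  also have "\<dots> = - integral\<^sup>L mu (\<lambda>x. u x * (b * e (- k) x))"
    by (subst spl[OF u(1)]) (auto intro!: continuous_intros continuous_on_subset[OF e_cont])
  also have "\<dots> = - (b * integral\<^sup>L mu (\<lambda>x. u x * e (- k) x))"
    unfolding integral_mult_right_zero[symmetric] by (simp only: mult_ac)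
  finally show ?thesis by (simp add: fourier_coeff_mu b_def)
qed

lemma has_weak_deriv_unique:
  fixes v :: "real \<Rightarrow> complex"
  assumes "has_weak_deriv L u v" "has_weak_deriv L u v'"
  shows "AE x in mu. v x = v' x"
  using assms by (intro fourier_coeff_eq_imp_AE_eq L2_integrable)
    (auto simp: has_weak_deriv_fourier dest: has_weak_deriv_L2)

lemma has_weak_deriv_unique_real:
  fixes v :: "real \<Rightarrow> real"
  assumes "has_weak_deriv L u v" "has_weak_deriv L u v'"
  shows "AE x in mu. v x = v' x"
proof -
  have "AE x in mu. complex_of_real (v x) = of_real (v' x)"
    by (rule has_weak_deriv_unique; rule has_weak_deriv_bounded_linear[OF bounded_linear_of_real]; rule assms)
  then show ?thesis by simp
qed

text \<open>Allows an element of the space to be exchanged for its regular representative.\<close>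

lemma has_weak_deriv_cong:
  fixes u v :: "real \<Rightarrow> 'a :: {banach, second_countable_topology}"
  assumes "has_weak_deriv L u v" "u' \<in> L2_per L" "AE x in mu. u x = u' x"
  shows "has_weak_deriv L u' v"
proof -
  have m: "u \<in> borel_measurable mu" "u' \<in> borel_measurable mu"
    using has_weak_deriv_L2(1)[OF assms(1)] assms(2) by (auto simp: L2_mu measurable_mu)
  have "integral\<^sup>L mu (\<lambda>x. p' x *\<^sub>R u x) = integral\<^sup>L mu (\<lambda>x. p' x *\<^sub>R u' x)" if p: "C1_per p p'" for p p'
  proof (rule integral_cong_AE)
    have "p' \<in> borel_measurable mu" using p by (auto simp: C1_per_def measurable_mu_cont)
    then show "(\<lambda>x. p' x *\<^sub>R u x) \<in> borel_measurable mu" "(\<lambda>x. p' x *\<^sub>R u' x) \<in> borel_measurable mu"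
      using m by auto
    show "AE x in mu. p' x *\<^sub>R u x = p' x *\<^sub>R u' x" using assms(3) by eventually_elim simp
  qed
  then show ?thesis using assms unfolding has_weak_deriv_mu by metis
qed

text \<open>\<open>weak_deriv\<close> picks an arbitrary candidate, so the inner choice agrees with
  \<open>U1\<close> only almost everywhere and has to be exchanged for it. Uniqueness is a premise
  so that real and complex functions are served alike.\<close>

lemma weak_deriv_twice:
  fixes u :: "real \<Rightarrow> 'a :: {banach, second_countable_topology}"
  assumes unique: "\<And>u v v' :: real \<Rightarrow> 'a. has_weak_deriv L u v \<Longrightarrow> has_weak_deriv L u v' \<Longrightarrow> AE x in mu. v x = v' x"
    and U: "has_weak_deriv L u U1" "has_weak_deriv L U1 W"
  shows "AE x in mu. weak_deriv L u x = U1 x" "has_weak_deriv L U1 (weak_deriv L (weak_deriv L u))"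
proof -
  have 1: "has_weak_deriv L u (weak_deriv L u)"
    unfolding weak_deriv_def by (rule someI[of _ U1]) (rule U)
  show AE: "AE x in mu. weak_deriv L u x = U1 x" by (rule unique[OF 1 U(1)])
  then have "AE x in mu. U1 x = weak_deriv L u x" by eventually_elim simp
  then have "has_weak_deriv L (weak_deriv L u) W"
    by (rule has_weak_deriv_cong[OF U(2) has_weak_deriv_L2(2)[OF 1]])
  then have "has_weak_deriv L (weak_deriv L u) (weak_deriv L (weak_deriv L u))"
    unfolding weak_deriv_def[of L "weak_deriv L u"] by (rule someI[of _ W])
  then show "has_weak_deriv L U1 (weak_deriv L (weak_deriv L u))"
    by (rule has_weak_deriv_cong[OF _ has_weak_deriv_L2(2)[OF U(1)] AE])
qed

end

subsection \<open>Regularity in the periodic Sobolev spaces\<close>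

lemma summable_inverse_int: "(\<lambda>k::int. 1 / (1 + (real_of_int k)\<^sup>2)) summable_on UNIV"
proof -
  have nat: "(\<lambda>n::nat. 1 / (1 + (real n)\<^sup>2)) summable_on UNIV"
  proof (subst summable_on_UNIV_nonneg_real_iff)
    show "summable (\<lambda>n::nat. 1 / (1 + (real n)\<^sup>2))"
    proof (rule summable_comparison_test'[of _ 1])
      show "summable (\<lambda>n. inverse (real n ^ 2))" by (rule inverse_power_summable) simp
      show "norm (1 / (1 + (real n)\<^sup>2)) \<le> inverse (real n ^ 2)" if "n \<ge> 1" for n
        using that by (simp add: divide_simps add_pos_nonneg)
    qed
  qed auto
  have "(\<lambda>k::int. 1 / (1 + (real_of_int k)\<^sup>2)) summable_on range int"
    by (subst summable_on_reindex) (use nat in \<open>auto simp: o_def\<close>)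
  moreover have "(\<lambda>k::int. 1 / (1 + (real_of_int k)\<^sup>2)) summable_on range (\<lambda>n. - int n)"
    by (subst summable_on_reindex) (use nat in \<open>auto simp: o_def inj_on_def\<close>)
  ultimately have "(\<lambda>k::int. 1 / (1 + (real_of_int k)\<^sup>2)) summable_on range int \<union> (range (\<lambda>n. - int n) - range int)"
    by (intro summable_on_Un_disjoint) (auto intro: summable_on_subset_banach)
  moreover have "range int \<union> (range (\<lambda>n. - int n) - range int) = UNIV"
  proof -
    have "k \<in> range int \<or> k \<in> range (\<lambda>n. - int n)" for k :: int
      by (cases k rule: int_cases2) auto
    then show ?thesis by auto
  qed
  ultimately show ?thesis by simp
qed

context period begin

lemma norm_fourier_coeff_bounded:
  assumes "integrable mu u" "\<And>x. norm (u x) \<le> B"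
  shows "norm (fourier_coeff L u k) \<le> B"
proof -
  have "norm (integral\<^sup>L mu (\<lambda>x. u x * e (- k) x)) \<le> integral\<^sup>L mu (\<lambda>x. norm (u x * e (- k) x))" by simp
  also have "\<dots> \<le> integral\<^sup>L mu (\<lambda>x. B)"
    using assms integrable_mult_e[OF assms(1)] by (intro integral_mono) (auto simp: norm_mult)
  finally show ?thesis using L_pos by (simp add: fourier_coeff_mu norm_mult norm_divide field_simps)
qed

text \<open>By the Weierstrass M-test the series converges uniformly, so continuity and the
  coefficients pass to the limit; a finite sum over any set containing \<open>k\<close> already has
  the coefficient \<open>d k\<close>.\<close>

lemma abs_fourier_series:
  assumes d: "(\<lambda>k. norm (d k)) summable_on UNIV"
  obtains V where "periodic V" "continuous_on UNIV V" "\<And>k. fourier_coeff L V k = d k"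
    "\<And>x. norm (V x) \<le> (\<Sum>\<^sub>\<infinity>k. norm (d k))"
proof -
  define V where "V x = (\<Sum>\<^sub>\<infinity>k. d k * e k x)" for x
  have ul: "uniform_limit UNIV (\<lambda>F x. \<Sum>k\<in>F. d k * e k x) V (finite_subsets_at_top UNIV)"
    unfolding V_def by (rule Weierstrass_m_test_general[OF _ d]) (simp add: norm_mult)
  have Vc: "continuous_on UNIV V"
    by (rule uniform_limit_theorem[OF always_eventually ul]) (auto intro: trig_sum_cont)
  have Vp: "periodic V" by (simp add: periodic_def V_def e_periodic)
  have "norm (V x) \<le> (\<Sum>\<^sub>\<infinity>k. norm (d k))" for x
  proof -
    have "(\<lambda>k. norm (d k * e k x)) summable_on UNIV" using d by (simp add: norm_mult)
    from norm_infsum_bound[OF this] show ?thesis by (simp add: V_def norm_mult)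
  qed
  moreover have "fourier_coeff L V k = d k" for k
  proof -
    have "norm (fourier_coeff L V k - d k) \<le> 0 + r" if "r > 0" for r
    proof -
      have "\<forall>\<^sub>F F in finite_subsets_at_top UNIV. \<forall>x\<in>UNIV. dist (\<Sum>k\<in>F. d k * e k x) (V x) < r"
        using ul that by (simp add: uniform_limit_iff)
      moreover have "\<forall>\<^sub>F F in finite_subsets_at_top (UNIV :: int set). finite F \<and> {k} \<subseteq> F \<and> F \<subseteq> UNIV"
        unfolding eventually_finite_subsets_at_top by (intro exI[of _ "{k}"]) auto
      ultimately have "\<forall>\<^sub>F F in finite_subsets_at_top (UNIV :: int set). norm (fourier_coeff L V k - d k) \<le> r"
      proof eventually_elim
        fix F assume F: "\<forall>x\<in>UNIV. dist (\<Sum>k\<in>F. d k * e k x) (V x) < r" "finite F \<and> {k} \<subseteq> F \<and> F \<subseteq> UNIV"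
        define S where "S = (\<lambda>x. \<Sum>k\<in>F. d k * e k x)"
        have i: "integrable mu V" "integrable mu S"
          unfolding S_def by (intro integrable_mu_cont Vc trig_sum_cont)+
        have "fourier_coeff L V k - d k = fourier_coeff L (\<lambda>x. V x - S x) k"
          using fourier_coeff_diff[OF i] fourier_coeff_trig[of F d k] F(2) by (simp add: S_def)
        also have "norm \<dots> \<le> r"
          using F(1) i by (intro norm_fourier_coeff_bounded) (auto simp: S_def dist_norm norm_minus_commute less_imp_le)
        finally show "norm (fourier_coeff L V k - d k) \<le> r" .
      qed
      then show ?thesis by (simp add: eventually_const_iff)
    qed
    then have "norm (fourier_coeff L V k - d k) \<le> 0" by (rule field_le_epsilon)
    then show ?thesis by simp
  qed
  ultimately show ?thesis using that Vc Vp by blast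
qed

lemma Hs_per_2:
  "u \<in> Hs_per L 2 \<longleftrightarrow> u \<in> L2_per L \<and>
     (\<lambda>k. (1 + (real_of_int k)\<^sup>2)\<^sup>2 * (norm (fourier_coeff L u k))\<^sup>2) summable_on UNIV"
proof -
  have "(1 + \<bar>real_of_int k\<bar>\<^sup>2) powr 2 = (1 + (real_of_int k)\<^sup>2)\<^sup>2" for k
    using powr_numeral[of "1 + (real_of_int k)\<^sup>2" "num.Bit0 num.One"] by (simp add: add_pos_nonneg)
  then show ?thesis by (simp add: Hs_per_def)
qed

lemma Hs_norm_2:
  "Hs_norm L 2 u = sqrt (L * (\<Sum>\<^sub>\<infinity>k. (1 + (real_of_int k)\<^sup>2)\<^sup>2 * (norm (fourier_coeff L u k))\<^sup>2))"
proof -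
  have "(1 + \<bar>real_of_int k\<bar>\<^sup>2) powr 2 = (1 + (real_of_int k)\<^sup>2)\<^sup>2" for k
    using powr_numeral[of "1 + (real_of_int k)\<^sup>2" "num.Bit0 num.One"] by (simp add: add_pos_nonneg)
  then show ?thesis by (simp add: Hs_norm_def)
qed

lemma Hs_norm_nonneg: "0 \<le> Hs_norm L s u"
  unfolding Hs_norm_def using L_pos by (auto intro!: mult_nonneg_nonneg infsum_nonneg)

lemma Hs_norm_sq: "(Hs_norm L s u)\<^sup>2 = L * (\<Sum>\<^sub>\<infinity>k. (1 + \<bar>real_of_int k\<bar>\<^sup>2) powr s * (norm (fourier_coeff L u k))\<^sup>2)"
  unfolding Hs_norm_def using L_pos by (subst real_sqrt_pow2) (auto intro!: mult_nonneg_nonneg infsum_nonneg)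

lemma weight_ge_1:
  assumes "s \<ge> 0" shows "1 \<le> (1 + \<bar>real_of_int k\<bar>\<^sup>2) powr s"
  using ge_one_powr_ge_zero[of "1 + \<bar>real_of_int k\<bar>\<^sup>2" s] assms by simp

lemma L2_le_Hs_norm:
  assumes "u \<in> Hs_per L s" "s \<ge> 0"
  shows "integral\<^sup>L mu (\<lambda>x. (norm (u x))\<^sup>2) \<le> (Hs_norm L s u)\<^sup>2"
proof -
  have u: "u \<in> L2_per L" and sm: "(\<lambda>k. (1 + \<bar>real_of_int k\<bar>\<^sup>2) powr s * (norm (fourier_coeff L u k))\<^sup>2) summable_on UNIV"
    using assms by (auto simp: Hs_per_def)
  have "integral\<^sup>L mu (\<lambda>x. (norm (u x))\<^sup>2) \<le> L * (\<Sum>\<^sub>\<infinity>k. (norm (fourier_coeff L u k))\<^sup>2)"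
    by (rule Parseval_le[OF u])
  also have "\<dots> \<le> (Hs_norm L s u)\<^sup>2"
    unfolding Hs_norm_sq
  proof (intro mult_left_mono infsum_mono sm)
    show "(\<lambda>k. (norm (fourier_coeff L u k))\<^sup>2) summable_on UNIV"
      using u by (intro Bessel_summable) (auto simp: L2_mu measurable_mu)
    show "(norm (fourier_coeff L u k))\<^sup>2 \<le> (1 + \<bar>real_of_int k\<bar>\<^sup>2) powr s * (norm (fourier_coeff L u k))\<^sup>2" for k
      using mult_right_mono[OF weight_ge_1[OF assms(2), of k], of "(norm (fourier_coeff L u k))\<^sup>2"] by simp
  qed (use L_pos in auto)
  finally show ?thesis .
qed

lemma Hs_per_diff:
  assumes "u \<in> Hs_per L s" "v \<in> Hs_per L s"
  shows "(\<lambda>x. u x - v x) \<in> Hs_per L s"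
proof -
  have u: "u \<in> L2_per L" "v \<in> L2_per L" using assms by (auto simp: Hs_per_def)
  let ?g = "\<lambda>k. 2 * ((1 + \<bar>real_of_int k\<bar>\<^sup>2) powr s * (norm (fourier_coeff L u k))\<^sup>2) + 2 * ((1 + \<bar>real_of_int k\<bar>\<^sup>2) powr s * (norm (fourier_coeff L v k))\<^sup>2)"
  have "?g summable_on UNIV"
    using assms unfolding Hs_per_def by (intro summable_on_add summable_on_cmult_right) auto
  then have "(\<lambda>k. (1 + \<bar>real_of_int k\<bar>\<^sup>2) powr s * (norm (fourier_coeff L (\<lambda>x. u x - v x) k))\<^sup>2) summable_on UNIV"
  proof (rule summable_on_comparison_test)
    fix k
    have "(norm (fourier_coeff L (\<lambda>x. u x - v x) k))\<^sup>2 \<le> 2 * (norm (fourier_coeff L u k))\<^sup>2 + 2 * (norm (fourier_coeff L v k))\<^sup>2"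
      unfolding fourier_coeff_diff[OF L2_integrable[OF u(1)] L2_integrable[OF u(2)]]
      using norm_add_square[of "fourier_coeff L u k" "- fourier_coeff L v k"] by simp
    then have "(1 + \<bar>real_of_int k\<bar>\<^sup>2) powr s * (norm (fourier_coeff L (\<lambda>x. u x - v x) k))\<^sup>2 \<le>
      (1 + \<bar>real_of_int k\<bar>\<^sup>2) powr s * (2 * (norm (fourier_coeff L u k))\<^sup>2 + 2 * (norm (fourier_coeff L v k))\<^sup>2)"
      by (rule mult_left_mono) simp
    then show "(1 + \<bar>real_of_int k\<bar>\<^sup>2) powr s * (norm (fourier_coeff L (\<lambda>x. u x - v x) k))\<^sup>2 \<le> ?g k"
      by (simp add: algebra_simps)
  qed auto
  then show ?thesis using L2_diff[OF u] by (simp add: Hs_per_def)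
qed

text \<open>At order 0 the weight is 1, and Bessel's inequality makes the summability condition
  automatic.\<close>

lemma Hs_per_0: "Hs_per L 0 = L2_per L"
proof -
  have "(1 + \<bar>real_of_int k\<bar>\<^sup>2) powr 0 = 1" for k
    using weight_ge_1[of 0 k] by (simp add: powr_def split: if_splits)
  then show ?thesis by (auto simp: Hs_per_def L2_mu measurable_mu intro!: Bessel_summable)
qed

lemma Hs_norm_scaleR: "c \<ge> 0 \<Longrightarrow> Hs_norm L s (\<lambda>x. of_real c * u x) = c * Hs_norm L s u"
  unfolding Hs_norm_def fourier_coeff_cmult
  by (simp add: norm_mult power_mult_distrib mult.left_commute[of _ "c\<^sup>2"] infsum_cmult_right' real_sqrt_mult)

lemma fourier_coeff_le_Hs_norm:
  assumes "u \<in> Hs_per L s" "s \<ge> 0"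
  shows "sqrt L * norm (fourier_coeff L u k) \<le> Hs_norm L s u"
proof -
  have sm: "(\<lambda>k. (1 + \<bar>real_of_int k\<bar>\<^sup>2) powr s * (norm (fourier_coeff L u k))\<^sup>2) summable_on UNIV"
    using assms by (auto simp: Hs_per_def)
  have "(norm (fourier_coeff L u k))\<^sup>2 \<le> (1 + \<bar>real_of_int k\<bar>\<^sup>2) powr s * (norm (fourier_coeff L u k))\<^sup>2"
    using mult_right_mono[OF weight_ge_1[OF assms(2), of k], of "(norm (fourier_coeff L u k))\<^sup>2"] by simp
  also have "\<dots> \<le> (\<Sum>\<^sub>\<infinity>k. (1 + \<bar>real_of_int k\<bar>\<^sup>2) powr s * (norm (fourier_coeff L u k))\<^sup>2)"
    using finite_sum_le_infsum[OF sm, of "{k}"] by simp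
  finally have "sqrt (L * (norm (fourier_coeff L u k))\<^sup>2) \<le> Hs_norm L s u"
    unfolding Hs_norm_def using L_pos by (intro real_sqrt_le_mono mult_left_mono) auto
  then show ?thesis by (simp add: real_sqrt_mult)
qed

text \<open>What the arithmetic-geometric inequality yields for the sum of the coefficient norms
  when \<open>Hs_norm L 2 u \<le> 1\<close>: half of the weighted square sum, which is at most
  \<open>1 / L\<close>, plus half of the sum of inverse weights.\<close>

definition sup_const :: real where
  "sup_const = (1 / L + (\<Sum>\<^sub>\<infinity>k::int. 1 / (1 + (real_of_int k)\<^sup>2))) / 2"

lemma AM_GM_weight:
  fixes a b :: real assumes "0 < b" shows "a \<le> (b\<^sup>2 * a\<^sup>2 + 1 / b\<^sup>2) / 2"
proof -
  have "0 \<le> (b * a - 1 / b)\<^sup>2" by simp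
  also have "\<dots> = b\<^sup>2 * a\<^sup>2 - 2 * a + 1 / b\<^sup>2"
    using assms by (simp add: power2_diff power_mult_distrib power_divide)
  finally show ?thesis by simp
qed

text \<open>Each term is split by the arithmetic-geometric inequality into its share of the squared
  norm and \<open>2 * (1 / K)\<close>. The factor \<open>1 + \<bar>real_of_int k\<bar>\<close> makes
  the series of the first derivative converge absolutely as well.\<close>

lemma H2_summable:
  assumes "u \<in> Hs_per L 2"
  shows "(\<lambda>k. (1 + \<bar>real_of_int k\<bar>) * norm (fourier_coeff L u k)) summable_on UNIV"
proof (rule summable_on_comparison_test)
  show "(\<lambda>k. (1 + (real_of_int k)\<^sup>2)\<^sup>2 * (norm (fourier_coeff L u k))\<^sup>2 + 2 * (1 / (1 + (real_of_int k)\<^sup>2))) summable_on UNIV"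
    using assms summable_inverse_int unfolding Hs_per_2 by (intro summable_on_add summable_on_cmult_right) auto
  fix k :: int
  define K where "K = 1 + (real_of_int k)\<^sup>2"
  define a where "a = norm (fourier_coeff L u k)"
  have K: "K \<ge> 1" by (simp add: K_def)
  have k1: "(1 + \<bar>real_of_int k\<bar>)\<^sup>2 \<le> 2 * K"
    using sum_squares_bound[of 1 "\<bar>real_of_int k\<bar>"] by (simp add: K_def power2_sum)
  have "0 \<le> (K * a - (1 + \<bar>real_of_int k\<bar>) / K)\<^sup>2" by simp
  also have "\<dots> = K\<^sup>2 * a\<^sup>2 - 2 * ((1 + \<bar>real_of_int k\<bar>) * a) + (1 + \<bar>real_of_int k\<bar>)\<^sup>2 / K\<^sup>2"
    using K by (simp add: power2_diff power_mult_distrib power_divide)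
  also have "(1 + \<bar>real_of_int k\<bar>)\<^sup>2 / K\<^sup>2 \<le> 2 * K / K\<^sup>2" by (rule divide_right_mono[OF k1]) simp
  also have "2 * K / K\<^sup>2 = 2 * (1 / K)" using K by (simp add: power2_eq_square)
  finally have "2 * ((1 + \<bar>real_of_int k\<bar>) * a) \<le> K\<^sup>2 * a\<^sup>2 + 2 * (1 / K)" by simp
  moreover have "0 \<le> (1 + \<bar>real_of_int k\<bar>) * a" by (simp add: a_def)
  ultimately show "(1 + \<bar>real_of_int k\<bar>) * norm (fourier_coeff L u k) \<le>
     (1 + (real_of_int k)\<^sup>2)\<^sup>2 * (norm (fourier_coeff L u k))\<^sup>2 + 2 * (1 / (1 + (real_of_int k)\<^sup>2))"
    unfolding K_def a_def by linarith
qed auto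

text \<open>Sobolev embedding on the unit ball. The arithmetic-geometric splitting is not
  homogeneous, and norm at most 1 is what a unit neighbourhood of the orbit provides.\<close>

lemma H2_sup_bound:
  assumes u: "u \<in> Hs_per L 2" and le: "Hs_norm L 2 u \<le> 1"
  shows "AE x in mu. norm (u x) \<le> sup_const"
proof -
  define c where "c = fourier_coeff L u"
  have s1: "(\<lambda>k. norm (c k)) summable_on UNIV"
    by (rule summable_on_comparison_test[OF H2_summable[OF u]])
       (auto simp: c_def distrib_right)
  have s2: "(\<lambda>k. (1 + (real_of_int k)\<^sup>2)\<^sup>2 * (norm (c k))\<^sup>2) summable_on UNIV"
    using u unfolding Hs_per_2 c_def by simp
  have "(\<Sum>\<^sub>\<infinity>k. norm (c k)) \<le> (\<Sum>\<^sub>\<infinity>k. (1/2) * ((1 + (real_of_int k)\<^sup>2)\<^sup>2 * (norm (c k))\<^sup>2 + 1 / (1 + (real_of_int k)\<^sup>2)))"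
  proof (rule infsum_mono[OF s1])
    show "(\<lambda>k. (1/2) * ((1 + (real_of_int k)\<^sup>2)\<^sup>2 * (norm (c k))\<^sup>2 + 1 / (1 + (real_of_int k)\<^sup>2))) summable_on UNIV"
      by (intro summable_on_cmult_right summable_on_add s2 summable_inverse_int)
    fix k :: int
    have K: "1 + (real_of_int k)\<^sup>2 \<ge> 1" by simp
    \<comment> \<open>Prepares to weaken the inverse square of the weight to its inverse, whose sum
      is known to converge.\<close>
    have "1 + (real_of_int k)\<^sup>2 \<le> (1 + (real_of_int k)\<^sup>2)\<^sup>2"
      using mult_left_mono[OF K, of "1 + (real_of_int k)\<^sup>2"] by (simp add: power2_eq_square)
    then have "1 / (1 + (real_of_int k)\<^sup>2)\<^sup>2 \<le> 1 / (1 + (real_of_int k)\<^sup>2)"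
      using K by (intro divide_left_mono mult_pos_pos zero_less_power) (auto simp: add_pos_nonneg)
    then show "norm (c k) \<le> (1/2) * ((1 + (real_of_int k)\<^sup>2)\<^sup>2 * (norm (c k))\<^sup>2 + 1 / (1 + (real_of_int k)\<^sup>2))"
      using AM_GM_weight[of "1 + (real_of_int k)\<^sup>2" "norm (c k)"] K by simp
  qed
  also have "\<dots> = (1/2) * ((\<Sum>\<^sub>\<infinity>k. (1 + (real_of_int k)\<^sup>2)\<^sup>2 * (norm (c k))\<^sup>2) + (\<Sum>\<^sub>\<infinity>k::int. 1 / (1 + (real_of_int k)\<^sup>2)))"
    unfolding infsum_cmult_right' using infsum_add[OF s2 summable_inverse_int] by simp
  also have "\<dots> \<le> sup_const"
  proof -
    have "(Hs_norm L 2 u)\<^sup>2 \<le> 1\<^sup>2" using le Hs_norm_nonneg by (intro power_mono) auto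
    moreover have "(Hs_norm L 2 u)\<^sup>2 = L * (\<Sum>\<^sub>\<infinity>k. (1 + (real_of_int k)\<^sup>2)\<^sup>2 * (norm (c k))\<^sup>2)"
      unfolding Hs_norm_2 c_def using L_pos by (subst real_sqrt_pow2) (auto intro!: mult_nonneg_nonneg infsum_nonneg)
    ultimately have "(\<Sum>\<^sub>\<infinity>k. (1 + (real_of_int k)\<^sup>2)\<^sup>2 * (norm (c k))\<^sup>2) \<le> 1 / L"
      using L_pos by (simp add: field_simps)
    then show ?thesis by (simp add: sup_const_def)
  qed
  finally have sum: "(\<Sum>\<^sub>\<infinity>k. norm (c k)) \<le> sup_const" .
  obtain V where V: "periodic V" "continuous_on UNIV V" "\<And>k. fourier_coeff L V k = c k"
    "\<And>x. norm (V x) \<le> (\<Sum>\<^sub>\<infinity>k. norm (c k))"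
    using abs_fourier_series[OF s1] by blast
  have "AE x in mu. u x = V x"
    by (rule fourier_coeff_eq_imp_AE_eq) (use u V in \<open>auto simp: c_def Hs_per_2 intro: L2_integrable integrable_mu_cont\<close>)
  then show ?thesis by eventually_elim (use V(4) sum in \<open>auto intro: order_trans\<close>)
qed

text \<open>The zero mean of \<open>G\<close> removes the drift over a period; the free constant of
  integration is spent on prescribing the mean \<open>m\<close>.\<close>

lemma periodic_antiderivative:
  fixes G :: "real \<Rightarrow> complex"
  assumes G: "periodic G" "continuous_on UNIV G" "fourier_coeff L G 0 = 0"
  obtains H where "periodic H" "\<And>x. (H has_vector_derivative G x) (at x)" "fourier_coeff L H 0 = m"
proof -
  obtain F where F: "\<And>x. (F has_vector_derivative G x) (at x)"
    using antiderivative_exists[OF G(2)] by blast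
  define b where "b = m - fourier_coeff L F 0"
  define H where "H x = F x + b" for x
  have Hd: "(H has_vector_derivative G x) (at x)" for x
    unfolding H_def by (auto intro!: derivative_eq_intros F)
  have Fc: "continuous_on A F" for A
    by (rule continuous_at_imp_continuous_on) (auto intro: has_vector_derivative_continuous[OF F])
  have "((\<lambda>y. H (y + L) - H y) has_vector_derivative 0) (at x within UNIV)" for x
  proof -
    have "((\<lambda>y. y + L) has_vector_derivative 1) (at x)" by (auto intro!: derivative_eq_intros)
    from vector_diff_chain_at[OF this Hd]
    have "((\<lambda>y. H (y + L)) has_vector_derivative G (x + L)) (at x)" by (simp add: o_def)
    from has_vector_derivative_diff[OF this Hd[of x]] show ?thesis using G(1) by (simp add: periodic_def)
  qed
  then obtain r where r: "\<And>y. H (y + L) - H y = r"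
    using has_vector_derivative_zero_constant[of UNIV "\<lambda>y. H (y + L) - H y"] by auto
  have "integral\<^sup>L mu G = H L - H 0" by (rule integral_mu_FTC[OF Hd G(2)])
  moreover have "integral\<^sup>L mu G = 0"
    using G(3) L_pos by (simp add: fourier_coeff_mu)
  ultimately have "r = 0" using r[of 0] by simp
  then have Hp: "periodic H" using r by (simp add: periodic_def)
  have "fourier_coeff L H 0 = fourier_coeff L F 0 + fourier_coeff L (\<lambda>x. b) 0"
    unfolding H_def by (intro fourier_coeff_add integrable_mu_cont Fc continuous_intros)
  also have "fourier_coeff L (\<lambda>x. b) 0 = b" using L_pos by (simp add: fourier_coeff_mu scaleR_conv_of_real)
  finally show ?thesis using that[OF Hp Hd] by (simp add: b_def)
qed

text \<open>\<open>U1\<close> is summed from the coefficients times \<open>\<i> * w * k\<close>, and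
  \<open>U\<close> is obtained by integrating it, which gives pointwise differentiability without
  differentiating a series. The second derivative exists only in L2, by Riesz-Fischer.\<close>

lemma H2_regular:
  assumes u: "u \<in> Hs_per L 2"
  obtains U U1 W where "periodic U" "periodic U1" "\<And>x. (U has_vector_derivative U1 x) (at x)" "continuous_on UNIV U1"
    "AE x in mu. u x = U x" "has_weak_deriv L U1 W"
proof -
  define c where "c = fourier_coeff L u"
  define m where "m k = \<i> * of_real (w * of_int k)" for k :: int
  have nm: "norm (m k) = w * \<bar>real_of_int k\<bar>" for k using w_pos by (simp add: m_def norm_mult abs_mult)
  have s2: "(\<lambda>k. w ^ 4 * ((1 + (real_of_int k)\<^sup>2)\<^sup>2 * (norm (c k))\<^sup>2)) summable_on UNIV"
    using u unfolding Hs_per_2 c_def by (intro summable_on_cmult_right) simp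
  have sm: "(\<lambda>k. (norm (m k * (m k * c k)))\<^sup>2) summable_on UNIV"
  proof (rule summable_on_comparison_test[OF s2])
    fix k :: int
    have "(norm (m k * (m k * c k)))\<^sup>2 = w ^ 4 * (((real_of_int k)\<^sup>2)\<^sup>2 * (norm (c k))\<^sup>2)"
      by (simp add: norm_mult nm power2_eq_square power4_eq_xxxx abs_mult_self_eq mult_ac)
    also have "\<dots> \<le> w ^ 4 * ((1 + (real_of_int k)\<^sup>2)\<^sup>2 * (norm (c k))\<^sup>2)"
      using w_pos by (intro mult_left_mono mult_right_mono power_mono) auto
    finally show "(norm (m k * (m k * c k)))\<^sup>2 \<le> w ^ 4 * ((1 + (real_of_int k)\<^sup>2)\<^sup>2 * (norm (c k))\<^sup>2)" .
  qed auto
  obtain W where W: "W \<in> L2_per L" "\<And>k. fourier_coeff L W k = m k * (m k * c k)"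
    using Riesz_Fischer[OF sm] by blast
  have sm1: "(\<lambda>k. norm (m k * c k)) summable_on UNIV"
  proof (rule summable_on_comparison_test)
    show "(\<lambda>k. w * ((1 + \<bar>real_of_int k\<bar>) * norm (c k))) summable_on UNIV"
      unfolding c_def by (intro summable_on_cmult_right H2_summable u)
    fix k :: int
    have "\<bar>real_of_int k\<bar> * norm (c k) \<le> (1 + \<bar>real_of_int k\<bar>) * norm (c k)" by (intro mult_right_mono) auto
    then show "norm (m k * c k) \<le> w * ((1 + \<bar>real_of_int k\<bar>) * norm (c k))"
      using w_pos by (simp add: norm_mult nm mult.assoc)
  qed auto
  obtain U1 where U1: "periodic U1" "continuous_on UNIV U1" "\<And>k. fourier_coeff L U1 k = m k * c k"
    by (rule abs_fourier_series[OF sm1]) (rule that)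
  have wd1: "has_weak_deriv L U1 W"
    by (rule has_weak_deriv_fourierI[OF L2_cont[OF U1(1,2)] W(1)]) (simp only: W(2) U1(3) m_def)
  \<comment> \<open>The mean is the one coefficient that the derivative does not determine.\<close>
  obtain U where U: "periodic U" "\<And>x. (U has_vector_derivative U1 x) (at x)" "fourier_coeff L U 0 = c 0"
    by (rule periodic_antiderivative[OF U1(1,2), of "c 0"]) (use U1(3)[of 0] that in \<open>auto simp: m_def\<close>)
  have Uc: "continuous_on A U" for A
    by (rule continuous_at_imp_continuous_on) (auto intro: has_vector_derivative_continuous[OF U(2)])
  have wd0: "has_weak_deriv L U U1" by (rule has_weak_deriv_C1[OF U(1) U1(1) U(2) U1(2)])
  have Uk: "fourier_coeff L U k = c k" for k
  proof (cases "k = 0")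
    case True
    then show ?thesis using U(3) by simp
  next
    case False
    have "m k * c k = m k * fourier_coeff L U k"
      using has_weak_deriv_fourier[OF wd0, of k] U1(3)[of k] by (simp add: m_def)
    moreover have "m k \<noteq> 0" using False w_pos by (simp add: m_def)
    ultimately show ?thesis by simp
  qed
  have "AE x in mu. u x = U x"
    by (rule fourier_coeff_eq_imp_AE_eq) (use u Uk Uc in \<open>auto simp: c_def Hs_per_2 intro: L2_integrable integrable_mu_cont\<close>)
  then show ?thesis using that[OF U(1) U1(1) U(2) U1(2) _ wd1] by blast
qed

text \<open>The coefficients of \<open>z\<close> have the size of those of \<open>u\<close> times
  \<open>w\<^sup>2 * k\<^sup>2\<close>, so Bessel's inequality for \<open>u\<close> and
  \<open>z\<close> controls the weight through
  \<open>(1 + k\<^sup>2)\<^sup>2 \<le> 2 + 2 * k ^ 4\<close>. It places the wave, its translates and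
  its perturbations in the space.\<close>

lemma weak_deriv2_Hs:
  assumes "has_weak_deriv L u v" "has_weak_deriv L v z"
  shows "u \<in> Hs_per L 2"
proof -
  define c where "c = fourier_coeff L u"
  have L2: "u \<in> L2_per L" "z \<in> L2_per L" using has_weak_deriv_L2 assms by blast+
  have z: "norm (fourier_coeff L z k) = w\<^sup>2 * (real_of_int k)\<^sup>2 * norm (c k)" for k
    unfolding has_weak_deriv_fourier[OF assms(2)] has_weak_deriv_fourier[OF assms(1)] c_def
    using w_pos by (simp add: norm_mult power2_eq_square abs_mult mult_ac)
  have B: "(\<lambda>k. (norm (fourier_coeff L r k))\<^sup>2) summable_on UNIV" if "r \<in> L2_per L" for r
    using that by (intro Bessel_summable) (auto simp: L2_mu measurable_mu)
  have "(\<lambda>k. 2 * (norm (c k))\<^sup>2 + 2 / w ^ 4 * (norm (fourier_coeff L z k))\<^sup>2) summable_on UNIV"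
    unfolding c_def by (intro summable_on_add summable_on_cmult_right B L2)
  then have "(\<lambda>k. (1 + (real_of_int k)\<^sup>2)\<^sup>2 * (norm (c k))\<^sup>2) summable_on UNIV"
  proof (rule summable_on_comparison_test)
    fix k :: int
    have "(1 + (real_of_int k)\<^sup>2)\<^sup>2 \<le> 2 + 2 * ((real_of_int k)\<^sup>2)\<^sup>2"
      using sum_squares_bound[of 1 "(real_of_int k)\<^sup>2"] by (simp add: power2_sum)
    then have "(1 + (real_of_int k)\<^sup>2)\<^sup>2 * (norm (c k))\<^sup>2 \<le> (2 + 2 * ((real_of_int k)\<^sup>2)\<^sup>2) * (norm (c k))\<^sup>2"
      by (rule mult_right_mono) simp
    also have "\<dots> = 2 * (norm (c k))\<^sup>2 + 2 / w ^ 4 * (norm (fourier_coeff L z k))\<^sup>2"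
      unfolding z using w_pos by (simp add: field_simps power_mult_distrib power2_eq_square power4_eq_xxxx)
    finally show "(1 + (real_of_int k)\<^sup>2)\<^sup>2 * (norm (c k))\<^sup>2 \<le> 2 * (norm (c k))\<^sup>2 + 2 / w ^ 4 * (norm (fourier_coeff L z k))\<^sup>2" .
  qed auto
  then show ?thesis unfolding Hs_per_2 c_def using L2 by blast
qed

end

subsection \<open>The energy estimate\<close>

definition pos_part :: "real \<Rightarrow> real" where "pos_part y = max 0 y"

lemma pos_part_nonneg [simp]: "0 \<le> pos_part y"
  by (simp add: pos_part_def)

lemma pos_part_le: "0 \<le> B \<Longrightarrow> \<bar>y\<bar> \<le> B \<Longrightarrow> pos_part y \<le> B"
  by (auto simp: pos_part_def)

lemma pos_part_cont [continuous_intros]: "continuous_on A f \<Longrightarrow> continuous_on A (\<lambda>x. pos_part (f x))"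
  unfolding pos_part_def by (intro continuous_intros)

lemma pos_part_measurable [measurable (raw)]:
  "f \<in> borel_measurable M \<Longrightarrow> (\<lambda>x. pos_part (f x)) \<in> borel_measurable M"
  unfolding pos_part_def by (intro borel_measurable_max) auto

lemma pos_part_sq_deriv: "((\<lambda>y. (pos_part y)\<^sup>2) has_real_derivative 2 * pos_part y) (at y)"
proof -
  consider "y > 0" | "y < 0" | "y = 0" by linarith
  then show ?thesis
  proof cases
    case 1
    have "((\<lambda>y. y\<^sup>2) has_real_derivative 2 * y) (at y)" by (auto intro!: derivative_eq_intros)
    then have "((\<lambda>y. (pos_part y)\<^sup>2) has_real_derivative 2 * y) (at y)"
      by (rule has_field_derivative_transform_within_open[of _ _ _ "{0<..}"]) (use 1 in \<open>auto simp: pos_part_def\<close>)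
    then show ?thesis using 1 by (simp add: pos_part_def)
  next
    case 2
    have "((\<lambda>y. 0) has_real_derivative 0) (at y)" by simp
    then have "((\<lambda>y. (pos_part y)\<^sup>2) has_real_derivative 0) (at y)"
      by (rule has_field_derivative_transform_within_open[of _ _ _ "{..<0}"]) (use 2 in \<open>auto simp: pos_part_def\<close>)
    then show ?thesis using 2 by (simp add: pos_part_def)
  next
    case 3
    have "((\<lambda>h. ((pos_part h)\<^sup>2) / h) \<longlongrightarrow> 0) (at 0)"
    proof (rule Lim_null_comparison)
      show "\<forall>\<^sub>F h in at 0. norm ((pos_part h)\<^sup>2 / h) \<le> \<bar>h\<bar>"
        by (rule always_eventually) (auto simp: pos_part_def max_def power2_eq_square)
      show "((\<lambda>h. \<bar>h\<bar>) \<longlongrightarrow> 0) (at (0::real))" by (intro tendsto_eq_intros) auto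
    qed
    then show ?thesis unfolding DERIV_def 3 by (simp add: pos_part_def)
  qed
qed

text \<open>The remainder is quadratic across the sign change too, because the derivative of the
  cube is Lipschitz on bounded sets. The factor 5 comes from the case \<open>a \<ge> 0\<close>,
  \<open>b < 0\<close>, where \<open>2 * a - 3 * b\<close> appears.\<close>

lemma pos_part_cube_Taylor:
  assumes "\<bar>a\<bar> \<le> B" "\<bar>b\<bar> \<le> B"
  shows "\<bar>pos_part b ^ 3 - pos_part a ^ 3 - 3 * (pos_part a)\<^sup>2 * (b - a)\<bar> \<le> 5 * B * (b - a)\<^sup>2"
proof -
  have B: "B \<ge> 0" using assms by linarith
  consider "a \<ge> 0" "b \<ge> 0" | "a \<ge> 0" "b < 0" | "a < 0" "b \<ge> 0" | "a < 0" "b < 0" by linarith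
  then show ?thesis
  proof cases
    case 1
    have "b ^ 3 - a ^ 3 - 3 * a\<^sup>2 * (b - a) = (b + 2 * a) * (b - a)\<^sup>2" by algebra
    also have "\<bar>\<dots>\<bar> = \<bar>b + 2 * a\<bar> * (b - a)\<^sup>2" by (simp add: abs_mult)
    also have "\<dots> \<le> 5 * B * (b - a)\<^sup>2" using assms by (intro mult_right_mono) auto
    finally show ?thesis using 1 by (simp add: pos_part_def)
  next
    case 2
    have "\<bar>- (a ^ 3) - 3 * a\<^sup>2 * (b - a)\<bar> = \<bar>a\<^sup>2 * (2 * a - 3 * b)\<bar>" by (rule arg_cong[where f = abs]) algebra
    also have "\<dots> = (2 * a - 3 * b) * a\<^sup>2" using 2 by (simp add: abs_mult)
    also have "\<dots> \<le> 5 * B * (b - a)\<^sup>2"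
    proof (rule mult_mono)
      show "2 * a - 3 * b \<le> 5 * B" using assms 2 by simp
      have "a\<^sup>2 \<le> (a - b)\<^sup>2" using 2 by (intro power_mono) auto
      then show "a\<^sup>2 \<le> (b - a)\<^sup>2" by (simp add: power2_commute)
    qed (use B in auto)
    finally show ?thesis using 2 by (simp add: pos_part_def)
  next
    case 3
    have "\<bar>b ^ 3\<bar> = b * b\<^sup>2" using 3 by (simp add: power3_eq_cube power2_eq_square)
    also have "\<dots> \<le> 5 * B * (b - a)\<^sup>2"
      using 3 assms B by (intro mult_mono power_mono) auto
    finally show ?thesis using 3 by (simp add: pos_part_def)
  next
    case 4
    then show ?thesis using B by (simp add: pos_part_def)
  qed
qed

text \<open>\<open>exp (- M * t) * E t - N * t\<close> is nonincreasing, as the decaying factor is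
  at most 1 in front of \<open>N\<close>. Differentiability is asked for only inside the interval,
  since a solution may fail to be differentiable at time 0.\<close>

lemma Gronwall_differential:
  fixes E :: "real \<Rightarrow> real"
  assumes "0 < T" "continuous_on {0..T} E" "E 0 \<le> 0" "0 \<le> N"
    and d: "\<And>t. 0 < t \<Longrightarrow> t < T \<Longrightarrow> (E has_real_derivative E' t) (at t)"
    and le: "\<And>t. 0 < t \<Longrightarrow> t < T \<Longrightarrow> E' t \<le> M * E t + N" and M: "0 \<le> M"
  shows "E T \<le> N * T * exp (M * T)"
proof -
  define G where "G t = exp (- M * t) * E t - N * t" for t
  have "G T \<le> G 0"
  proof (rule DERIV_nonpos_imp_decreasing_open[of 0 T G])
    show "continuous_on {0..T} G" unfolding G_def by (intro continuous_intros assms)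
    show "\<exists>y. (G has_real_derivative y) (at t) \<and> y \<le> 0" if t: "0 < t" "t < T" for t
    proof -
      have "(G has_real_derivative exp (- M * t) * (E' t - M * E t) - N) (at t)"
        unfolding G_def by (auto intro!: derivative_eq_intros d t simp: algebra_simps)
      moreover have "exp (- M * t) * (E' t - M * E t) \<le> exp (- M * t) * N"
        using le[OF t] by (intro mult_left_mono) auto
      moreover have "exp (- M * t) * N \<le> 1 * N" using M t assms(4) by (intro mult_right_mono) auto
      ultimately show ?thesis by (intro exI conjI) (assumption, linarith)
    qed
  qed (use assms in auto)
  then have "exp (- M * T) * E T \<le> N * T" using assms(3) by (simp add: G_def)
  then have "E T / exp (M * T) \<le> N * T" by (simp add: exp_minus field_simps)
  then show ?thesis by (simp add: divide_le_eq)
qed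

context period begin

lemma integrable_mu_bounded:
  fixes h :: "real \<Rightarrow> real"
  assumes "h \<in> borel_measurable mu" "AE x in mu. \<bar>h x\<bar> \<le> B"
  shows "integrable mu h"
  by (rule mu.integrable_const_bound[of _ B]) (use assms in auto)

lemma square_integrable_add_real:
  fixes u v :: "real \<Rightarrow> real"
  assumes "u \<in> borel_measurable mu" "integrable mu (\<lambda>x. (u x)\<^sup>2)"
    and "v \<in> borel_measurable mu" "integrable mu (\<lambda>x. (v x)\<^sup>2)"
  shows "integrable mu (\<lambda>x. (u x + v x)\<^sup>2)"
    "integral\<^sup>L mu (\<lambda>x. (u x + v x)\<^sup>2) \<le> 2 * integral\<^sup>L mu (\<lambda>x. (u x)\<^sup>2) + 2 * integral\<^sup>L mu (\<lambda>x. (v x)\<^sup>2)"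
proof -
  show i: "integrable mu (\<lambda>x. (u x + v x)\<^sup>2)"
    using square_integrable_add[of u v] assms by simp
  have "integral\<^sup>L mu (\<lambda>x. (u x + v x)\<^sup>2) \<le> integral\<^sup>L mu (\<lambda>x. 2 * (u x)\<^sup>2 + 2 * (v x)\<^sup>2)"
    using i assms norm_add_square[of "u _" "v _"] by (intro integral_mono) auto
  also have "\<dots> = 2 * integral\<^sup>L mu (\<lambda>x. (u x)\<^sup>2) + 2 * integral\<^sup>L mu (\<lambda>x. (v x)\<^sup>2)"
    using assms by simp
  finally show "integral\<^sup>L mu (\<lambda>x. (u x + v x)\<^sup>2) \<le> 2 * integral\<^sup>L mu (\<lambda>x. (u x)\<^sup>2) + 2 * integral\<^sup>L mu (\<lambda>x. (v x)\<^sup>2)" .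
qed

text \<open>The exponent 3 makes the derivative of the integrand continuously differentiable, so that it is
  an admissible test function for the weak formulation.\<close>

definition energy :: "(real \<Rightarrow> real) \<Rightarrow> real" where
  "energy z = integral\<^sup>L mu (\<lambda>x. pos_part (z x) ^ 3)"

lemma energy_integrable:
  assumes "z \<in> borel_measurable mu" "AE x in mu. \<bar>z x\<bar> \<le> B" "0 \<le> B"
  shows "integrable mu (\<lambda>x. pos_part (z x) ^ n)"
proof (rule integrable_mu_bounded)
  show "AE x in mu. \<bar>pos_part (z x) ^ n\<bar> \<le> B ^ n"
    using assms(2) by eventually_elim (auto simp: power_abs intro!: power_mono pos_part_le assms)
qed (use assms(1) in measurable)

lemma bounded_square_integrable:
  fixes z :: "real \<Rightarrow> real"
  assumes "z \<in> borel_measurable mu" "AE x in mu. \<bar>z x\<bar> \<le> B"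
  shows "integrable mu (\<lambda>x. (z x)\<^sup>2)"
proof (rule integrable_mu_bounded)
  show "AE x in mu. \<bar>(z x)\<^sup>2\<bar> \<le> B\<^sup>2"
    using assms(2) by eventually_elim (metis abs_ge_zero power2_abs power_mono abs_power2)
qed (use assms(1) in measurable)

text \<open>\<open>Q\<close> measures in mean square how far the difference quotient is from
  \<open>D\<close>. With \<open>q\<close> for this error, \<open>b - a\<close> is
  \<open>h * (q + D)\<close>: the first-order term costs the L1 norm of \<open>q\<close>, and the
  quadratic remainder is of order \<open>h\<close>.\<close>

lemma energy_diff_bound:
  assumes a: "a \<in> borel_measurable mu" "AE x in mu. \<bar>a x\<bar> \<le> B"
    and b: "b \<in> borel_measurable mu" "AE x in mu. \<bar>b x\<bar> \<le> B" and B: "0 \<le> B"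
    and D: "D \<in> borel_measurable mu" "integrable mu (\<lambda>x. (D x)\<^sup>2)" and h: "h \<noteq> 0"
    and Q: "Q = integral\<^sup>L mu (\<lambda>x. ((b x - a x) / h - D x)\<^sup>2)"
  shows "\<bar>(energy b - energy a) / h - integral\<^sup>L mu (\<lambda>x. 3 * (pos_part (a x))\<^sup>2 * D x)\<bar>
     \<le> 3 * B\<^sup>2 * (sqrt L * sqrt Q) + 10 * B * \<bar>h\<bar> * (Q + integral\<^sup>L mu (\<lambda>x. (D x)\<^sup>2))"
proof -
  define q where "q x = (b x - a x) / h - D x" for x
  have qm: "q \<in> borel_measurable mu" unfolding q_def using a b D by measurable
  have q2: "integrable mu (\<lambda>x. (q x)\<^sup>2)"
  proof -
    have "AE x in mu. \<bar>(b x - a x) / h\<bar> \<le> 2 * B / \<bar>h\<bar>"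
      using a(2) b(2) by eventually_elim (auto simp: abs_divide intro!: divide_right_mono)
    then have "integrable mu (\<lambda>x. ((b x - a x) / h)\<^sup>2)"
      using a b by (intro bounded_square_integrable) auto
    then have "integrable mu (\<lambda>x. ((b x - a x) / h + - D x)\<^sup>2)"
      using a b D by (intro square_integrable_add_real) auto
    then show ?thesis by (simp add: q_def)
  qed
  have qi: "integrable mu q" "integrable mu D"
    using square_integrable_imp_integrable[of q] square_integrable_imp_integrable[of D] qm q2 D by auto
  note Ei = energy_integrable[OF a B] energy_integrable[OF b B]
  have aDi: "integrable mu (\<lambda>x. 3 * (pos_part (a x))\<^sup>2 * D x)"
  proof (rule Bochner_Integration.integrable_bound[of mu "\<lambda>x. 3 * B\<^sup>2 * D x"])
    show "AE x in mu. norm (3 * (pos_part (a x))\<^sup>2 * D x) \<le> norm (3 * B\<^sup>2 * D x)"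
      using a(2) by eventually_elim (auto simp: abs_mult intro!: mult_right_mono power_mono pos_part_le B)
  qed (use a D qi in auto)
  have eq: "(energy b - energy a) / h - integral\<^sup>L mu (\<lambda>x. 3 * (pos_part (a x))\<^sup>2 * D x)
     = integral\<^sup>L mu (\<lambda>x. (pos_part (b x) ^ 3 - pos_part (a x) ^ 3) / h - 3 * (pos_part (a x))\<^sup>2 * D x)"
    unfolding energy_def using Ei aDi by simp
  have "\<bar>(energy b - energy a) / h - integral\<^sup>L mu (\<lambda>x. 3 * (pos_part (a x))\<^sup>2 * D x)\<bar>
     \<le> integral\<^sup>L mu (\<lambda>x. \<bar>(pos_part (b x) ^ 3 - pos_part (a x) ^ 3) / h - 3 * (pos_part (a x))\<^sup>2 * D x\<bar>)"
    unfolding eq by (rule integral_abs_bound)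
  also have "\<dots> \<le> integral\<^sup>L mu (\<lambda>x. 3 * B\<^sup>2 * \<bar>q x\<bar> + 10 * B * \<bar>h\<bar> * ((q x)\<^sup>2 + (D x)\<^sup>2))"
  proof (rule integral_mono_AE)
    show "integrable mu (\<lambda>x. \<bar>(pos_part (b x) ^ 3 - pos_part (a x) ^ 3) / h - 3 * (pos_part (a x))\<^sup>2 * D x\<bar>)"
      using Ei aDi by simp
    show "integrable mu (\<lambda>x. 3 * B\<^sup>2 * \<bar>q x\<bar> + 10 * B * \<bar>h\<bar> * ((q x)\<^sup>2 + (D x)\<^sup>2))"
      using qi q2 D by simp
    show "AE x in mu. \<bar>(pos_part (b x) ^ 3 - pos_part (a x) ^ 3) / h - 3 * (pos_part (a x))\<^sup>2 * D x\<bar>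
       \<le> 3 * B\<^sup>2 * \<bar>q x\<bar> + 10 * B * \<bar>h\<bar> * ((q x)\<^sup>2 + (D x)\<^sup>2)"
      using a(2) b(2)
    proof eventually_elim
      fix x assume ab: "\<bar>a x\<bar> \<le> B" "\<bar>b x\<bar> \<le> B"
      define r where "r = pos_part (b x) ^ 3 - pos_part (a x) ^ 3 - 3 * (pos_part (a x))\<^sup>2 * (b x - a x)"
      have bq: "b x - a x = h * (q x + D x)" using h by (simp add: q_def)
      have "\<bar>r\<bar> \<le> 5 * B * (h * (q x + D x))\<^sup>2"
        using pos_part_cube_Taylor[OF ab] by (simp add: r_def bq)
      then have "\<bar>r / h\<bar> \<le> 5 * B * (h * (q x + D x))\<^sup>2 / \<bar>h\<bar>"
        unfolding abs_divide by (rule divide_right_mono) simp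
      also have "\<dots> = 5 * B * \<bar>h\<bar> * (q x + D x)\<^sup>2"
        using h by (cases "h > 0") (auto simp: power_mult_distrib power2_eq_square field_simps)
      also have "\<dots> \<le> 5 * B * \<bar>h\<bar> * (2 * (q x)\<^sup>2 + 2 * (D x)\<^sup>2)"
        using norm_add_square[of "q x" "D x"] B by (intro mult_left_mono) auto
      finally have r1: "\<bar>r / h\<bar> \<le> 10 * B * \<bar>h\<bar> * ((q x)\<^sup>2 + (D x)\<^sup>2)" by (simp add: algebra_simps)
      have "\<bar>3 * (pos_part (a x))\<^sup>2 * q x\<bar> \<le> 3 * B\<^sup>2 * \<bar>q x\<bar>"
        using ab by (auto simp: abs_mult intro!: mult_right_mono power_mono pos_part_le B)
      moreover have "(pos_part (b x) ^ 3 - pos_part (a x) ^ 3) / h - 3 * (pos_part (a x))\<^sup>2 * D x = 3 * (pos_part (a x))\<^sup>2 * q x + r / h"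
        using h unfolding r_def bq by (simp add: field_simps)
      ultimately show "\<bar>(pos_part (b x) ^ 3 - pos_part (a x) ^ 3) / h - 3 * (pos_part (a x))\<^sup>2 * D x\<bar>
       \<le> 3 * B\<^sup>2 * \<bar>q x\<bar> + 10 * B * \<bar>h\<bar> * ((q x)\<^sup>2 + (D x)\<^sup>2)"
        using r1 by linarith
    qed
  qed
  also have "\<dots> = 3 * B\<^sup>2 * integral\<^sup>L mu (\<lambda>x. \<bar>q x\<bar>) + 10 * B * \<bar>h\<bar> * (Q + integral\<^sup>L mu (\<lambda>x. (D x)\<^sup>2))"
    using qi q2 D by (simp add: Q q_def[symmetric])
  also have "\<dots> \<le> 3 * B\<^sup>2 * (sqrt L * sqrt Q) + 10 * B * \<bar>h\<bar> * (Q + integral\<^sup>L mu (\<lambda>x. (D x)\<^sup>2))"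
    using Cauchy_Schwarz_1[OF qm q2] by (intro add_right_mono mult_left_mono) (auto simp: Q q_def)
  finally show ?thesis .
qed

text \<open>Chain rule along a curve that is differentiable only in mean square. The uniform bound
  \<open>B\<close> tames the cube, and the estimate of \<open>energy_diff_bound\<close> tends to 0
  together with \<open>s - t\<close>.\<close>

lemma energy_has_derivative:
  assumes Z: "\<And>s. s \<in> S \<Longrightarrow> Z s \<in> borel_measurable mu" "\<And>s. s \<in> S \<Longrightarrow> AE x in mu. \<bar>Z s x\<bar> \<le> B"
    and B: "0 \<le> B" and t: "t \<in> S"
    and D: "D \<in> borel_measurable mu" "integrable mu (\<lambda>x. (D x)\<^sup>2)"
    and lim: "((\<lambda>s. integral\<^sup>L mu (\<lambda>x. ((Z s x - Z t x) / (s - t) - D x)\<^sup>2)) \<longlongrightarrow> 0) (at t within S)"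
  shows "((\<lambda>s. energy (Z s)) has_real_derivative integral\<^sup>L mu (\<lambda>x. 3 * (pos_part (Z t x))\<^sup>2 * D x)) (at t within S)"
  unfolding has_field_derivative_iff
proof (subst Lim_null, rule Lim_null_comparison)
  define Q where "Q s = integral\<^sup>L mu (\<lambda>x. ((Z s x - Z t x) / (s - t) - D x)\<^sup>2)" for s
  show "\<forall>\<^sub>F s in at t within S. norm ((energy (Z s) - energy (Z t)) / (s - t) - integral\<^sup>L mu (\<lambda>x. 3 * (pos_part (Z t x))\<^sup>2 * D x))
     \<le> 3 * B\<^sup>2 * (sqrt L * sqrt (Q s)) + 10 * B * \<bar>s - t\<bar> * (Q s + integral\<^sup>L mu (\<lambda>x. (D x)\<^sup>2))"
    unfolding eventually_at_filter
  proof (rule always_eventually, intro allI impI)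
    fix s assume "s \<noteq> t" "s \<in> S"
    then show "norm ((energy (Z s) - energy (Z t)) / (s - t) - integral\<^sup>L mu (\<lambda>x. 3 * (pos_part (Z t x))\<^sup>2 * D x))
     \<le> 3 * B\<^sup>2 * (sqrt L * sqrt (Q s)) + 10 * B * \<bar>s - t\<bar> * (Q s + integral\<^sup>L mu (\<lambda>x. (D x)\<^sup>2))"
      unfolding real_norm_def using Z t by (intro energy_diff_bound B D) (auto simp: Q_def)
  qed
  have "((\<lambda>s. 3 * B\<^sup>2 * (sqrt L * sqrt (Q s)) + 10 * B * \<bar>s - t\<bar> * (Q s + integral\<^sup>L mu (\<lambda>x. (D x)\<^sup>2)))
    \<longlongrightarrow> 3 * B\<^sup>2 * (sqrt L * sqrt 0) + 10 * B * \<bar>t - t\<bar> * (0 + integral\<^sup>L mu (\<lambda>x. (D x)\<^sup>2))) (at t within S)"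
    using lim unfolding Q_def[symmetric] by (intro tendsto_intros)
  then show "((\<lambda>s. 3 * B\<^sup>2 * (sqrt L * sqrt (Q s)) + 10 * B * \<bar>s - t\<bar> * (Q s + integral\<^sup>L mu (\<lambda>x. (D x)\<^sup>2))) \<longlongrightarrow> 0) (at t within S)"
    by simp
qed

lemma energy_continuous:
  assumes Z: "\<And>s. s \<in> S \<Longrightarrow> Z s \<in> borel_measurable mu" "\<And>s. s \<in> S \<Longrightarrow> AE x in mu. \<bar>Z s x\<bar> \<le> B"
    and B: "0 \<le> B" and t: "t \<in> S"
    and lim: "((\<lambda>s. integral\<^sup>L mu (\<lambda>x. (Z s x - Z t x)\<^sup>2)) \<longlongrightarrow> 0) (at t within S)"
  shows "continuous (at t within S) (\<lambda>s. energy (Z s))"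
  unfolding continuous_within
proof (subst Lim_null, rule Lim_null_comparison)
  define Q where "Q s = integral\<^sup>L mu (\<lambda>x. (Z s x - Z t x)\<^sup>2)" for s
  show "\<forall>\<^sub>F s in at t within S. norm (energy (Z s) - energy (Z t)) \<le> 3 * B\<^sup>2 * (sqrt L * sqrt (Q s)) + 10 * B * Q s"
    unfolding eventually_at_filter
  proof (rule always_eventually, intro allI impI)
    fix s assume "s \<noteq> t" "s \<in> S"
    then show "norm (energy (Z s) - energy (Z t)) \<le> 3 * B\<^sup>2 * (sqrt L * sqrt (Q s)) + 10 * B * Q s"
      \<comment> \<open>With \<open>h = 1\<close> and \<open>D = 0\<close> the difference quotient
        is the plain increment.\<close>
      using energy_diff_bound[of "Z t" B "Z s" "\<lambda>x. 0" 1 "Q s"] Z t B by (simp add: Q_def)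
  qed
  have "((\<lambda>s. 3 * B\<^sup>2 * (sqrt L * sqrt (Q s)) + 10 * B * Q s) \<longlongrightarrow> 3 * B\<^sup>2 * (sqrt L * sqrt 0) + 10 * B * 0) (at t within S)"
    using lim unfolding Q_def[symmetric] by (intro tendsto_intros)
  then show "((\<lambda>s. 3 * B\<^sup>2 * (sqrt L * sqrt (Q s)) + 10 * B * Q s) \<longlongrightarrow> 0) (at t within S)" by simp
qed

lemma C1_perD:
  assumes "C1_per p p'"
  shows "periodic p" "(p has_real_derivative p' x) (at x)" "continuous_on A p'" "continuous_on A p"
  using assms C1_per_cont[OF assms] continuous_on_subset[of UNIV p' A] by (auto simp: C1_per_def)

lemma C1_per_deriv_periodic:
  assumes "C1_per p p'" shows "periodic p'"
  unfolding periodic_def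
proof
  fix x
  have "((\<lambda>y. p (y + L)) has_real_derivative p' (x + L)) (at x)"
    using DERIV_shift[of p "p' (x + L)" x L] C1_perD(2)[OF assms] by simp
  moreover have "(\<lambda>y. p (y + L)) = p" using C1_perD(1)[OF assms] by (auto simp: periodic_def)
  ultimately show "p' (x + L) = p' x" using C1_perD(2)[OF assms] DERIV_unique by metis
qed

lemma C1_per_weak_deriv: "C1_per p p' \<Longrightarrow> has_weak_deriv L p p'"
  by (rule has_weak_deriv_C1)
     (auto simp: C1_perD C1_per_deriv_periodic has_real_derivative_iff_has_vector_derivative[symmetric])

lemma C1_per_compose:
  assumes "C1_per p p'" "\<And>y. (f has_real_derivative f' y) (at y)" "continuous_on UNIV f'"
  shows "C1_per (\<lambda>x. f (p x)) (\<lambda>x. f' (p x) * p' x)"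
  unfolding C1_per_def
proof (intro conjI allI)
  show "periodic (\<lambda>x. f (p x))" using C1_perD(1)[OF assms(1)] by (simp add: periodic_def)
  show "((\<lambda>x. f (p x)) has_real_derivative f' (p x) * p' x) (at x)" for x
    using DERIV_chain2[OF assms(2) C1_perD(2)[OF assms(1)]] .
  show "continuous_on UNIV (\<lambda>x. f' (p x) * p' x)"
    by (intro continuous_intros C1_perD[OF assms(1)] continuous_on_compose2[OF assms(3)]) auto
qed

lemma C1_per_diff:
  assumes "C1_per p p'" "C1_per q q'" shows "C1_per (\<lambda>x. p x - q x) (\<lambda>x. p' x - q' x)"
  using assms unfolding C1_per_def periodic_def by (auto intro!: derivative_eq_intros continuous_intros)

text \<open>The equation for \<open>U\<close> and the inequality for \<open>s\<close> are subtracted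
  and multiplied by \<open>p\<close>, the derivative of the cube, which is nonnegative and an
  admissible test function. Diffusion then contributes \<open>- 6 * z * y\<^sup>2\<close> for the
  difference \<open>y\<close> of the gradients, and this absorbs the flux term.\<close>

lemma energy_dissipation:
  assumes U: "C1_per U U1" "has_weak_deriv L U1 W" "has_weak_deriv L (\<lambda>x. f (U x)) fw"
    and s: "C1_per s s1" "C1_per s1 s2"
    and f: "\<And>y. (f has_real_derivative f' y) (at y)" "continuous_on UNIV f'"
    and g: "continuous_on UNIV g"
    and R: "\<And>x. \<bar>s x\<bar> \<le> R" "AE x in mu. \<bar>U x\<bar> \<le> R"
    and M: "\<And>a b. \<bar>a\<bar> \<le> R \<Longrightarrow> \<bar>b\<bar> \<le> R \<Longrightarrow> \<bar>f a - f b\<bar> \<le> M * \<bar>a - b\<bar>"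
      "\<And>a b. \<bar>a\<bar> \<le> R \<Longrightarrow> \<bar>b\<bar> \<le> R \<Longrightarrow> \<bar>g a - g b\<bar> \<le> M * \<bar>a - b\<bar>" "0 \<le> M"
    and st: "continuous_on UNIV st" "\<And>x. st x \<le> s2 x - f' (s x) * s1 x + g (s x) + d" "0 \<le> d"
    and v: "integrable mu v" "AE x in mu. v x + fw x = W x + g (U x)"
  shows "integral\<^sup>L mu (\<lambda>x. 3 * (pos_part (s x - U x))\<^sup>2 * (st x - v x))
    \<le> (3 / 2 * M\<^sup>2 + 3 * M) * energy (\<lambda>x. s x - U x) + 12 * R\<^sup>2 * d * L"
proof -
  define z where "z x = pos_part (s x - U x)" for x
  define p where "p x = 3 * (z x)\<^sup>2" for x
  define p' where "p' x = 6 * z x * (s1 x - U1 x)" for x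
  have R0: "0 \<le> R" using R(1)[of 0] by linarith
  have zz: "z x \<ge> 0" for x by (simp add: z_def)
  have pp: "p x \<ge> 0" for x by (simp add: p_def)
  have p: "C1_per p p'"
  proof -
    have "C1_per (\<lambda>x. 3 * (pos_part (s x - U x))\<^sup>2) (\<lambda>x. (3 * (2 * pos_part (s x - U x))) * (s1 x - U1 x))"
      by (rule C1_per_compose[OF C1_per_diff[OF s(1) U(1)], where f = "\<lambda>y. 3 * (pos_part y)\<^sup>2" and f' = "\<lambda>y. 3 * (2 * pos_part y)"])
         (use DERIV_cmult[OF pos_part_sq_deriv, of 3] in \<open>auto intro!: continuous_intros\<close>)
    moreover have "p = (\<lambda>x. 3 * (pos_part (s x - U x))\<^sup>2)" "p' = (\<lambda>x. (3 * (2 * pos_part (s x - U x))) * (s1 x - U1 x))"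
      by (auto simp: p_def p'_def z_def)
    ultimately show ?thesis by simp
  qed
  have fs: "C1_per (\<lambda>x. f (s x)) (\<lambda>x. f' (s x) * s1 x)" by (rule C1_per_compose[OF s(1) f])
  have fU: "C1_per (\<lambda>x. f (U x)) (\<lambda>x. f' (U x) * U1 x)" by (rule C1_per_compose[OF U(1) f])
  have gc: "continuous_on UNIV (\<lambda>x. g (h x))" if "continuous_on UNIV h" for h :: "real \<Rightarrow> real"
    by (rule continuous_on_compose2[OF g that]) auto
  note pc = C1_perD(4)[OF p] and p'c = C1_perD(3)[OF p]
  note sc = C1_perD(4)[OF s(1)] C1_perD(4)[OF s(2)] C1_perD(3)[OF s(2)] C1_perD(4)[OF U(1)] C1_perD(3)[OF U(1)]
    C1_perD(4)[OF fs] C1_perD(3)[OF fs] C1_perD(4)[OF fU]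
  have Wi: "integrable mu W" "integrable mu fw"
    using has_weak_deriv_L2(2)[OF U(2)] has_weak_deriv_L2(2)[OF U(3)] L2_integrable by blast+
  have pWi: "integrable mu (\<lambda>x. p x * W x)" "integrable mu (\<lambda>x. p x * fw x)" "integrable mu (\<lambda>x. p x * v x)"
    using integrable_scaleR_cont[OF Wi(1) pc] integrable_scaleR_cont[OF Wi(2) pc] integrable_scaleR_cont[OF v(1) pc] by simp_all
  have ci: "integrable mu (\<lambda>x. p x * s2 x)" "integrable mu (\<lambda>x. p x * (f' (s x) * s1 x))"
    "integrable mu (\<lambda>x. p x * (g (s x) - g (U x)))" "integrable mu (\<lambda>x. p x * d)" "integrable mu (\<lambda>x. p x * st x)"
    "integrable mu (\<lambda>x. p' x * s1 x)" "integrable mu (\<lambda>x. p' x * U1 x)"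
    "integrable mu (\<lambda>x. p' x * f (s x))" "integrable mu (\<lambda>x. p' x * f (U x))"
    by (intro integrable_mu_cont continuous_intros pc p'c sc gc st(1))+
  have zi: "integrable mu (\<lambda>x. z x ^ 3)"
    unfolding z_def by (intro integrable_mu_cont continuous_intros sc)
  have parts: "integral\<^sup>L mu (\<lambda>x. p x * s2 x) = - integral\<^sup>L mu (\<lambda>x. p' x * s1 x)"
    "integral\<^sup>L mu (\<lambda>x. p x * W x) = - integral\<^sup>L mu (\<lambda>x. p' x * U1 x)"
    "integral\<^sup>L mu (\<lambda>x. p x * (f' (s x) * s1 x)) = - integral\<^sup>L mu (\<lambda>x. p' x * f (s x))"
    "integral\<^sup>L mu (\<lambda>x. p x * fw x) = - integral\<^sup>L mu (\<lambda>x. p' x * f (U x))"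
    using has_weak_deriv_test[OF C1_per_weak_deriv[OF s(2)] p] has_weak_deriv_test[OF U(2) p]
      has_weak_deriv_test[OF C1_per_weak_deriv[OF fs] p] has_weak_deriv_test[OF U(3) p] by simp_all
  have "integral\<^sup>L mu (\<lambda>x. p x * (st x - v x)) \<le> integral\<^sup>L mu (\<lambda>x. p x * s2 x - p x * W x - p x * (f' (s x) * s1 x)
      + p x * fw x + p x * (g (s x) - g (U x)) + p x * d)"
  proof (rule integral_mono_AE)
    show "integrable mu (\<lambda>x. p x * (st x - v x))" using ci(5) pWi(3) by (simp add: right_diff_distrib)
    show "integrable mu (\<lambda>x. p x * s2 x - p x * W x - p x * (f' (s x) * s1 x) + p x * fw x + p x * (g (s x) - g (U x)) + p x * d)"
      by (intro Bochner_Integration.integrable_add Bochner_Integration.integrable_diff ci pWi)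
    show "AE x in mu. p x * (st x - v x) \<le> p x * s2 x - p x * W x - p x * (f' (s x) * s1 x) + p x * fw x + p x * (g (s x) - g (U x)) + p x * d"
      using v(2)
    proof eventually_elim
      fix x assume "v x + fw x = W x + g (U x)"
      then have "st x - v x \<le> s2 x - W x - f' (s x) * s1 x + fw x + (g (s x) - g (U x)) + d" using st(2)[of x] by linarith
      from mult_left_mono[OF this pp[of x]]
      show "p x * (st x - v x) \<le> p x * s2 x - p x * W x - p x * (f' (s x) * s1 x) + p x * fw x + p x * (g (s x) - g (U x)) + p x * d"
        by (simp only: distrib_left right_diff_distrib)
    qed
  qed
  also have "\<dots> = integral\<^sup>L mu (\<lambda>x. p' x * U1 x - p' x * s1 x + p' x * f (s x) - p' x * f (U x) + p x * (g (s x) - g (U x)) + p x * d)"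
    using ci(1-4,6-9) pWi(1,2) parts by simp
  also have "\<dots> \<le> integral\<^sup>L mu (\<lambda>x. (3 / 2 * M\<^sup>2 + 3 * M) * z x ^ 3 + 12 * R\<^sup>2 * d)"
  proof (rule integral_mono_AE)
    show "integrable mu (\<lambda>x. p' x * U1 x - p' x * s1 x + p' x * f (s x) - p' x * f (U x) + p x * (g (s x) - g (U x)) + p x * d)"
      by (intro Bochner_Integration.integrable_add Bochner_Integration.integrable_diff ci)
    show "integrable mu (\<lambda>x. (3 / 2 * M\<^sup>2 + 3 * M) * z x ^ 3 + 12 * R\<^sup>2 * d)" using zi by simp
    show "AE x in mu. p' x * U1 x - p' x * s1 x + p' x * f (s x) - p' x * f (U x) + p x * (g (s x) - g (U x)) + p x * d
      \<le> (3 / 2 * M\<^sup>2 + 3 * M) * z x ^ 3 + 12 * R\<^sup>2 * d"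
      using R(2)
    proof eventually_elim
      fix x assume Ux: "\<bar>U x\<bar> \<le> R"
      show "p' x * U1 x - p' x * s1 x + p' x * f (s x) - p' x * f (U x) + p x * (g (s x) - g (U x)) + p x * d
        \<le> (3 / 2 * M\<^sup>2 + 3 * M) * z x ^ 3 + 12 * R\<^sup>2 * d"
      proof (cases "s x - U x > 0")
        case False
        then have "z x = 0" by (simp add: z_def pos_part_def)
        then show ?thesis using st(3) by (simp add: p_def p'_def)
      next
        case True
        then have zx: "z x = s x - U x" "\<bar>s x - U x\<bar> = z x" by (auto simp: z_def pos_part_def)
        define y where "y = s1 x - U1 x"
        define F where "F = f (s x) - f (U x)"
        have F: "\<bar>F\<bar> \<le> M * z x" using M(1)[OF R(1) Ux, of x] zx by (simp add: F_def)
        then have "F\<^sup>2 \<le> (M * z x)\<^sup>2" by (metis abs_ge_zero power2_abs power_mono)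
        \<comment> \<open>Completing the square bounds the flux term without any bound on the
          gradient difference \<open>y\<close>.\<close>
        moreover have "0 \<le> (y - F / 2)\<^sup>2" by simp
        ultimately have "- y\<^sup>2 + y * F \<le> M\<^sup>2 * (z x)\<^sup>2 / 4" by (simp add: power2_diff power_mult_distrib power_divide)
        then have "6 * z x * (- y\<^sup>2 + y * F) \<le> 6 * z x * (M\<^sup>2 * (z x)\<^sup>2 / 4)" using zz[of x] by (intro mult_left_mono) auto
        moreover have "p' x * U1 x - p' x * s1 x + p' x * f (s x) - p' x * f (U x) = 6 * z x * (- y\<^sup>2 + y * F)"
          unfolding p'_def y_def F_def by algebra
        moreover have "6 * z x * (M\<^sup>2 * (z x)\<^sup>2 / 4) = 3 / 2 * M\<^sup>2 * z x ^ 3" by (simp add: power2_eq_square power3_eq_cube)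
        ultimately have 1: "p' x * U1 x - p' x * s1 x + p' x * f (s x) - p' x * f (U x) \<le> 3 / 2 * M\<^sup>2 * z x ^ 3" by linarith
        have "g (s x) - g (U x) \<le> M * z x" using M(2)[OF R(1) Ux, of x] zx by simp
        then have "p x * (g (s x) - g (U x)) \<le> p x * (M * z x)" by (rule mult_left_mono[OF _ pp])
        also have "\<dots> = 3 * M * z x ^ 3" by (simp add: p_def power2_eq_square power3_eq_cube)
        finally have 2: "p x * (g (s x) - g (U x)) \<le> 3 * M * z x ^ 3" .
        \<comment> \<open>Both functions take values between \<open>- R\<close> and
          \<open>R\<close>; the factor 12 of the defect term is
          \<open>3 * 2\<^sup>2\<close>.\<close>
        have "z x \<le> 2 * R" using zx R(1)[of x] Ux by linarith
        then have "(z x)\<^sup>2 \<le> (2 * R)\<^sup>2" using zz by (intro power_mono) auto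
        then have "p x \<le> 12 * R\<^sup>2" by (simp add: p_def power_mult_distrib)
        then have 3: "p x * d \<le> 12 * R\<^sup>2 * d" using st(3) by (rule mult_right_mono)
        from 1 2 3 show ?thesis by (simp add: distrib_right)
      qed
    qed
  qed
  also have "\<dots> = (3 / 2 * M\<^sup>2 + 3 * M) * energy (\<lambda>x. s x - U x) + 12 * R\<^sup>2 * d * L"
    using zi by (simp add: energy_def z_def mult.commute)
  finally show ?thesis by (simp add: p_def z_def)
qed

subsection \<open>The comparison principle\<close>

lemma real_Hs_imp_L2:
  assumes "u \<in> real_Hs_per L s" shows "u \<in> L2_per L"
proof -
  have "(\<lambda>x. complex_of_real (u x)) \<in> L2_per L" using assms by (simp add: real_Hs_per_def Hs_per_def)
  from L2_bounded_linear[OF bounded_linear_Re this] show ?thesis by simp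
qed

lemma L2_imp_real_Hs_0: "u \<in> L2_per L \<Longrightarrow> u \<in> real_Hs_per L 0"
  unfolding real_Hs_per_def Hs_per_0 by (simp add: L2_bounded_linear[OF bounded_linear_of_real])

lemma real_L2_le_Hs_norm:
  assumes "u \<in> real_Hs_per L s" "s \<ge> 0"
  shows "integral\<^sup>L mu (\<lambda>x. (u x)\<^sup>2) \<le> (real_Hs_norm L s u)\<^sup>2"
  using L2_le_Hs_norm[of "\<lambda>x. complex_of_real (u x)" s] assms by (simp add: real_Hs_per_def real_Hs_norm_def)

lemma real_Hs_diff:
  assumes "u \<in> real_Hs_per L s" "v \<in> real_Hs_per L s"
  shows "(\<lambda>x. u x - v x) \<in> real_Hs_per L s"
  using Hs_per_diff[of "\<lambda>x. complex_of_real (u x)" s "\<lambda>x. complex_of_real (v x)"] assms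
  by (simp add: real_Hs_per_def)

lemma real_Hs_norm_nonneg: "0 \<le> real_Hs_norm L s u"
  by (simp add: real_Hs_norm_def Hs_norm_nonneg)

lemma real_H2_sup_bound:
  assumes "u \<in> real_Hs_per L 2" "real_Hs_norm L 2 u \<le> 1"
  shows "AE x in mu. \<bar>u x\<bar> \<le> sup_const"
  using H2_sup_bound[of "\<lambda>x. complex_of_real (u x)"] assms by (simp add: real_Hs_per_def real_Hs_norm_def)

text \<open>Identifies the iterated choice \<open>weak_deriv L (weak_deriv L u)\<close>, as it
  occurs in the equation, with a weak derivative of the continuous \<open>U1\<close>.\<close>

lemma real_H2_regular:
  assumes u: "u \<in> real_Hs_per L 2"
  obtains U U1 where "C1_per U U1" "AE x in mu. u x = U x"
    "has_weak_deriv L U1 (weak_deriv L (weak_deriv L u))"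
proof -
  have "(\<lambda>x. complex_of_real (u x)) \<in> Hs_per L 2" using u by (simp add: real_Hs_per_def)
  from H2_regular[OF this] obtain V V1 W where V: "periodic V" "periodic V1"
    "\<And>x. (V has_vector_derivative V1 x) (at x)" "continuous_on UNIV V1"
    "AE x in mu. complex_of_real (u x) = V x" "has_weak_deriv L V1 W" by metis
  define U where "U x = Re (V x)" for x
  define U1 where "U1 x = Re (V1 x)" for x
  have C1: "C1_per U U1"
    unfolding C1_per_def periodic_def U_def U1_def has_real_derivative_iff_has_vector_derivative
    using V(1) by (intro conjI allI bounded_linear.has_vector_derivative[OF bounded_linear_Re V(3)] continuous_intros V(4))
      (simp add: periodic_def)
  have AE: "AE x in mu. u x = U x" using V(5) by eventually_elim (metis Re_complex_of_real U_def)
  then have AE': "AE x in mu. U x = u x" by eventually_elim simp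
  have "has_weak_deriv L u U1"
    by (rule has_weak_deriv_cong[OF C1_per_weak_deriv[OF C1] real_Hs_imp_L2[OF u] AE'])
  moreover have "has_weak_deriv L U1 (\<lambda>x. Re (W x))"
    unfolding U1_def by (rule has_weak_deriv_bounded_linear[OF bounded_linear_Re V(6)])
  ultimately have "has_weak_deriv L U1 (weak_deriv L (weak_deriv L u))"
    by (intro weak_deriv_twice(2)[of u U1 "\<lambda>x. Re (W x)"] has_weak_deriv_unique_real)
  with C1 AE that show ?thesis by blast
qed

lemma L2_real_measurable:
  fixes u :: "real \<Rightarrow> real"
  assumes "u \<in> L2_per L" shows "u \<in> borel_measurable mu" "integrable mu (\<lambda>x. (u x)\<^sup>2)"
  using assms by (auto simp: L2_mu measurable_mu)

lemma tendsto_0_square_Hs: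
  assumes "((\<lambda>s. real_Hs_norm L a (h s)) \<longlongrightarrow> 0) (at t within S)" "0 \<le> a"
    and "\<And>s. s \<in> S \<Longrightarrow> s \<noteq> t \<Longrightarrow> h s \<in> real_Hs_per L a"
  shows "((\<lambda>s. integral\<^sup>L mu (\<lambda>x. (h s x)\<^sup>2)) \<longlongrightarrow> 0) (at t within S)"
proof (rule Lim_null_comparison)
  show "((\<lambda>s. (real_Hs_norm L a (h s))\<^sup>2) \<longlongrightarrow> 0) (at t within S)"
    using tendsto_power[OF assms(1), of 2] by simp
  show "\<forall>\<^sub>F s in at t within S. norm (integral\<^sup>L mu (\<lambda>x. (h s x)\<^sup>2)) \<le> (real_Hs_norm L a (h s))\<^sup>2"
    unfolding eventually_at_filter using real_L2_le_Hs_norm[OF assms(3) assms(2)] by (auto intro!: always_eventually)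
qed

lemma solution_continuous_L2:
  assumes u: "solution_on f g L T u" and t: "t \<in> {0..T}"
  shows "((\<lambda>s. integral\<^sup>L mu (\<lambda>x. (u s x - u t x)\<^sup>2)) \<longlongrightarrow> 0) (at t within {0..T})"
  using u t by (intro tendsto_0_square_Hs[of 2] real_Hs_diff) (auto simp: solution_on_def)

text \<open>Restates the equation at one time for the C1 representative \<open>U\<close> of
  \<open>u t\<close>, the form in which \<open>energy_dissipation\<close> can use it.\<close>

lemma solution_derivative_L2:
  assumes u: "solution_on f g L T u" and t: "0 < t" "t < T" and f: "continuous_on UNIV f"
  obtains v fw U U1 W where "v \<in> L2_per L"
    "((\<lambda>s. integral\<^sup>L mu (\<lambda>x. ((u s x - u t x) / (s - t) - v x)\<^sup>2)) \<longlongrightarrow> 0) (at t)"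
    "C1_per U U1" "AE x in mu. u t x = U x" "has_weak_deriv L U1 W"
    "has_weak_deriv L (\<lambda>x. f (U x)) fw" "AE x in mu. v x + fw x = W x + g (U x)"
proof -
  have H2: "u s \<in> real_Hs_per L 2" if "s \<in> {0..T}" for s using u that by (auto simp: solution_on_def)
  from u obtain v where v: "\<And>t. t \<in> {0<..T} \<Longrightarrow> v t \<in> real_Hs_per L 0"
    "\<And>t. t \<in> {0<..T} \<Longrightarrow> ((\<lambda>s. real_Hs_norm L 0 (\<lambda>x. (u s x - u t x) / (s - t) - v t x)) \<longlongrightarrow> 0) (at t within {0<..T})"
    "\<And>t. t \<in> {0<..T} \<Longrightarrow> \<exists>w. has_weak_deriv L (\<lambda>x. f (u t x)) w \<and>
           (AE x in lborel. v t x + w x = weak_deriv L (weak_deriv L (u t)) x + g (u t x))"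
    unfolding solution_on_def by blast
  have t': "t \<in> {0<..T}" "t \<in> {0..T}" using t by auto
  have vL2: "v t \<in> L2_per L" using real_Hs_imp_L2 v(1)[OF t'(1)] by blast
  have "((\<lambda>s. integral\<^sup>L mu (\<lambda>x. ((u s x - u t x) / (s - t) - v t x)\<^sup>2)) \<longlongrightarrow> 0) (at t within {0<..T})"
  proof (rule tendsto_0_square_Hs[OF v(2)[OF t'(1)]])
    fix s assume s: "s \<in> {0<..T}"
    have "(\<lambda>x. (u s x - u t x) / (s - t)) \<in> L2_per L"
      using L2_scaleR[OF L2_diff[OF real_Hs_imp_L2[OF H2] real_Hs_imp_L2[OF H2[OF t'(2)]]], of s "inverse (s - t)"] s
      by (simp add: divide_inverse mult.commute)
    then show "(\<lambda>x. (u s x - u t x) / (s - t) - v t x) \<in> real_Hs_per L 0"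
      by (intro L2_imp_real_Hs_0 L2_diff vL2)
  qed simp
  \<comment> \<open>\<open>t\<close> is an interior time, so the limit within the interval is a full
    limit.\<close>
  moreover have "at t within {0<..T} = at t"
    using t by (intro at_within_interior interiorI[of "{0<..<T}"]) auto
  ultimately have lim: "((\<lambda>s. integral\<^sup>L mu (\<lambda>x. ((u s x - u t x) / (s - t) - v t x)\<^sup>2)) \<longlongrightarrow> 0) (at t)"
    by simp
  obtain U U1 where U: "C1_per U U1" "AE x in mu. u t x = U x"
    "has_weak_deriv L U1 (weak_deriv L (weak_deriv L (u t)))"
    using real_H2_regular[OF H2[OF t'(2)]] by blast
  obtain fw where fw: "has_weak_deriv L (\<lambda>x. f (u t x)) fw"
    "AE x in lborel. v t x + fw x = weak_deriv L (weak_deriv L (u t)) x + g (u t x)"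
    using v(3)[OF t'(1)] by blast
  have fU: "(\<lambda>x. f (U x)) \<in> L2_per L"
    using C1_perD(1,4)[OF U(1)]
    by (intro L2_cont continuous_on_compose2[OF f]) (auto simp: periodic_def)
  have "AE x in mu. f (u t x) = f (U x)" using U(2) by eventually_elim simp
  then have "has_weak_deriv L (\<lambda>x. f (U x)) fw" by (rule has_weak_deriv_cong[OF fw(1) fU])
  moreover have "AE x in mu. v t x + fw x = weak_deriv L (weak_deriv L (u t)) x + g (U x)"
    using AE_mu[OF fw(2)] U(2) by eventually_elim simp
  ultimately show ?thesis using that vL2 lim U by blast
qed

text \<open>The energy of \<open>s - u\<close> vanishes initially and obeys a Gronwall inequality
  whose source is the defect \<open>d\<close>. The uniform quadratic remainder in time makes the
  difference quotients of \<open>s\<close> converge in mean square, like those of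
  \<open>u\<close>.\<close>

lemma comparison:
  assumes u: "solution_on f g L T u" and T: "0 < T"
    and f: "\<And>y. (f has_real_derivative f' y) (at y)" "continuous_on UNIV f'"
    and g: "continuous_on UNIV g"
    and s: "\<And>t. C1_per (s t) (sx t)" "\<And>t. C1_per (sx t) (sxx t)" "\<And>t. continuous_on UNIV (st t)"
    and st: "\<And>r t x. r \<in> {0..T} \<Longrightarrow> t \<in> {0..T} \<Longrightarrow> \<bar>s r x - s t x - (r - t) * st t x\<bar> \<le> K * (r - t)\<^sup>2"
      "\<And>t x. t \<in> {0..T} \<Longrightarrow> \<bar>st t x\<bar> \<le> K"
    and sub: "\<And>t x. t \<in> {0..T} \<Longrightarrow> st t x \<le> sxx t x - f' (s t x) * sx t x + g (s t x) + d" "0 \<le> d"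
    and R: "\<And>t x. t \<in> {0..T} \<Longrightarrow> \<bar>s t x\<bar> \<le> R" "\<And>t. t \<in> {0..T} \<Longrightarrow> AE x in mu. \<bar>u t x\<bar> \<le> R"
    and M: "\<And>a b. \<bar>a\<bar> \<le> R \<Longrightarrow> \<bar>b\<bar> \<le> R \<Longrightarrow> \<bar>f a - f b\<bar> \<le> M * \<bar>a - b\<bar>"
      "\<And>a b. \<bar>a\<bar> \<le> R \<Longrightarrow> \<bar>b\<bar> \<le> R \<Longrightarrow> \<bar>g a - g b\<bar> \<le> M * \<bar>a - b\<bar>" "0 \<le> M"
    and init: "AE x in mu. s 0 x \<le> u 0 x"
  shows "energy (\<lambda>x. s T x - u T x) \<le> 12 * R\<^sup>2 * d * L * T * exp ((3 / 2 * M\<^sup>2 + 3 * M) * T)"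
proof -
  define Z where "Z t x = s t x - u t x" for t x
  have R0: "0 \<le> R" using R(1)[of 0 0] T by fastforce
  have K0: "0 \<le> K" using st(2)[of 0 0] T by fastforce
  have uL2: "u t \<in> L2_per L" if "t \<in> {0..T}" for t
    using u that by (auto simp: solution_on_def intro: real_Hs_imp_L2)
  note um = L2_real_measurable[OF uL2]
  have sm: "s t \<in> borel_measurable mu" "st t \<in> borel_measurable mu" for t
    by (intro measurable_mu_cont C1_perD(4)[OF s(1)] s(3))+
  have Zm: "Z t \<in> borel_measurable mu" if "t \<in> {0..T}" for t
    unfolding Z_def using um[OF that] sm by measurable
  have ZB: "AE x in mu. \<bar>Z t x\<bar> \<le> 2 * R" if "t \<in> {0..T}" for t
    using R(2)[OF that]
  proof eventually_elim
    fix x assume "\<bar>u t x\<bar> \<le> R"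
    then show "\<bar>Z t x\<bar> \<le> 2 * R" using R(1)[OF that, of x] by (simp add: Z_def)
  qed
  have sq_le: "integrable mu (\<lambda>x. (h x)\<^sup>2) \<and> integral\<^sup>L mu (\<lambda>x. (h x)\<^sup>2) \<le> L * B\<^sup>2"
    if "h \<in> borel_measurable mu" "\<And>x. \<bar>h x\<bar> \<le> B" for h :: "real \<Rightarrow> real" and B
  proof
    show i: "integrable mu (\<lambda>x. (h x)\<^sup>2)" using that by (intro bounded_square_integrable) auto
    have "integral\<^sup>L mu (\<lambda>x. (h x)\<^sup>2) \<le> integral\<^sup>L mu (\<lambda>x. B\<^sup>2)"
      using i that(2) by (intro integral_mono) (auto, metis abs_ge_zero power2_abs power_mono)
    then show "integral\<^sup>L mu (\<lambda>x. (h x)\<^sup>2) \<le> L * B\<^sup>2" by simp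
  qed
  have cont: "continuous_on {0..T} (\<lambda>t. energy (Z t))"
    unfolding continuous_on_eq_continuous_within
  proof
    fix t assume t: "t \<in> {0..T}"
    show "continuous (at t within {0..T}) (\<lambda>t. energy (Z t))"
    proof (rule energy_continuous[OF Zm ZB _ t])
      show "((\<lambda>r. integral\<^sup>L mu (\<lambda>x. (Z r x - Z t x)\<^sup>2)) \<longlongrightarrow> 0) (at t within {0..T})"
      proof (rule Lim_null_comparison)
        let ?b = "\<lambda>r. 2 * (L * (K * (r - t)\<^sup>2 + \<bar>r - t\<bar> * K)\<^sup>2) + 2 * integral\<^sup>L mu (\<lambda>x. (u r x - u t x)\<^sup>2)"
        show "\<forall>\<^sub>F r in at t within {0..T}. norm (integral\<^sup>L mu (\<lambda>x. (Z r x - Z t x)\<^sup>2)) \<le> ?b r"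
          unfolding eventually_at_filter
        proof (intro always_eventually allI impI)
          fix r assume r: "r \<in> {0..T}"
          have "\<bar>s r x - s t x\<bar> \<le> K * (r - t)\<^sup>2 + \<bar>r - t\<bar> * K" for x
          proof -
            have "\<bar>(r - t) * st t x\<bar> \<le> \<bar>r - t\<bar> * K"
              unfolding abs_mult using st(2)[OF t] by (intro mult_left_mono) auto
            then show ?thesis using st(1)[OF r t, of x] by linarith
          qed
          then have A: "integrable mu (\<lambda>x. (s r x - s t x)\<^sup>2) \<and> integral\<^sup>L mu (\<lambda>x. (s r x - s t x)\<^sup>2) \<le> L * (K * (r - t)\<^sup>2 + \<bar>r - t\<bar> * K)\<^sup>2"
            using sm by (intro sq_le) auto
          have B: "integrable mu (\<lambda>x. (- (u r x - u t x))\<^sup>2)"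
            using L2_real_measurable(2)[OF L2_diff[OF uL2[OF r] uL2[OF t]]] by (simp add: power2_commute)
          have "integral\<^sup>L mu (\<lambda>x. ((s r x - s t x) + - (u r x - u t x))\<^sup>2)
             \<le> 2 * integral\<^sup>L mu (\<lambda>x. (s r x - s t x)\<^sup>2) + 2 * integral\<^sup>L mu (\<lambda>x. (- (u r x - u t x))\<^sup>2)"
            using A B sm um(1)[OF r] um(1)[OF t] by (intro square_integrable_add_real) auto
          then show "norm (integral\<^sup>L mu (\<lambda>x. (Z r x - Z t x)\<^sup>2)) \<le> ?b r"
            using A by (simp add: Z_def algebra_simps power2_commute)
        qed
        have "(?b \<longlongrightarrow> 2 * (L * (K * (t - t)\<^sup>2 + \<bar>t - t\<bar> * K)\<^sup>2) + 2 * 0) (at t within {0..T})"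
          by (intro tendsto_intros solution_continuous_L2[OF u t])
        then show "(?b \<longlongrightarrow> 0) (at t within {0..T})" by simp
      qed
    qed (use R0 in auto)
  qed
  have deriv: "\<exists>E'. ((\<lambda>t. energy (Z t)) has_real_derivative E') (at t) \<and>
      E' \<le> (3 / 2 * M\<^sup>2 + 3 * M) * energy (Z t) + 12 * R\<^sup>2 * d * L" if t: "0 < t" "t < T" for t
  proof -
    have t': "t \<in> {0..T}" using t by simp
    have fc: "continuous_on UNIV f" using f(1) DERIV_isCont continuous_at_imp_continuous_on by blast
    obtain v fw U U1 W where v: "v \<in> L2_per L"
      "((\<lambda>r. integral\<^sup>L mu (\<lambda>x. ((u r x - u t x) / (r - t) - v x)\<^sup>2)) \<longlongrightarrow> 0) (at t)"
      and U: "C1_per U U1" "AE x in mu. u t x = U x" "has_weak_deriv L U1 W"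
      "has_weak_deriv L (\<lambda>x. f (U x)) fw" "AE x in mu. v x + fw x = W x + g (U x)"
      by (rule solution_derivative_L2[OF u t fc])
    note vm = L2_real_measurable[OF v(1)]
    have at: "at t within {0..T} = at t" using t by (intro at_within_interior) simp
    define D where "D x = st t x - v x" for x
    have D2: "integrable mu (\<lambda>x. (st t x + - v x)\<^sup>2)"
      using sq_le[OF sm(2) st(2)[OF t']] vm sm by (intro square_integrable_add_real) auto
    have Dm: "D \<in> borel_measurable mu" "integrable mu (\<lambda>x. (D x)\<^sup>2)"
      unfolding D_def using D2 vm sm by auto
    have "((\<lambda>r. energy (Z r)) has_real_derivative integral\<^sup>L mu (\<lambda>x. 3 * (pos_part (Z t x))\<^sup>2 * D x)) (at t within {0..T})"
    proof (rule energy_has_derivative[OF Zm ZB _ t' Dm])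
      show "((\<lambda>r. integral\<^sup>L mu (\<lambda>x. ((Z r x - Z t x) / (r - t) - D x)\<^sup>2)) \<longlongrightarrow> 0) (at t within {0..T})"
      proof (rule Lim_null_comparison)
        let ?b = "\<lambda>r. 2 * (L * (K * \<bar>r - t\<bar>)\<^sup>2) + 2 * integral\<^sup>L mu (\<lambda>x. ((u r x - u t x) / (r - t) - v x)\<^sup>2)"
        show "\<forall>\<^sub>F r in at t within {0..T}. norm (integral\<^sup>L mu (\<lambda>x. ((Z r x - Z t x) / (r - t) - D x)\<^sup>2)) \<le> ?b r"
          unfolding eventually_at_filter
        proof (intro always_eventually allI impI)
          fix r assume rt: "r \<noteq> t" and r: "r \<in> {0..T}"
          define p where "p x = (s r x - s t x) / (r - t) - st t x" for x
          define q where "q x = (u r x - u t x) / (r - t) - v x" for x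
          have "\<bar>p x\<bar> \<le> K * \<bar>r - t\<bar>" for x
          proof -
            have "p x = (s r x - s t x - (r - t) * st t x) / (r - t)" using rt by (simp add: p_def field_simps)
            then have "\<bar>p x\<bar> \<le> K * (r - t)\<^sup>2 / \<bar>r - t\<bar>"
              unfolding abs_divide using st(1)[OF r t', of x] by (simp add: abs_divide divide_right_mono)
            also have "\<dots> = K * \<bar>r - t\<bar>" using rt by (cases "r > t") (auto simp: power2_eq_square field_simps)
            finally show ?thesis .
          qed
          moreover have pm: "p \<in> borel_measurable mu" unfolding p_def using sm by measurable
          ultimately have A: "integrable mu (\<lambda>x. (p x)\<^sup>2) \<and> integral\<^sup>L mu (\<lambda>x. (p x)\<^sup>2) \<le> L * (K * \<bar>r - t\<bar>)\<^sup>2"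
            by (intro sq_le) auto
          have "(\<lambda>x. inverse (r - t) *\<^sub>R (u r x - u t x) - v x) \<in> L2_per L"
            by (intro L2_diff L2_scaleR uL2 r t' v(1))
          moreover have "q = (\<lambda>x. inverse (r - t) *\<^sub>R (u r x - u t x) - v x)"
            by (auto simp: q_def divide_inverse mult.commute)
          ultimately have "q \<in> L2_per L" by simp
          note qm = L2_real_measurable[OF this]
          have "integral\<^sup>L mu (\<lambda>x. (p x + - q x)\<^sup>2) \<le> 2 * integral\<^sup>L mu (\<lambda>x. (p x)\<^sup>2) + 2 * integral\<^sup>L mu (\<lambda>x. (- q x)\<^sup>2)"
            using A pm qm by (intro square_integrable_add_real) auto
          then have "integral\<^sup>L mu (\<lambda>x. (p x + - q x)\<^sup>2) \<le> 2 * integral\<^sup>L mu (\<lambda>x. (p x)\<^sup>2) + 2 * integral\<^sup>L mu (\<lambda>x. (q x)\<^sup>2)"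
            by (simp only: power2_minus)
          moreover have "(Z r x - Z t x) / (r - t) - D x = p x + - q x" for x
            by (simp add: Z_def D_def p_def q_def diff_divide_distrib)
          ultimately show "norm (integral\<^sup>L mu (\<lambda>x. ((Z r x - Z t x) / (r - t) - D x)\<^sup>2)) \<le> ?b r"
            using A by (simp add: q_def)
        qed
        have "(?b \<longlongrightarrow> 2 * (L * (K * \<bar>t - t\<bar>)\<^sup>2) + 2 * 0) (at t)"
          by (intro tendsto_intros v(2))
        then show "(?b \<longlongrightarrow> 0) (at t within {0..T})" unfolding at by simp
      qed
    qed (use R0 in auto)
    then have E: "((\<lambda>r. energy (Z r)) has_real_derivative integral\<^sup>L mu (\<lambda>x. 3 * (pos_part (Z t x))\<^sup>2 * D x)) (at t)"
      unfolding at .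
    have AEZ: "AE x in mu. Z t x = s t x - U x" using U(2) by eventually_elim (simp add: Z_def)
    have Um: "U \<in> borel_measurable mu" by (intro measurable_mu_cont C1_perD(4)[OF U(1)])
    have "integral\<^sup>L mu (\<lambda>x. 3 * (pos_part (Z t x))\<^sup>2 * D x) = integral\<^sup>L mu (\<lambda>x. 3 * (pos_part (s t x - U x))\<^sup>2 * (st t x - v x))"
    proof (rule integral_cong_AE)
      show "(\<lambda>x. 3 * (pos_part (Z t x))\<^sup>2 * D x) \<in> borel_measurable mu"
        using Zm[OF t'] Dm by measurable
      show "(\<lambda>x. 3 * (pos_part (s t x - U x))\<^sup>2 * (st t x - v x)) \<in> borel_measurable mu"
        using sm Um vm by measurable
      show "AE x in mu. 3 * (pos_part (Z t x))\<^sup>2 * D x = 3 * (pos_part (s t x - U x))\<^sup>2 * (st t x - v x)"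
        using AEZ by eventually_elim (simp add: D_def)
    qed
    also have "\<dots> \<le> (3 / 2 * M\<^sup>2 + 3 * M) * energy (\<lambda>x. s t x - U x) + 12 * R\<^sup>2 * d * L"
    proof (rule energy_dissipation[OF U(1,3,4) s(1,2) f g R(1)[OF t'] _ M s(3) sub(1)[OF t'] sub(2) L2_integrable[OF v(1)] U(5)])
      show "AE x in mu. \<bar>U x\<bar> \<le> R" using R(2)[OF t'] U(2) by eventually_elim simp
    qed
    also have "energy (\<lambda>x. s t x - U x) = energy (Z t)"
      unfolding energy_def
    proof (rule integral_cong_AE)
      show "AE x in mu. pos_part (s t x - U x) ^ 3 = pos_part (Z t x) ^ 3" using AEZ by eventually_elim simp
    qed (use sm Um Zm[OF t'] in measurable)
    finally show ?thesis using E by blast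
  qed
  have E0: "energy (Z 0) \<le> 0"
  proof -
    have "AE x in mu. pos_part (Z 0 x) ^ 3 = 0" using init by eventually_elim (simp add: Z_def pos_part_def)
    then show ?thesis unfolding energy_def by (simp add: integral_eq_zero_AE)
  qed
  obtain E' where E': "\<And>t. 0 < t \<Longrightarrow> t < T \<Longrightarrow> ((\<lambda>t. energy (Z t)) has_real_derivative E' t) (at t)"
    "\<And>t. 0 < t \<Longrightarrow> t < T \<Longrightarrow> E' t \<le> (3 / 2 * M\<^sup>2 + 3 * M) * energy (Z t) + 12 * R\<^sup>2 * d * L"
    using deriv by metis
  have "energy (Z T) \<le> (12 * R\<^sup>2 * d * L) * T * exp ((3 / 2 * M\<^sup>2 + 3 * M) * T)"
    by (rule Gronwall_differential[OF T cont E0 _ E'(1) E'(2)]) (use M(3) sub(2) L_pos in auto)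
  then show ?thesis by (simp add: Z_def[abs_def])
qed

end

subsection \<open>Kato's inequality and the eigenfunction\<close>

lemma C_k_has_deriv:
  "C_k k h \<Longrightarrow> j < k \<Longrightarrow> ((deriv ^^ j) h has_real_derivative (deriv ^^ Suc j) h x) (at x)"
  by (simp add: C_k_def field_differentiable_derivI)

lemma C_k_continuous:
  assumes "C_k k h" "j \<le> k" shows "continuous_on UNIV ((deriv ^^ j) h)"
proof (cases "j = k")
  case False
  then show ?thesis
    using C_k_has_deriv[OF assms(1), of j] assms(2) by (intro continuous_at_imp_continuous_on) (auto intro: DERIV_isCont)
qed (use assms in \<open>auto simp: C_k_def\<close>)

text \<open>Restriction to a bounded range provides Lipschitz constants for nonlinearities of
  arbitrary growth.\<close>

lemma Lipschitz_on_bounded: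
  fixes h :: "real \<Rightarrow> real"
  assumes "\<And>x. (h has_real_derivative h' x) (at x)" "continuous_on UNIV h'"
  obtains M where "0 \<le> M" "\<And>a b. \<bar>a\<bar> \<le> R \<Longrightarrow> \<bar>b\<bar> \<le> R \<Longrightarrow> \<bar>h a - h b\<bar> \<le> M * \<bar>a - b\<bar>"
proof -
  have "bounded (h' ` {- R..R})"
    by (intro compact_imp_bounded compact_continuous_image continuous_on_subset[OF assms(2)]) auto
  then obtain M where M: "\<And>x. x \<in> {- R..R} \<Longrightarrow> norm (h' x) \<le> M"
    unfolding bounded_iff by blast
  have "\<bar>h a - h b\<bar> \<le> \<bar>M\<bar> * \<bar>a - b\<bar>" if "\<bar>a\<bar> \<le> R" "\<bar>b\<bar> \<le> R" for a b
    unfolding real_norm_def[symmetric]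
  proof (rule field_differentiable_bound[of "{- R..R}"])
    show "(h has_field_derivative h' x) (at x within {- R..R})" for x
      using assms(1) by (rule has_field_derivative_at_within)
    show "norm (h' x) \<le> norm M" if "x \<in> {- R..R}" for x using M[OF that] by simp
  qed (use that in auto)
  then show ?thesis using that[of "\<bar>M\<bar>"] by simp
qed

text \<open>Mean value inequality for \<open>h x - x * h' a\<close>, whose derivative is at most
  \<open>M * \<bar>b - a\<bar>\<close> on the segment.\<close>

lemma Taylor_second_order:
  fixes h :: "real \<Rightarrow> real"
  assumes S: "convex S" and h: "\<And>x. x \<in> S \<Longrightarrow> (h has_real_derivative h' x) (at x within S)"
    and lip: "\<And>x y. x \<in> S \<Longrightarrow> y \<in> S \<Longrightarrow> \<bar>h' x - h' y\<bar> \<le> M * \<bar>x - y\<bar>"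
    and ab: "a \<in> S" "b \<in> S" and M: "0 \<le> M"
  shows "\<bar>h b - h a - (b - a) * h' a\<bar> \<le> M * (b - a)\<^sup>2"
proof -
  have sub: "closed_segment a b \<subseteq> S" using S ab by (simp add: closed_segment_subset)
  have "norm ((h b - b * h' a) - (h a - a * h' a)) \<le> (M * \<bar>b - a\<bar>) * norm (b - a)"
  proof (rule field_differentiable_bound[of "closed_segment a b"])
    show "((\<lambda>x. h x - x * h' a) has_field_derivative h' x - h' a) (at x within closed_segment a b)"
      if "x \<in> closed_segment a b" for x
      using DERIV_subset[OF h sub] that sub by (auto intro!: derivative_eq_intros)
    show "norm (h' x - h' a) \<le> M * \<bar>b - a\<bar>" if x: "x \<in> closed_segment a b" for x
    proof -
      have "\<bar>h' x - h' a\<bar> \<le> M * \<bar>x - a\<bar>" using lip x sub ab by blast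
      also have "\<dots> \<le> M * \<bar>b - a\<bar>"
        using x M by (intro mult_left_mono) (auto simp: closed_segment_eq_real_ivl split: if_splits)
      finally show ?thesis by simp
    qed
  qed auto
  then show ?thesis by (simp add: power2_eq_square algebra_simps abs_mult_self_eq)
qed

text \<open>If \<open>p\<close>, \<open>p1\<close>, \<open>p2\<close> are the values of a complex function and its first two derivatives, then
  \<open>mod_reg1\<close> and \<open>mod_reg2\<close> are the first two derivatives of its regularised modulus.\<close>

definition mod_reg :: "real \<Rightarrow> complex \<Rightarrow> real" where
  "mod_reg \<eta> p = sqrt ((norm p)\<^sup>2 + \<eta>\<^sup>2)"

definition mod_reg1 :: "real \<Rightarrow> complex \<Rightarrow> complex \<Rightarrow> real" where
  "mod_reg1 \<eta> p p1 = Re (cnj p * p1) / mod_reg \<eta> p"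

definition mod_reg2 :: "real \<Rightarrow> complex \<Rightarrow> complex \<Rightarrow> complex \<Rightarrow> real" where
  "mod_reg2 \<eta> p p1 p2 = ((norm p1)\<^sup>2 + Re (cnj p * p2) - (mod_reg1 \<eta> p p1)\<^sup>2) / mod_reg \<eta> p"

lemma mod_reg_sq: "(mod_reg \<eta> p)\<^sup>2 = (norm p)\<^sup>2 + \<eta>\<^sup>2"
  by (simp add: mod_reg_def)

lemma mod_reg_pos: "0 < \<eta> \<Longrightarrow> 0 < mod_reg \<eta> p"
  unfolding mod_reg_def by (intro real_sqrt_gt_zero add_nonneg_pos) auto

lemma mod_reg_ge: "0 < \<eta> \<Longrightarrow> norm p \<le> mod_reg \<eta> p" "0 < \<eta> \<Longrightarrow> \<eta> \<le> mod_reg \<eta> p"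
  by (auto simp: mod_reg_def intro!: real_le_rsqrt)

lemma mod_reg_le: "0 < \<eta> \<Longrightarrow> mod_reg \<eta> p \<le> norm p + \<eta>"
  unfolding mod_reg_def by (intro real_le_lsqrt) (auto simp: power2_sum)

lemma mod_reg_mono: "0 < \<eta> \<Longrightarrow> \<eta> \<le> \<theta> \<Longrightarrow> mod_reg \<eta> p \<le> mod_reg \<theta> p"
  unfolding mod_reg_def by (intro real_sqrt_le_mono add_left_mono power_mono) auto

lemma abs_mod_reg1_le:
  assumes "0 < \<eta>" shows "\<bar>mod_reg1 \<eta> p p1\<bar> \<le> norm p1"
proof -
  have "\<bar>Re (cnj p * p1)\<bar> \<le> norm p * norm p1"
    using abs_Re_le_cmod[of "cnj p * p1"] by (simp add: norm_mult)
  also have "\<dots> \<le> mod_reg \<eta> p * norm p1" by (intro mult_right_mono mod_reg_ge assms) auto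
  finally show ?thesis
    using mod_reg_pos[OF assms, of p] by (simp add: mod_reg1_def abs_divide divide_le_eq mult.commute)
qed

text \<open>Only the reality of the coefficients \<open>b1\<close>, \<open>b0\<close> matters; the term \<open>K * \<eta>\<close> is the price
  of regularising the modulus at the zeros of the eigenfunction.\<close>

lemma Kato_inequality:
  assumes eig: "p2 + of_real b1 * p1 + of_real b0 * p = \<mu> * p" and \<eta>: "0 < \<eta>"
    and K: "\<bar>b0 - Re \<mu>\<bar> \<le> K"
  shows "Re \<mu> * mod_reg \<eta> p - K * \<eta> \<le> mod_reg2 \<eta> p p1 p2 + b1 * mod_reg1 \<eta> p p1 + b0 * mod_reg \<eta> p"
proof -
  define r where "r = mod_reg \<eta> p"
  define r1 where "r1 = mod_reg1 \<eta> p p1"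
  have r: "r > 0" "\<eta> \<le> r" using mod_reg_pos mod_reg_ge \<eta> by (auto simp: r_def)
  have p2: "p2 = \<mu> * p - of_real b1 * p1 - of_real b0 * p" using eig by (simp add: algebra_simps)
  have np: "(norm p)\<^sup>2 = r\<^sup>2 - \<eta>\<^sup>2" by (simp add: r_def mod_reg_sq)
  have Re2: "Re (cnj p * p2) = Re \<mu> * (norm p)\<^sup>2 - b1 * Re (cnj p * p1) - b0 * (norm p)\<^sup>2"
    unfolding p2 cmod_power2 by (simp add: power2_eq_square algebra_simps)
  have rr1: "Re (cnj p * p1) = r * r1" using r(1) by (simp add: r1_def mod_reg1_def r_def)
  have r2: "mod_reg2 \<eta> p p1 p2 = ((norm p1)\<^sup>2 - r1\<^sup>2 + Re (cnj p * p2)) / r"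
    by (simp add: mod_reg2_def r_def r1_def)
  \<comment> \<open>Here the convexity of the modulus enters: the discarded term
    \<open>(norm p1)\<^sup>2 - r1\<^sup>2\<close> is nonnegative.\<close>
  have "r1\<^sup>2 \<le> (norm p1)\<^sup>2"
    using abs_mod_reg1_le[OF \<eta>, of p p1] unfolding r1_def by (metis abs_ge_zero power2_abs power_mono)
  then have "Re (cnj p * p2) / r \<le> mod_reg2 \<eta> p p1 p2"
    unfolding r2 using r(1) by (intro divide_right_mono) auto
  \<comment> \<open>Replacing \<open>(norm p)\<^sup>2\<close> by
    \<open>r\<^sup>2 - \<eta>\<^sup>2\<close> leaves the last term as the defect of the
    regularisation.\<close>
  moreover have "Re (cnj p * p2) / r = Re \<mu> * r - b1 * r1 - b0 * r + (b0 - Re \<mu>) * (\<eta>\<^sup>2 / r)"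
    unfolding Re2 rr1 np using r(1) by (simp add: field_simps power2_eq_square)
  moreover have "\<bar>(b0 - Re \<mu>) * (\<eta>\<^sup>2 / r)\<bar> \<le> K * \<eta>"
  proof -
    have "\<eta>\<^sup>2 / r \<le> \<eta>" using r \<eta> by (simp add: divide_le_eq power2_eq_square)
    then show ?thesis using K \<eta> r(1) unfolding abs_mult by (intro mult_mono) auto
  qed
  ultimately show ?thesis unfolding r_def[symmetric] r1_def[symmetric] by linarith
qed

lemma mod_reg_deriv:
  assumes \<eta>: "0 < \<eta>" and P: "(P has_vector_derivative P1) (at x)"
  shows "((\<lambda>x. mod_reg \<eta> (P x)) has_real_derivative mod_reg1 \<eta> (P x) P1) (at x)"
proof -
  define n where "n x = (Re (P x))\<^sup>2 + (Im (P x))\<^sup>2 + \<eta>\<^sup>2" for x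
  have eq: "mod_reg \<eta> (P x) = sqrt (n x)" for x by (simp add: mod_reg_def n_def cmod_power2)
  have pos: "0 < n x" unfolding n_def using \<eta> by (intro add_nonneg_pos) auto
  have N: "(n has_real_derivative 2 * (Re (P x) * Re P1 + Im (P x) * Im P1)) (at x)"
    unfolding n_def by (auto intro!: derivative_eq_intros P)
  have "((\<lambda>x. sqrt (n x)) has_real_derivative inverse (sqrt (n x)) / 2 * (2 * (Re (P x) * Re P1 + Im (P x) * Im P1))) (at x)"
    by (rule DERIV_chain2[OF DERIV_real_sqrt[OF pos] N])
  moreover have "inverse (sqrt (n x)) / 2 * (2 * (Re (P x) * Re P1 + Im (P x) * Im P1)) = mod_reg1 \<eta> (P x) P1"
    by (simp only: mod_reg1_def eq divide_inverse) (simp add: mult_ac)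
  ultimately show ?thesis by (simp only: eq)
qed

lemma mod_reg1_deriv:
  assumes \<eta>: "0 < \<eta>" and P: "(P has_vector_derivative P1 x) (at x)" "(P1 has_vector_derivative P2) (at x)"
  shows "((\<lambda>x. mod_reg1 \<eta> (P x) (P1 x)) has_real_derivative mod_reg2 \<eta> (P x) (P1 x) P2) (at x)"
proof -
  have "((\<lambda>x. Re (P x) * Re (P1 x) + Im (P x) * Im (P1 x)) has_real_derivative
     (Re (P1 x) * Re (P1 x) + Im (P1 x) * Im (P1 x)) + (Re (P x) * Re P2 + Im (P x) * Im P2)) (at x)"
    by (auto intro!: derivative_eq_intros P)
  moreover have "(norm (P1 x))\<^sup>2 = Re (P1 x) * Re (P1 x) + Im (P1 x) * Im (P1 x)"
    unfolding cmod_power2 by (simp only: power2_eq_square)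
  ultimately have N: "((\<lambda>x. Re (cnj (P x) * P1 x)) has_real_derivative (norm (P1 x))\<^sup>2 + Re (cnj (P x) * P2)) (at x)"
    by simp
  have pos: "mod_reg \<eta> (P x) > 0" by (rule mod_reg_pos[OF \<eta>])
  have f: "Re (cnj (P x) * P1 x) = mod_reg \<eta> (P x) * mod_reg1 \<eta> (P x) (P1 x)" using pos by (simp add: mod_reg1_def)
  have "(((norm (P1 x))\<^sup>2 + Re (cnj (P x) * P2)) * mod_reg \<eta> (P x) - Re (cnj (P x) * P1 x) * mod_reg1 \<eta> (P x) (P1 x))
     / (mod_reg \<eta> (P x) * mod_reg \<eta> (P x)) = mod_reg2 \<eta> (P x) (P1 x) P2"
    unfolding f mod_reg2_def using pos by (simp add: divide_simps power2_eq_square) (simp add: algebra_simps)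
  with DERIV_divide[OF N mod_reg_deriv[OF \<eta> P(1)]] pos show ?thesis
    unfolding mod_reg1_def[of \<eta> "P _" "P1 _"] by simp
qed

text \<open>Here \<open>y\<close>, \<open>y1\<close>, \<open>y2\<close> are the values of the wave and its derivatives, and \<open>r\<close>, \<open>r1\<close>, \<open>r2\<close>
  those of the perturbation.\<close>

lemma subsolution_pointwise:
  fixes \<alpha> \<kappa> :: real
  assumes wave: "- c * y1 + f1 y * y1 = y2 + g y"
    and lin: "\<kappa> * r - d \<le> r2 + (c - f1 y) * r1 + (g1 y - f2 y * y1) * r"
    and tf: "\<bar>f1 (y + \<alpha> * r) - f1 y - (\<alpha> * r) * f2 y\<bar> \<le> Cf * (\<alpha> * r)\<^sup>2"
    and lf: "\<bar>f1 (y + \<alpha> * r) - f1 y\<bar> \<le> Mf * \<bar>\<alpha> * r\<bar>"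
    and tg: "\<bar>g (y + \<alpha> * r) - g y - (\<alpha> * r) * g1 y\<bar> \<le> Cg * (\<alpha> * r)\<^sup>2"
    and b: "\<bar>y1\<bar> \<le> B1" "0 \<le> r" "r \<le> B" "\<bar>r1\<bar> \<le> B2" "0 \<le> \<alpha>" "\<alpha> \<le> 1" "0 \<le> d" "0 \<le> Cf" "0 \<le> Mf" "0 \<le> Cg"
    and small: "\<alpha> * (Cf * B * B1 + Mf * B2 + Cg * B) \<le> \<kappa> / 2"
  shows "- c * (y1 + \<alpha> * r1) + \<kappa> / 2 * \<alpha> * r
    \<le> (y2 + \<alpha> * r2) - f1 (y + \<alpha> * r) * (y1 + \<alpha> * r1) + g (y + \<alpha> * r) + d"
proof -
  \<comment> \<open>\<open>e1\<close> and \<open>e3\<close> are quadratic Taylor remainders;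
    \<open>e2\<close> is only a first-order increment, but it multiplies the small gradient
    \<open>\<alpha> * r1\<close>. Each error thus carries a factor \<alpha> beyond
    \<open>\<alpha> * r\<close>.\<close>
  define e1 where "e1 = f1 (y + \<alpha> * r) - f1 y - (\<alpha> * r) * f2 y"
  define e2 where "e2 = f1 (y + \<alpha> * r) - f1 y"
  define e3 where "e3 = g (y + \<alpha> * r) - g y - (\<alpha> * r) * g1 y"
  have ar: "0 \<le> \<alpha> * r" using b by simp
  have B0: "0 \<le> B" "0 \<le> B1" "0 \<le> B2" using b by linarith+
  have sq: "(\<alpha> * r)\<^sup>2 \<le> (\<alpha> * r) * (\<alpha> * B)"
    unfolding power2_eq_square using b by (intro mult_left_mono) auto
  have "\<bar>e1 * y1\<bar> \<le> (Cf * (\<alpha> * r)\<^sup>2) * B1" unfolding abs_mult using tf b by (intro mult_mono) (auto simp: e1_def)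
  also have "\<dots> \<le> (Cf * ((\<alpha> * r) * (\<alpha> * B))) * B1" using sq b B0 by (intro mult_right_mono mult_left_mono) auto
  finally have 1: "\<bar>e1 * y1\<bar> \<le> (\<alpha> * r) * (\<alpha> * (Cf * B * B1))" by (simp add: mult_ac)
  have "\<bar>e2 * (\<alpha> * r1)\<bar> \<le> (Mf * (\<alpha> * r)) * (\<alpha> * B2)"
    unfolding abs_mult using lf b ar by (intro mult_mono) (auto simp: e2_def)
  then have 2: "\<bar>e2 * (\<alpha> * r1)\<bar> \<le> (\<alpha> * r) * (\<alpha> * (Mf * B2))" by (simp add: mult_ac)
  have "\<bar>e3\<bar> \<le> Cg * (\<alpha> * r)\<^sup>2" using tg by (simp add: e3_def)
  also have "\<dots> \<le> Cg * ((\<alpha> * r) * (\<alpha> * B))" using sq b by (intro mult_left_mono) auto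
  finally have 3: "\<bar>e3\<bar> \<le> (\<alpha> * r) * (\<alpha> * (Cg * B))" by (simp add: mult_ac)
  have "(\<alpha> * r) * (\<alpha> * (Cf * B * B1)) + (\<alpha> * r) * (\<alpha> * (Mf * B2)) + (\<alpha> * r) * (\<alpha> * (Cg * B))
     = (\<alpha> * r) * (\<alpha> * (Cf * B * B1 + Mf * B2 + Cg * B))" by (simp add: algebra_simps)
  also have "\<dots> \<le> (\<alpha> * r) * (\<kappa> / 2)" using small ar by (rule mult_left_mono)
  finally have 4: "(\<alpha> * r) * (\<alpha> * (Cf * B * B1)) + (\<alpha> * r) * (\<alpha> * (Mf * B2)) + (\<alpha> * r) * (\<alpha> * (Cg * B)) \<le> (\<alpha> * r) * (\<kappa> / 2)" .
  have 5: "\<alpha> * (\<kappa> * r - d) \<le> \<alpha> * (r2 + (c - f1 y) * r1 + (g1 y - f2 y * y1) * r)"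
    using lin b by (intro mult_left_mono) auto
  have 6: "\<alpha> * d \<le> 1 * d" using b by (intro mult_right_mono) auto
  have y2: "y2 = - c * y1 + f1 y * y1 - g y" using wave by simp
  have "(y2 + \<alpha> * r2) - f1 (y + \<alpha> * r) * (y1 + \<alpha> * r1) + g (y + \<alpha> * r) + c * (y1 + \<alpha> * r1)
    = \<alpha> * (r2 + (c - f1 y) * r1 + (g1 y - f2 y * y1) * r) - e1 * y1 - e2 * (\<alpha> * r1) + e3"
    unfolding y2 e1_def e2_def e3_def by (simp add: algebra_simps)
  then have 7: "((y2 + \<alpha> * r2) - f1 (y + \<alpha> * r) * (y1 + \<alpha> * r1) + g (y + \<alpha> * r)) - (- c * (y1 + \<alpha> * r1))
    = \<alpha> * (r2 + (c - f1 y) * r1 + (g1 y - f2 y * y1) * r) - e1 * y1 - e2 * (\<alpha> * r1) + e3" by simp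
  have 8: "2 * (\<alpha> * r * (\<kappa> / 2)) - \<alpha> * d \<le> \<alpha> * (r2 + (c - f1 y) * r1 + (g1 y - f2 y * y1) * r)"
    using 5 by (simp add: algebra_simps)
  \<comment> \<open>The products are abstracted into variables so that the remaining inequality is
    linear.\<close>
  have aux: "s + k \<le> z + d" if "z - s = l - x1 - x2 + x3" "2 * k - q \<le> l" "q \<le> 1 * d"
    "\<bar>x1\<bar> \<le> m1" "\<bar>x2\<bar> \<le> m2" "\<bar>x3\<bar> \<le> m3" "m1 + m2 + m3 \<le> k" for s k z l x1 x2 x3 q m1 m2 m3 :: real
    using that by linarith
  show ?thesis using aux[OF 7 8 6 1 2 3 4] by (simp add: mult_ac)
qed

context period begin

text \<open>The eigenvalue equation equates the second weak derivative almost everywhere with the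
  continuous function \<open>G\<close>, and integrating \<open>G\<close> shows that
  \<open>U1\<close> is continuously differentiable. Kato's inequality then applies at every
  point.\<close>

lemma eigenfunction_regular:
  assumes H2: "\<Psi> \<in> Hs_per L 2"
    and nz: "\<not> (AE x in lborel. \<Psi> x = 0)"
    and eq: "AE x in lborel. weak_deriv L (weak_deriv L \<Psi>) x + of_real (a1 x) * weak_deriv L \<Psi> x + of_real (a0 x) * \<Psi> x = \<mu> * \<Psi> x"
    and a: "periodic a1" "continuous_on UNIV a1" "periodic a0" "continuous_on UNIV a0"
  obtains P P1 P2 where "periodic P" "periodic P1" "periodic P2" "\<And>x. (P has_vector_derivative P1 x) (at x)"
    "\<And>x. (P1 has_vector_derivative P2 x) (at x)" "continuous_on UNIV P2"
    "\<And>x. P2 x + of_real (a1 x) * P1 x + of_real (a0 x) * P x = \<mu> * P x"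
    "0 < integral\<^sup>L mu (\<lambda>x. norm (P x))"
proof -
  obtain U U1 W where U: "periodic U" "periodic U1" "\<And>x. (U has_vector_derivative U1 x) (at x)" "continuous_on UNIV U1"
    "AE x in mu. \<Psi> x = U x" "has_weak_deriv L U1 W"
    using H2_regular[OF H2] by metis
  have Uc: "continuous_on A U" for A
    by (rule continuous_at_imp_continuous_on) (auto intro: has_vector_derivative_continuous[OF U(3)])
  have PL2: "\<Psi> \<in> L2_per L" using H2 by (simp add: Hs_per_def)
  have "AE x in mu. U x = \<Psi> x" using U(5) by eventually_elim simp
  then have wd: "has_weak_deriv L \<Psi> U1"
    using has_weak_deriv_cong[OF has_weak_deriv_C1[OF U(1-4)] PL2] by blast
  have w1: "AE x in mu. weak_deriv L \<Psi> x = U1 x"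
    by (rule weak_deriv_twice(1)[OF _ wd U(6)]) (rule has_weak_deriv_unique)
  have w2: "has_weak_deriv L U1 (weak_deriv L (weak_deriv L \<Psi>))"
    by (rule weak_deriv_twice(2)[OF _ wd U(6)]) (rule has_weak_deriv_unique)
  define G where "G x = \<mu> * U x - of_real (a1 x) * U1 x - of_real (a0 x) * U x" for x
  have Gc: "continuous_on UNIV G" unfolding G_def by (intro continuous_intros a U Uc)
  have Gp: "periodic G" using a U unfolding periodic_def G_def by simp
  have "AE x in mu. weak_deriv L (weak_deriv L \<Psi>) x = G x"
    using AE_mu[OF eq] w1 U(5) by eventually_elim (simp add: G_def algebra_simps)
  then have Gk: "fourier_coeff L G k = \<i> * of_real (w * of_int k) * fourier_coeff L U1 k" for k
  proof -
    assume AE: "AE x in mu. weak_deriv L (weak_deriv L \<Psi>) x = G x"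
    have "integral\<^sup>L mu (\<lambda>x. G x * e (- k) x) = integral\<^sup>L mu (\<lambda>x. weak_deriv L (weak_deriv L \<Psi>) x * e (- k) x)"
    proof (rule integral_cong_AE)
      show "(\<lambda>x. G x * e (- k) x) \<in> borel_measurable mu"
        by (intro measurable_mu_cont continuous_intros Gc e_cont)
      show "(\<lambda>x. weak_deriv L (weak_deriv L \<Psi>) x * e (- k) x) \<in> borel_measurable mu"
        using integrable_mult_e[OF L2_integrable[OF has_weak_deriv_L2(2)[OF w2]]] by simp
      show "AE x in mu. G x * e (- k) x = weak_deriv L (weak_deriv L \<Psi>) x * e (- k) x"
        using AE by eventually_elim simp
    qed
    then show ?thesis using has_weak_deriv_fourier[OF w2, of k] by (simp add: fourier_coeff_mu)
  qed
  \<comment> \<open>Having the coefficients of a weak derivative, \<open>G\<close> has mean zero and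
    thus a periodic antiderivative; its constant is fixed by the mean of \<open>U1\<close>.\<close>
  have "fourier_coeff L G 0 = 0" by (simp add: Gk)
  then obtain H where H: "periodic H" "\<And>x. (H has_vector_derivative G x) (at x)" "fourier_coeff L H 0 = fourier_coeff L U1 0"
    using periodic_antiderivative[OF Gp Gc, of "fourier_coeff L U1 0"] by metis
  have Hc: "continuous_on A H" for A
    by (rule continuous_at_imp_continuous_on) (auto intro: has_vector_derivative_continuous[OF H(2)])
  have Hk: "fourier_coeff L U1 k = fourier_coeff L H k" for k
  proof (cases "k = 0")
    case False
    have "\<i> * of_real (w * of_int k) * fourier_coeff L U1 k = \<i> * of_real (w * of_int k) * fourier_coeff L H k"
      using has_weak_deriv_fourier[OF has_weak_deriv_C1[OF H(1) Gp H(2) Gc], of k] Gk[of k] by simp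
    then show ?thesis using False w_pos by simp
  qed (use H in simp)
  have U1c: "continuous_on A U1" for A using U(4) continuous_on_subset by blast
  have "AE x in mu. U1 x = H x"
    by (rule fourier_coeff_eq_imp_AE_eq[OF _ _ Hk]) (intro integrable_mu_cont U Hc)+
  then have "AE x in mu. (norm (U1 x - H x))\<^sup>2 = 0" by eventually_elim simp
  then have "integral\<^sup>L mu (\<lambda>x. (norm (U1 x - H x))\<^sup>2) = 0" by (rule integral_eq_zero_AE)
  \<comment> \<open>Continuity upgrades equality almost everywhere to equality on the closed period,
    and periodicity extends it to the line.\<close>
  then have UH0: "U1 x = H x" if "x \<in> {0..L}" for x
    using integral_mu_eq_0_cont[of "\<lambda>x. (norm (U1 x - H x))\<^sup>2" x] that
      continuous_on_power[OF continuous_on_norm[OF continuous_on_diff[OF U1c Hc]], of "{0..L}" 2] by simp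
  have UH: "U1 x = H x" for x
  proof -
    obtain y n where y: "y \<in> {0..<L}" "x = y + of_int n * L" using periodic_reduce by blast
    then show ?thesis using UH0[of y] periodic_int[OF U(2), of y n] periodic_int[OF H(1), of y n] by simp
  qed
  then have "U1 = H" by auto
  then have U1d: "(U1 has_vector_derivative G x) (at x)" for x using H(2) by simp
  have "0 < integral\<^sup>L mu (\<lambda>x. norm (U x))"
  proof (rule ccontr)
    assume "\<not> ?thesis"
    moreover have "0 \<le> integral\<^sup>L mu (\<lambda>x. norm (U x))" by simp
    ultimately have "integral\<^sup>L mu (\<lambda>x. norm (U x)) = 0" by linarith
    then have "U x = 0" if "x \<in> {0..L}" for x
      using integral_mu_eq_0_cont[of "\<lambda>x. norm (U x)" x] that continuous_on_norm[OF Uc] by simp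
    then have "AE x in mu. U x = 0" by (intro AE_I2) simp
    then have "AE x in mu. \<Psi> x = 0" using U(5) by eventually_elim simp
    moreover have "periodic (\<lambda>x. \<Psi> x = 0)" using PL2 by (simp add: L2_mu periodic_def)
    ultimately show False using nz AE_mu_imp_AE_lborel by blast
  qed
  then show ?thesis using that[OF U(1,2) Gp U(3) U1d Gc] by (simp add: G_def)
qed

lemma C1_per_shift:
  assumes "C1_per p p'" shows "C1_per (\<lambda>x. p (x + a)) (\<lambda>x. p' (x + a))"
  unfolding C1_per_def
proof (intro conjI allI)
  show "periodic (\<lambda>x. p (x + a))"
    using C1_perD(1)[OF assms] unfolding periodic_def by (metis add.assoc add.commute)
  show "((\<lambda>x. p (x + a)) has_real_derivative p' (x + a)) (at x)" for x
    using C1_perD(2)[OF assms, of "x + a"] by (simp add: DERIV_shift)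
  show "continuous_on UNIV (\<lambda>x. p' (x + a))"
    by (rule continuous_on_compose2[OF C1_perD(3)[OF assms, of UNIV]]) (auto intro!: continuous_intros)
qed

lemma C1_per_lincomb:
  assumes "C1_per p p'" "C1_per q q'" shows "C1_per (\<lambda>x. p x + a * q x) (\<lambda>x. p' x + a * q' x)"
  using assms unfolding C1_per_def periodic_def by (auto intro!: derivative_eq_intros continuous_intros)

lemma C2_per_real_Hs:
  assumes "C1_per p p1" "C1_per p1 p2" shows "p \<in> real_Hs_per L 2"
  unfolding real_Hs_per_def using weak_deriv2_Hs has_weak_deriv_bounded_linear[OF bounded_linear_of_real] C1_per_weak_deriv assms by blast

lemma C1_per_bounded:
  assumes "C1_per p p'" obtains B where "\<And>x. \<bar>p x\<bar> \<le> B"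
  using periodic_cont_bounded[OF C1_perD(1,4)[OF assms]] by (metis real_norm_def)

lemma C1_per_deriv_bounded:
  assumes "C1_per p p'" obtains B where "\<And>x. \<bar>p' x\<bar> \<le> B"
  using periodic_cont_bounded[OF C1_per_deriv_periodic[OF assms] C1_perD(3)[OF assms]] by (metis real_norm_def)

subsection \<open>Growing subsolutions\<close>

text \<open>All bounds hold uniformly for \<open>\<eta> \<le> 1\<close>, so \<open>A\<close> and
  \<open>K\<close> depend on neither \<eta> nor \<alpha>. \<open>A\<close> is so small that the
  quadratic terms use up at most half of \<open>Re \<mu>\<close>.\<close>

lemma subsolution_family:
  assumes f: "\<And>x. (f1 has_real_derivative f2 x) (at x)" "\<And>x. (f2 has_real_derivative f3 x) (at x)" "continuous_on UNIV f3"
    and g: "\<And>x. (g has_real_derivative g1 x) (at x)" "\<And>x. (g1 has_real_derivative g2 x) (at x)" "continuous_on UNIV g2"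
    and phi: "C1_per \<phi> \<phi>1" "C1_per \<phi>1 \<phi>2" "\<And>x. - c * \<phi>1 x + f1 (\<phi> x) * \<phi>1 x = \<phi>2 x + g (\<phi> x)"
    and P: "periodic P" "periodic P1" "\<And>x. (P has_vector_derivative P1 x) (at x)" "continuous_on UNIV P1"
      "\<And>x. P2 x + of_real (c - f1 (\<phi> x)) * P1 x + of_real (g1 (\<phi> x) - f2 (\<phi> x) * \<phi>1 x) * P x = \<mu> * P x"
    and \<mu>: "0 < Re \<mu>"
  obtains A K where "0 < A" "A \<le> 1" "0 \<le> K"
    "\<And>\<eta> \<alpha> y. 0 < \<eta> \<Longrightarrow> \<eta> \<le> 1 \<Longrightarrow> 0 \<le> \<alpha> \<Longrightarrow> \<alpha> \<le> A \<Longrightarrow>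
      - c * (\<phi>1 y + \<alpha> * mod_reg1 \<eta> (P y) (P1 y)) + Re \<mu> / 2 * \<alpha> * mod_reg \<eta> (P y)
      \<le> (\<phi>2 y + \<alpha> * mod_reg2 \<eta> (P y) (P1 y) (P2 y))
        - f1 (\<phi> y + \<alpha> * mod_reg \<eta> (P y)) * (\<phi>1 y + \<alpha> * mod_reg1 \<eta> (P y) (P1 y))
        + g (\<phi> y + \<alpha> * mod_reg \<eta> (P y)) + K * \<eta>"
proof -
  have Pc: "continuous_on UNIV P"
    by (rule continuous_at_imp_continuous_on) (auto intro: has_vector_derivative_continuous[OF P(3)])
  have f2c: "continuous_on UNIV f2" and g1c: "continuous_on UNIV g1"
    using f(2) g(2) by (auto intro: DERIV_continuous_on)
  obtain B0 where B0: "\<And>x. \<bar>\<phi> x\<bar> \<le> B0" using C1_per_bounded[OF phi(1)] by blast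
  obtain B1 where B1: "\<And>x. \<bar>\<phi>1 x\<bar> \<le> B1" using C1_per_bounded[OF phi(2)] by blast
  obtain BP where BP: "\<And>x. norm (P x) \<le> BP" "0 < BP" using periodic_cont_bounded[OF P(1) Pc] by metis
  obtain B2 where B2: "\<And>x. norm (P1 x) \<le> B2" "0 < B2" using periodic_cont_bounded[OF P(2) P(4)] by metis
  \<comment> \<open>The wave is bounded by \<open>B0\<close> and the perturbation by
    \<open>BP + 1\<close>, as \<alpha> and \<eta> are at most 1.\<close>
  define R where "R = B0 + BP + 1"
  obtain Mf where Mf: "0 \<le> Mf" "\<And>a b. \<bar>a\<bar> \<le> R \<Longrightarrow> \<bar>b\<bar> \<le> R \<Longrightarrow> \<bar>f1 a - f1 b\<bar> \<le> Mf * \<bar>a - b\<bar>"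
    using Lipschitz_on_bounded[OF f(1) f2c] by metis
  obtain Cf where Cf: "0 \<le> Cf" "\<And>a b. \<bar>a\<bar> \<le> R \<Longrightarrow> \<bar>b\<bar> \<le> R \<Longrightarrow> \<bar>f2 a - f2 b\<bar> \<le> Cf * \<bar>a - b\<bar>"
    using Lipschitz_on_bounded[OF f(2,3)] by metis
  obtain Cg where Cg: "0 \<le> Cg" "\<And>a b. \<bar>a\<bar> \<le> R \<Longrightarrow> \<bar>b\<bar> \<le> R \<Longrightarrow> \<bar>g1 a - g1 b\<bar> \<le> Cg * \<bar>a - b\<bar>"
    using Lipschitz_on_bounded[OF g(2,3)] by metis
  define b0 where "b0 x = g1 (\<phi> x) - f2 (\<phi> x) * \<phi>1 x" for x
  have "periodic (\<lambda>x. b0 x - Re \<mu>)"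
    using C1_perD(1)[OF phi(1)] C1_perD(1)[OF phi(2)] by (simp add: periodic_def b0_def)
  moreover have "continuous_on UNIV (\<lambda>x. b0 x - Re \<mu>)"
    unfolding b0_def by (intro continuous_intros continuous_on_compose2[OF g1c] continuous_on_compose2[OF f2c]
        C1_perD(4)[OF phi(1)] C1_perD(4)[OF phi(2)]) auto
  ultimately obtain K where K: "0 < K" "\<And>x. \<bar>b0 x - Re \<mu>\<bar> \<le> K"
    using periodic_cont_bounded by (metis real_norm_def)
  \<comment> \<open>The sum of the remainder constants in \<open>subsolution_pointwise\<close>, with
    \<open>BP + 1\<close> bounding the regularised modulus.\<close>
  define C where "C = Cf * (BP + 1) * B1 + Mf * B2 + Cg * (BP + 1)"
  have B1_0: "0 \<le> B1" using B1[of 0] by linarith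
  have C0: "0 \<le> C" unfolding C_def using Cf(1) Mf(1) Cg(1) BP(2) B2(2) B1_0 by (intro add_nonneg_nonneg mult_nonneg_nonneg) auto
  \<comment> \<open>\<open>C + 1\<close> in the denominator because \<open>C\<close> may be
    0.\<close>
  define A where "A = min 1 (Re \<mu> / (2 * (C + 1)))"
  have A: "0 < A" "A \<le> 1" using \<mu> C0 by (auto simp: A_def)
  have AC: "A * C \<le> Re \<mu> / 2"
  proof -
    have "A * C \<le> Re \<mu> / (2 * (C + 1)) * (C + 1)"
      using C0 \<mu> A by (intro mult_mono) (auto simp: A_def)
    also have "\<dots> = Re \<mu> / 2"
    proof -
      have "C + 1 \<noteq> 0" using C0 by linarith
      then show ?thesis by (simp add: field_simps)
    qed
    finally show ?thesis .
  qed
  show ?thesis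
  proof (rule that[of A K])
    fix \<eta> \<alpha> y :: real assume \<eta>: "0 < \<eta>" "\<eta> \<le> 1" and \<alpha>: "0 \<le> \<alpha>" "\<alpha> \<le> A"
    define r where "r = mod_reg \<eta> (P y)"
    have r: "0 \<le> r" "r \<le> BP + 1"
      using mod_reg_pos[OF \<eta>(1), of "P y"] mod_reg_le[OF \<eta>(1), of "P y"] BP(1)[of y] \<eta> by (auto simp: r_def)
    have ar: "\<bar>\<alpha> * r\<bar> \<le> 1 * (BP + 1)" unfolding abs_mult using r \<alpha> A by (intro mult_mono) auto
    have ph: "\<bar>\<phi> y\<bar> \<le> R" "\<bar>\<phi> y + \<alpha> * r\<bar> \<le> R" using B0[of y] ar BP(2) by (auto simp: R_def)
    have conv: "convex {- R..R}" by simp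
    have T1: "\<bar>f1 (\<phi> y + \<alpha> * r) - f1 (\<phi> y) - (\<alpha> * r) * f2 (\<phi> y)\<bar> \<le> Cf * (\<alpha> * r)\<^sup>2"
      using Taylor_second_order[OF conv has_field_derivative_at_within[OF f(1)] _ _ _ Cf(1), of "\<phi> y" "\<phi> y + \<alpha> * r"] Cf(2) ph by (simp add: abs_le_iff)
    have T2: "\<bar>g (\<phi> y + \<alpha> * r) - g (\<phi> y) - (\<alpha> * r) * g1 (\<phi> y)\<bar> \<le> Cg * (\<alpha> * r)\<^sup>2"
      using Taylor_second_order[OF conv has_field_derivative_at_within[OF g(1)] _ _ _ Cg(1), of "\<phi> y" "\<phi> y + \<alpha> * r"] Cg(2) ph by (simp add: abs_le_iff)
    have T3: "\<bar>f1 (\<phi> y + \<alpha> * r) - f1 (\<phi> y)\<bar> \<le> Mf * \<bar>\<alpha> * r\<bar>" using Mf(2)[OF ph(2,1)] by simp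
    have small: "\<alpha> * (Cf * (BP + 1) * B1 + Mf * B2 + Cg * (BP + 1)) \<le> Re \<mu> / 2"
      using mult_right_mono[OF \<alpha>(2) C0] AC by (simp add: C_def)
    have Kato: "Re \<mu> * r - K * \<eta> \<le> mod_reg2 \<eta> (P y) (P1 y) (P2 y) + (c - f1 (\<phi> y)) * mod_reg1 \<eta> (P y) (P1 y) + (g1 (\<phi> y) - f2 (\<phi> y) * \<phi>1 y) * r"
      unfolding r_def using Kato_inequality[OF P(5) \<eta>(1)] K(2)[of y] by (simp add: b0_def)
    have r1: "\<bar>mod_reg1 \<eta> (P y) (P1 y)\<bar> \<le> B2" using abs_mod_reg1_le[OF \<eta>(1)] B2(1) order_trans by blast
    show "- c * (\<phi>1 y + \<alpha> * mod_reg1 \<eta> (P y) (P1 y)) + Re \<mu> / 2 * \<alpha> * mod_reg \<eta> (P y)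
      \<le> (\<phi>2 y + \<alpha> * mod_reg2 \<eta> (P y) (P1 y) (P2 y))
        - f1 (\<phi> y + \<alpha> * mod_reg \<eta> (P y)) * (\<phi>1 y + \<alpha> * mod_reg1 \<eta> (P y) (P1 y))
        + g (\<phi> y + \<alpha> * mod_reg \<eta> (P y)) + K * \<eta>"
      using subsolution_pointwise[where ?f1.0 = f1 and ?f2.0 = f2 and g = g and ?g1.0 = g1, OF phi(3)[of y] Kato T1 T3 T2 B1 r r1 \<alpha>(1) _ _ Cf(1) Mf(1) Cg(1) small] \<alpha> A K(1) \<eta>
      by (simp add: r_def)
  qed (use A K in auto)
qed

end

text \<open>A predicate closed under sums and products, so that the long time derivatives in the
  moving frame can be bounded term by term.\<close>

definition strip_bounded :: "real \<Rightarrow> (real \<Rightarrow> real \<Rightarrow> real) \<Rightarrow> bool" where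
  "strip_bounded T F \<longleftrightarrow> (\<exists>K. \<forall>t\<in>{0..T}. \<forall>x. \<bar>F t x\<bar> \<le> K)"

lemma strip_bounded_add:
  assumes "strip_bounded T F" "strip_bounded T G" shows "strip_bounded T (\<lambda>t x. F t x + G t x)"
proof -
  obtain K M where "\<And>t x. t \<in> {0..T} \<Longrightarrow> \<bar>F t x\<bar> \<le> K" "\<And>t x. t \<in> {0..T} \<Longrightarrow> \<bar>G t x\<bar> \<le> M"
    using assms unfolding strip_bounded_def by metis
  then show ?thesis unfolding strip_bounded_def
    by (intro exI[of _ "K + M"]) (meson abs_triangle_ineq add_mono order_trans)
qed

lemma strip_bounded_mult:
  assumes "strip_bounded T F" "strip_bounded T G" shows "strip_bounded T (\<lambda>t x. F t x * G t x)"
proof -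
  obtain K M where "\<And>t x. t \<in> {0..T} \<Longrightarrow> \<bar>F t x\<bar> \<le> K" "\<And>t x. t \<in> {0..T} \<Longrightarrow> \<bar>G t x\<bar> \<le> M"
    using assms unfolding strip_bounded_def by metis
  then have "\<bar>F t x * G t x\<bar> \<le> K * M" if "t \<in> {0..T}" for t x
    unfolding abs_mult using that by (intro mult_mono) (auto intro: order_trans[OF abs_ge_zero])
  then show ?thesis unfolding strip_bounded_def by blast
qed

lemma strip_bounded_space: "(\<And>x. \<bar>h x\<bar> \<le> B) \<Longrightarrow> strip_bounded T (\<lambda>t x. h (x - c * t))"
  unfolding strip_bounded_def by blast

lemma strip_bounded_time: "continuous_on {0..T} \<alpha> \<Longrightarrow> strip_bounded T (\<lambda>t x. \<alpha> t)"
  using compact_imp_bounded[OF compact_continuous_image, of "{0..T}" \<alpha>]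
  unfolding strip_bounded_def bounded_iff by force

context period begin

text \<open>The second time derivative \<open>stt\<close> is bounded because the profiles are C2 and
  periodic and \<alpha> is continuous on a compact time interval. \<open>K\<close> depends on the
  profile \<open>q\<close>, hence later on \<eta>; this is harmless, as it does not occur in the
  conclusion of \<open>comparison\<close>.\<close>

lemma moving_frame_time_Taylor:
  fixes \<alpha> :: "real \<Rightarrow> real"
  assumes p: "C1_per p p1" "C1_per p1 p2" and q: "C1_per q q1" "C1_per q1 q2"
    and \<alpha>: "\<And>t. (\<alpha> has_real_derivative k * \<alpha> t) (at t)"
    and s: "s = (\<lambda>t x. p (x - c * t) + \<alpha> t * q (x - c * t))"
    and st: "st = (\<lambda>t x. - c * (p1 (x - c * t) + \<alpha> t * q1 (x - c * t)) + k * \<alpha> t * q (x - c * t))"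
  obtains K where "\<And>r t x. r \<in> {0..T} \<Longrightarrow> t \<in> {0..T} \<Longrightarrow> \<bar>s r x - s t x - (r - t) * st t x\<bar> \<le> K * (r - t)\<^sup>2"
    "\<And>t x. t \<in> {0..T} \<Longrightarrow> \<bar>st t x\<bar> \<le> K"
proof -
  define stt where "stt t x = - c * ((- c) * p2 (x - c * t) + (k * \<alpha> t * q1 (x - c * t) + \<alpha> t * ((- c) * q2 (x - c * t))))
     + k * (k * \<alpha> t * q (x - c * t) + \<alpha> t * ((- c) * q1 (x - c * t)))" for t x
  have sh: "((\<lambda>t. h (x - c * t)) has_real_derivative (- c) * h' (x - c * t)) (at t within S)"
    if "C1_per h h'" for h h' x t S
  proof -
    have "((\<lambda>t. x - c * t) has_real_derivative (- c)) (at t)" by (auto intro!: derivative_eq_intros)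
    then have "((\<lambda>t. h (x - c * t)) has_real_derivative h' (x - c * t) * (- c)) (at t)"
      by (rule DERIV_chain2[where f = h, OF C1_perD(2)[OF that]])
    from has_field_derivative_at_within[OF this, of S] show ?thesis by (simp only: mult.commute)
  qed
  note \<alpha>' = has_field_derivative_at_within[OF \<alpha>]
  have d1: "((\<lambda>t. s t x) has_real_derivative st t x) (at t within S)" for t x S
    unfolding s st
    by (rule DERIV_cong[OF DERIV_add[OF sh[OF p(1)] DERIV_mult[OF \<alpha>' sh[OF q(1)]]]]) (simp add: algebra_simps)
  have d2: "((\<lambda>t. st t x) has_real_derivative stt t x) (at t within S)" for t x S
    unfolding st stt_def
    by (rule DERIV_cong[OF DERIV_add[OF DERIV_cmult[OF DERIV_add[OF sh[OF p(2)] DERIV_mult[OF \<alpha>' sh[OF q(2)]]]]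
          DERIV_mult[OF DERIV_cmult[OF \<alpha>'] sh[OF q(1)]]]]) (simp add: algebra_simps)
  have ac: "continuous_on A \<alpha>" for A
    by (rule DERIV_continuous_on[OF \<alpha>'])
  have b: "strip_bounded T (\<lambda>t x. h (x - c * t))" if h: "\<exists>B. \<forall>x. \<bar>h x\<bar> \<le> B" for h
  proof -
    obtain B where "\<And>x. \<bar>h x\<bar> \<le> B" using h by blast
    then show ?thesis by (rule strip_bounded_space)
  qed
  have bp: "\<exists>B. \<forall>x. \<bar>h x\<bar> \<le> B" "\<exists>B. \<forall>x. \<bar>h' x\<bar> \<le> B" if "C1_per h h'" for h h'
    by (rule C1_per_bounded[OF that], blast) (rule C1_per_deriv_bounded[OF that], blast)
  note bs = strip_bounded_add strip_bounded_mult strip_bounded_time ac continuous_on_const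
     b[OF bp(1)[OF p(1)]] b[OF bp(1)[OF p(2)]] b[OF bp(2)[OF p(2)]] b[OF bp(1)[OF q(1)]] b[OF bp(1)[OF q(2)]] b[OF bp(2)[OF q(2)]]
  have "strip_bounded T st" unfolding st by (intro bs)
  then obtain K1 where K1: "\<And>t x. t \<in> {0..T} \<Longrightarrow> \<bar>st t x\<bar> \<le> K1" unfolding strip_bounded_def by blast
  have "strip_bounded T stt" unfolding stt_def by (intro bs)
  then obtain K2 where K2: "\<And>t x. t \<in> {0..T} \<Longrightarrow> \<bar>stt t x\<bar> \<le> K2" unfolding strip_bounded_def by blast
  define K where "K = max \<bar>K1\<bar> \<bar>K2\<bar>"
  have K: "K1 \<le> K" "K2 \<le> K" "0 \<le> K" by (auto simp: K_def)
  show ?thesis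
  proof (rule that[of K])
    fix r t x :: real assume rt: "r \<in> {0..T}" "t \<in> {0..T}"
    have lip: "\<bar>st a x - st b x\<bar> \<le> K * \<bar>a - b\<bar>" if "a \<in> {0..T}" "b \<in> {0..T}" for a b
      unfolding real_norm_def[symmetric]
    proof (rule field_differentiable_bound[of "{0..T}" "\<lambda>t. st t x" "\<lambda>t. stt t x" K a b])
      show "norm (stt z x) \<le> K" if "z \<in> {0..T}" for z using K2[OF that, of x] K(2) by simp
    qed (use that d2 in auto)
    show "\<bar>s r x - s t x - (r - t) * st t x\<bar> \<le> K * (r - t)\<^sup>2"
      by (rule Taylor_second_order[of "{0..T}" "\<lambda>t. s t x" "\<lambda>t. st t x"]) (use d1 lip rt K in auto)
  next
    fix t x :: real assume "t \<in> {0..T}"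
    then show "\<bar>st t x\<bar> \<le> K" using K1[of t x] K by linarith
  qed
qed

text \<open>Up to the threshold \<tau> the first term suffices, beyond it the cube dominates. This
  turns a small cubic energy into an upper bound for an integral.\<close>

lemma pos_part_interpolate:
  assumes "0 < \<tau>" shows "y \<le> \<tau> + pos_part y ^ 3 / \<tau>\<^sup>2"
proof (cases "y \<le> \<tau>")
  case True
  have "0 \<le> pos_part y ^ 3 / \<tau>\<^sup>2" by simp
  with True show ?thesis by linarith
next
  case False
  have "y * \<tau>\<^sup>2 \<le> y * y\<^sup>2" using False assms by (intro mult_left_mono power_mono) auto
  then have "y \<le> pos_part y ^ 3 / \<tau>\<^sup>2"
    using False assms by (simp add: pos_part_def le_divide_eq power2_eq_square power3_eq_cube mult.assoc)
  then show ?thesis using assms by linarith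
qed

subsection \<open>Instability\<close>

lemma near_orbit:
  assumes "orbit_dist L \<phi> v < d"
  obtains r where "real_Hs_norm L 2 (\<lambda>x. v x - \<phi> (x + r)) < d"
proof -
  have "bdd_below (range (\<lambda>r. real_Hs_norm L 2 (\<lambda>x. v x - \<phi> (x + r))))"
    by (rule bdd_belowI2[of _ 0]) (rule real_Hs_norm_nonneg)
  then have "\<exists>r\<in>UNIV. real_Hs_norm L 2 (\<lambda>x. v x - \<phi> (x + r)) < d"
    using assms unfolding orbit_dist_def by (subst (asm) cINF_less_iff) auto
  then show ?thesis using that by blast
qed

lemma orbit_dist_le: "orbit_dist L \<phi> v \<le> real_Hs_norm L 2 (\<lambda>x. v x - \<phi> (x + r))"
  unfolding orbit_dist_def
  by (rule cINF_lower) (auto intro!: bdd_belowI2[of _ 0] real_Hs_norm_nonneg)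

text \<open>The zeroth Fourier coefficient is the mean, and its modulus times \<open>sqrt L\<close>
  is at most the Sobolev norm.\<close>

lemma integral_near_orbit:
  assumes v: "v \<in> real_Hs_per L 2" and phi: "C1_per \<phi> \<phi>1" "C1_per \<phi>1 \<phi>2"
    and d: "orbit_dist L \<phi> v < d"
  shows "integral\<^sup>L mu v \<le> integral\<^sup>L mu \<phi> + sqrt L * d"
proof -
  obtain r where r: "real_Hs_norm L 2 (\<lambda>x. v x - \<phi> (x + r)) < d" using near_orbit[OF d] by blast
  define h where "h x = v x - \<phi> (x + r)" for x
  have ph: "(\<lambda>x. \<phi> (x + r)) \<in> real_Hs_per L 2"
    by (rule C2_per_real_Hs[OF C1_per_shift[OF phi(1)] C1_per_shift[OF phi(2)]])
  have h: "h \<in> real_Hs_per L 2" unfolding h_def by (rule real_Hs_diff[OF v ph])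
  have "sqrt L * norm (fourier_coeff L (\<lambda>x. complex_of_real (h x)) 0) \<le> real_Hs_norm L 2 h"
    unfolding real_Hs_norm_def using h by (intro fourier_coeff_le_Hs_norm) (auto simp: real_Hs_per_def)
  moreover have "fourier_coeff L (\<lambda>x. complex_of_real (h x)) 0 = of_real (integral\<^sup>L mu h / L)"
    by (simp add: fourier_coeff_mu)
  ultimately have "sqrt L * \<bar>integral\<^sup>L mu h / L\<bar> < d"
    using r by (simp only: norm_of_real h_def[symmetric])
  then have "sqrt L * (sqrt L * \<bar>integral\<^sup>L mu h / L\<bar>) \<le> sqrt L * d"
    using L_pos by (intro mult_left_mono) auto
  then have "\<bar>integral\<^sup>L mu h\<bar> \<le> sqrt L * d"
    using L_pos by (simp add: mult.assoc[symmetric] abs_divide)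
  moreover have "integral\<^sup>L mu h = integral\<^sup>L mu v - integral\<^sup>L mu \<phi>"
  proof -
    have "integral\<^sup>L mu h = integral\<^sup>L mu v - integral\<^sup>L mu (\<lambda>x. \<phi> (x + r))"
      unfolding h_def by (intro Bochner_Integration.integral_diff L2_integrable real_Hs_imp_L2[OF v] real_Hs_imp_L2[OF ph])
    then show ?thesis using integral_mu_shift[OF C1_perD(1,4)[OF phi(1)]] by simp
  qed
  ultimately show ?thesis by linarith
qed

text \<open>Supplies the range on which \<open>f\<close> and \<open>g\<close> are Lipschitz,
  uniformly in time and independently of the size of the initial perturbation.\<close>

lemma bounded_near_orbit:
  assumes v: "v \<in> real_Hs_per L 2" and phi: "C1_per \<phi> \<phi>1" "C1_per \<phi>1 \<phi>2" "\<And>x. \<bar>\<phi> x\<bar> \<le> B"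
    and d: "orbit_dist L \<phi> v < 1"
  shows "AE x in mu. \<bar>v x\<bar> \<le> B + sup_const"
proof -
  obtain r where r: "real_Hs_norm L 2 (\<lambda>x. v x - \<phi> (x + r)) < 1" using near_orbit[OF d] by blast
  have "(\<lambda>x. \<phi> (x + r)) \<in> real_Hs_per L 2"
    by (rule C2_per_real_Hs[OF C1_per_shift[OF phi(1)] C1_per_shift[OF phi(2)]])
  then have "AE x in mu. \<bar>v x - \<phi> (x + r)\<bar> \<le> sup_const"
    using r by (intro real_H2_sup_bound real_Hs_diff v) auto
  then show ?thesis
  proof eventually_elim
    fix x assume "\<bar>v x - \<phi> (x + r)\<bar> \<le> sup_const"
    then show "\<bar>v x\<bar> \<le> B + sup_const" using phi(3)[of "x + r"] by linarith
  qed
qed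

text \<open>The order of choices matters: \<open>A\<close> and the integral \<open>I\<close> fix
  \<epsilon>, stability answers with \<open>\<delta>s\<close>, then come \<delta> and the escape
  time \<open>T\<close>, then the constant \<open>C\<close>, which depends on \<open>T\<close>, and
  only at the end \<eta>, which has to beat \<open>C\<close>. Hence the initial datum must not
  depend on \<eta>.\<close>

lemma not_orbitally_stable:
  assumes f: "\<And>x. (f has_real_derivative f1 x) (at x)" "\<And>x. (f1 has_real_derivative f2 x) (at x)"
      "\<And>x. (f2 has_real_derivative f3 x) (at x)" "continuous_on UNIV f3"
    and g: "\<And>x. (g has_real_derivative g1 x) (at x)" "\<And>x. (g1 has_real_derivative g2 x) (at x)" "continuous_on UNIV g2"
    and phi: "C1_per \<phi> \<phi>1" "C1_per \<phi>1 \<phi>2" "\<And>x. - c * \<phi>1 x + f1 (\<phi> x) * \<phi>1 x = \<phi>2 x + g (\<phi> x)"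
    and P: "periodic P" "periodic P1" "\<And>x. (P has_vector_derivative P1 x) (at x)"
      "\<And>x. (P1 has_vector_derivative P2 x) (at x)" "continuous_on UNIV P2"
      "\<And>x. P2 x + of_real (c - f1 (\<phi> x)) * P1 x + of_real (g1 (\<phi> x) - f2 (\<phi> x) * \<phi>1 x) * P x = \<mu> * P x"
      "0 < integral\<^sup>L mu (\<lambda>x. norm (P x))"
    and \<mu>: "0 < Re \<mu>"
  shows "\<not> orbitally_stable f g L \<phi>"
proof
  assume stable: "orbitally_stable f g L \<phi>"
  have Pc: "continuous_on A P" and P1c: "continuous_on A P1" for A
    by (rule continuous_at_imp_continuous_on; use P(3,4) in \<open>auto intro: has_vector_derivative_continuous\<close>)+
  obtain A K0 where A: "0 < A" "A \<le> 1" and K0: "0 \<le> K0"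
    and sub: "\<And>\<eta> \<alpha> y. 0 < \<eta> \<Longrightarrow> \<eta> \<le> 1 \<Longrightarrow> 0 \<le> \<alpha> \<Longrightarrow> \<alpha> \<le> A \<Longrightarrow>
      - c * (\<phi>1 y + \<alpha> * mod_reg1 \<eta> (P y) (P1 y)) + Re \<mu> / 2 * \<alpha> * mod_reg \<eta> (P y)
      \<le> (\<phi>2 y + \<alpha> * mod_reg2 \<eta> (P y) (P1 y) (P2 y))
        - f1 (\<phi> y + \<alpha> * mod_reg \<eta> (P y)) * (\<phi>1 y + \<alpha> * mod_reg1 \<eta> (P y) (P1 y))
        + g (\<phi> y + \<alpha> * mod_reg \<eta> (P y)) + K0 * \<eta>"
    using subsolution_family[OF f(2-4) g phi P(1-3) P1c P(6) \<mu>] by metis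
  define q where "q \<eta> x = mod_reg \<eta> (P x)" for \<eta> x
  define q1 where "q1 \<eta> x = mod_reg1 \<eta> (P x) (P1 x)" for \<eta> x
  define q2 where "q2 \<eta> x = mod_reg2 \<eta> (P x) (P1 x) (P2 x)" for \<eta> x
  have q2c: "continuous_on UNIV (q2 \<eta>)" if "0 < \<eta>" for \<eta>
  proof -
    have "mod_reg \<eta> (P x) \<noteq> 0" for x using mod_reg_pos[OF that, of "P x"] by simp
    then show ?thesis unfolding q2_def mod_reg2_def mod_reg1_def
      by (intro continuous_intros Pc P1c P(5)) (auto simp: mod_reg_def intro!: continuous_intros Pc)
  qed
  have q1C1: "C1_per (q1 \<eta>) (q2 \<eta>)" if "0 < \<eta>" for \<eta>
    unfolding C1_per_def using q2c[OF that] P(1,2) mod_reg1_deriv[OF that P(3,4)]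
    by (auto simp: q1_def[abs_def] q2_def[abs_def] periodic_def)
  have qC1: "C1_per (q \<eta>) (q1 \<eta>)" if "0 < \<eta>" for \<eta>
    unfolding C1_per_def using C1_perD(4)[OF q1C1[OF that]] P(1) mod_reg_deriv[OF that P(3)]
    by (auto simp: q_def[abs_def] q1_def[abs_def] periodic_def)
  have q0: "0 \<le> q \<eta> x" if "0 < \<eta>" for \<eta> x unfolding q_def using mod_reg_pos[OF that, of "P x"] by linarith
  obtain BP where BP: "\<And>x. norm (P x) \<le> BP" "0 < BP" using periodic_cont_bounded[OF P(1) Pc] by metis
  have qB: "q \<eta> x \<le> BP + 1" if "0 < \<eta>" "\<eta> \<le> 1" for \<eta> x
    using mod_reg_le[OF that(1), of "P x"] BP(1)[of x] that(2) by (simp add: q_def)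
  obtain B0 where B0: "\<And>x. \<bar>\<phi> x\<bar> \<le> B0" using C1_per_bounded[OF phi(1)] by blast
  define I where "I = integral\<^sup>L mu (\<lambda>x. norm (P x))"
  have I: "0 < I" using P(7) by (simp add: I_def)
  \<comment> \<open>At most 1 for the sup bound near the orbit; the other entry makes the allowed
    excess of the integral, \<open>sqrt L * \<epsilon>\<close>, at most
    \<open>A * I / 4\<close>.\<close>
  define \<epsilon> where "\<epsilon> = min 1 (A * I / (4 * sqrt L))"
  have \<epsilon>: "0 < \<epsilon>" "\<epsilon> \<le> 1" "sqrt L * \<epsilon> \<le> A * I / 4"
  proof -
    show "0 < \<epsilon>" "\<epsilon> \<le> 1" using A I L_pos by (auto simp: \<epsilon>_def)
    have "sqrt L * \<epsilon> \<le> sqrt L * (A * I / (4 * sqrt L))"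
      using L_pos by (intro mult_left_mono) (auto simp: \<epsilon>_def)
    then show "sqrt L * \<epsilon> \<le> A * I / 4" using L_pos by simp
  qed
  obtain \<delta>s where \<delta>s: "0 < \<delta>s" and near: "\<And>\<psi>. \<psi> \<in> real_Hs_per L 2 \<Longrightarrow> orbit_dist L \<phi> \<psi> < \<delta>s \<Longrightarrow>
      \<exists>u. global_solution f g L \<psi> u \<and> (SUP t\<in>{0<..}. ereal (orbit_dist L \<phi> (u t))) < ereal \<epsilon>"
    using stable \<epsilon>(1) unfolding orbitally_stable_def by meson
  define n1 where "n1 = real_Hs_norm L 2 (q 1)"
  have n1: "0 \<le> n1" by (simp add: n1_def real_Hs_norm_nonneg)
  \<comment> \<open>\<open>A / 2\<close> leaves \<alpha> room to grow, so that \<open>T > 0\<close>;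
    the second entry brings the datum within \<open>\<delta>s\<close> of the orbit, with
    \<open>1 + n1\<close> as a positive denominator.\<close>
  define \<delta> where "\<delta> = min (A / 2) (\<delta>s / (2 * (1 + n1)))"
  have \<delta>: "0 < \<delta>" "\<delta> < A" using A \<delta>s n1 by (auto simp: \<delta>_def)
  have \<delta>n: "\<delta> * n1 < \<delta>s"
  proof -
    have "\<delta> * n1 \<le> \<delta>s / (2 * (1 + n1)) * n1" using n1 by (intro mult_right_mono) (auto simp: \<delta>_def)
    also have "\<dots> < \<delta>s" using n1 \<delta>s by (simp add: divide_less_eq add_nonneg_pos algebra_simps)
    finally show ?thesis .
  qed
  define \<psi> where "\<psi> x = \<phi> x + \<delta> * q 1 x" for x
  have "\<psi> \<in> real_Hs_per L 2"
    unfolding \<psi>_def by (rule C2_per_real_Hs[OF C1_per_lincomb[OF phi(1) qC1] C1_per_lincomb[OF phi(2) q1C1]]) auto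
  moreover have "orbit_dist L \<phi> \<psi> < \<delta>s"
  proof -
    have "orbit_dist L \<phi> \<psi> \<le> real_Hs_norm L 2 (\<lambda>x. \<psi> x - \<phi> (x + 0))" by (rule orbit_dist_le)
    also have "\<dots> = \<delta> * n1"
      using Hs_norm_scaleR[of \<delta> 2 "\<lambda>x. complex_of_real (q 1 x)"] \<delta> by (simp add: real_Hs_norm_def \<psi>_def n1_def)
    finally show ?thesis using \<delta>n by linarith
  qed
  ultimately obtain u where u: "global_solution f g L \<psi> u"
    and sup: "(SUP t\<in>{0<..}. ereal (orbit_dist L \<phi> (u t))) < ereal \<epsilon>" using near by blast
  have close: "orbit_dist L \<phi> (u t) < \<epsilon>" if "0 < t" for t
    using le_less_trans[OF SUP_upper[of t "{0<..}" "\<lambda>t. ereal (orbit_dist L \<phi> (u t))"] sup] that by simp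
  define \<alpha> where "\<alpha> t = \<delta> * exp (Re \<mu> / 2 * t)" for t
  have \<alpha>d: "(\<alpha> has_real_derivative Re \<mu> / 2 * \<alpha> t) (at t)" for t
    unfolding \<alpha>_def by (auto intro!: derivative_eq_intros)
  \<comment> \<open>The solution of \<open>\<alpha> T = A\<close>.\<close>
  define T where "T = 2 / Re \<mu> * ln (A / \<delta>)"
  have T: "0 < T" using \<mu> \<delta> by (simp add: T_def)
  have \<alpha>T: "\<alpha> T = A" using \<mu> \<delta> A by (simp add: \<alpha>_def T_def)
  have \<alpha>0: "0 \<le> \<alpha> t" for t using \<delta> by (simp add: \<alpha>_def)
  have \<alpha>A: "\<alpha> t \<le> A" if "t \<in> {0..T}" for t
    unfolding \<alpha>T[symmetric] unfolding \<alpha>_def using that \<delta> \<mu> by (intro mult_left_mono) auto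
  have sol: "solution_on f g L T u" and u0: "AE x in lborel. u 0 x = \<psi> x"
    using u T by (auto simp: global_solution_def)
  have uH: "u t \<in> real_Hs_per L 2" if "t \<in> {0..T}" for t using sol that by (auto simp: solution_on_def)
  \<comment> \<open>A common bound for the subsolutions, the initial datum and every function within
    distance 1 of the orbit.\<close>
  define R where "R = B0 + BP + 1 + \<bar>sup_const\<bar>"
  \<comment> \<open>Closeness to the orbit is given for positive times only, so time 0 is read off
    from the datum.\<close>
  have uR: "AE x in mu. \<bar>u t x\<bar> \<le> R" if t: "t \<in> {0..T}" for t
  proof (cases "t = 0")
    case True
    have "\<bar>\<psi> x\<bar> \<le> R" for x
    proof -
      have "\<bar>\<delta> * q 1 x\<bar> \<le> 1 * (BP + 1)"
        unfolding abs_mult using \<delta> A q0[of 1 x] qB[of 1 x] by (intro mult_mono) auto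
      then show ?thesis using B0[of x] by (simp add: \<psi>_def R_def)
    qed
    then show ?thesis using AE_mu[OF u0] True by (auto elim!: eventually_mono)
  next
    case False
    then have "orbit_dist L \<phi> (u t) < 1" using close[of t] t \<epsilon> by simp
    from bounded_near_orbit[OF uH[OF t] phi(1,2) B0 this] show ?thesis
      by eventually_elim (use BP in \<open>simp add: R_def\<close>)
  qed
  have f1c: "continuous_on UNIV f1" and g1c: "continuous_on UNIV g1" and gc: "continuous_on UNIV g"
    using f(2) g(1,2) by (auto intro: DERIV_continuous_on)
  obtain Mf where Mf: "0 \<le> Mf" "\<And>a b. \<bar>a\<bar> \<le> R \<Longrightarrow> \<bar>b\<bar> \<le> R \<Longrightarrow> \<bar>f a - f b\<bar> \<le> Mf * \<bar>a - b\<bar>"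
    using Lipschitz_on_bounded[OF f(1) f1c] by metis
  obtain Mg where Mg: "0 \<le> Mg" "\<And>a b. \<bar>a\<bar> \<le> R \<Longrightarrow> \<bar>b\<bar> \<le> R \<Longrightarrow> \<bar>g a - g b\<bar> \<le> Mg * \<bar>a - b\<bar>"
    using Lipschitz_on_bounded[OF g(1) g1c] by metis
  define M where "M = max Mf Mg"
  have M: "\<bar>f a - f b\<bar> \<le> M * \<bar>a - b\<bar>" "\<bar>g a - g b\<bar> \<le> M * \<bar>a - b\<bar>" if "\<bar>a\<bar> \<le> R" "\<bar>b\<bar> \<le> R" for a b
    using order_trans[OF Mf(2)[OF that] mult_right_mono[of Mf M]] order_trans[OF Mg(2)[OF that] mult_right_mono[of Mg M]]
    by (auto simp: M_def)
  have M0: "0 \<le> M" using Mf(1) by (simp add: M_def)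
  define C where "C = 12 * R\<^sup>2 * K0 * L * T * exp ((3 / 2 * M\<^sup>2 + 3 * M) * T)"
  have C0: "0 \<le> C" using K0 L_pos T by (simp add: C_def)
  define s where "s \<eta> t x = \<phi> (x - c * t) + \<alpha> t * q \<eta> (x - c * t)" for \<eta> t x
  have C1s: "C1_per (s \<eta> t) (\<lambda>x. \<phi>1 (x - c * t) + \<alpha> t * q1 \<eta> (x - c * t))"
    "C1_per (\<lambda>x. \<phi>1 (x - c * t) + \<alpha> t * q1 \<eta> (x - c * t)) (\<lambda>x. \<phi>2 (x - c * t) + \<alpha> t * q2 \<eta> (x - c * t))" if "0 < \<eta>" for \<eta> t
    using C1_per_lincomb[OF C1_per_shift[OF phi(1)] C1_per_shift[OF qC1[OF that]], of "- (c * t)" "\<alpha> t" "- (c * t)"]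
      C1_per_lincomb[OF C1_per_shift[OF phi(2)] C1_per_shift[OF q1C1[OF that]], of "- (c * t)" "\<alpha> t" "- (c * t)"]
    by (simp_all add: s_def[abs_def])
  have small: "energy (\<lambda>x. s \<eta> T x - u T x) \<le> C * \<eta>" if \<eta>: "0 < \<eta>" "\<eta> \<le> 1" for \<eta>
  proof -
    define st where "st t x = - c * (\<phi>1 (x - c * t) + \<alpha> t * q1 \<eta> (x - c * t)) + Re \<mu> / 2 * \<alpha> t * q \<eta> (x - c * t)" for t x
    obtain K where K: "\<And>r t x. r \<in> {0..T} \<Longrightarrow> t \<in> {0..T} \<Longrightarrow> \<bar>s \<eta> r x - s \<eta> t x - (r - t) * st t x\<bar> \<le> K * (r - t)\<^sup>2"
      "\<And>t x. t \<in> {0..T} \<Longrightarrow> \<bar>st t x\<bar> \<le> K"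
      using moving_frame_time_Taylor[OF phi(1,2) qC1[OF \<eta>(1)] q1C1[OF \<eta>(1)] \<alpha>d, of "s \<eta>" c st T]
      by (auto simp: s_def[abs_def] st_def[abs_def])
    have stc: "continuous_on UNIV (st t)" for t
      unfolding st_def using C1_perD(4)[OF C1_per_shift[OF phi(2)], of UNIV "- (c * t)"]
        C1_perD(4)[OF C1_per_shift[OF q1C1[OF \<eta>(1)]], of UNIV "- (c * t)"] C1_perD(4)[OF C1_per_shift[OF qC1[OF \<eta>(1)]], of UNIV "- (c * t)"]
      by (intro continuous_intros) auto
    have "energy (\<lambda>x. s \<eta> T x - u T x) \<le> 12 * R\<^sup>2 * (K0 * \<eta>) * L * T * exp ((3 / 2 * M\<^sup>2 + 3 * M) * T)"
    proof (rule comparison[OF sol T f(1) f1c gc C1s[OF \<eta>(1)] stc K _ _ _ uR M M0])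
      fix t x assume t: "t \<in> {0..T}"
      show "st t x \<le> \<phi>2 (x - c * t) + \<alpha> t * q2 \<eta> (x - c * t) - f1 (s \<eta> t x) * (\<phi>1 (x - c * t) + \<alpha> t * q1 \<eta> (x - c * t)) + g (s \<eta> t x) + K0 * \<eta>"
        using sub[OF \<eta> \<alpha>0 \<alpha>A[OF t], of "x - c * t"] by (simp add: st_def s_def q_def q1_def q2_def)
      have "\<bar>\<alpha> t * q \<eta> (x - c * t)\<bar> \<le> 1 * (BP + 1)"
        unfolding abs_mult using \<alpha>0[of t] \<alpha>A[OF t] A q0[OF \<eta>(1)] qB[OF \<eta>] by (intro mult_mono) auto
      then show "\<bar>s \<eta> t x\<bar> \<le> R" using B0[of "x - c * t"] by (simp add: s_def R_def)
    next
      show "0 \<le> K0 * \<eta>" using K0 \<eta> by simp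
      \<comment> \<open>The regularised modulus increases with its parameter, so the datum with
        parameter 1 dominates all subsolutions at once.\<close>
      show "AE x in mu. s \<eta> 0 x \<le> u 0 x"
        using AE_mu[OF u0]
      proof eventually_elim
        fix x assume "u 0 x = \<psi> x"
        moreover have "q \<eta> x \<le> q 1 x" unfolding q_def by (rule mod_reg_mono[OF \<eta>])
        ultimately show "s \<eta> 0 x \<le> u 0 x" using \<delta> by (simp add: s_def \<psi>_def \<alpha>_def)
      qed
    qed
    then show ?thesis by (simp add: C_def mult_ac)
  qed
  \<comment> \<open>A loss of \<open>A * I / 2\<close> is budgeted: one quarter of
    \<open>A * I\<close> for the threshold term, one for the energy term, which \<eta> makes
    small.\<close>
  define \<tau> where "\<tau> = A * I / (4 * L)"
  have \<tau>: "0 < \<tau>" "L * \<tau> = A * I / 4" using A I L_pos by (auto simp: \<tau>_def)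
  define \<eta> where "\<eta> = min 1 (A * I * \<tau>\<^sup>2 / (4 * (C + 1)))"
  have \<eta>: "0 < \<eta>" "\<eta> \<le> 1" using A I \<tau> C0 by (auto simp: \<eta>_def)
  have C\<eta>: "C * \<eta> / \<tau>\<^sup>2 \<le> A * I / 4"
  proof -
    have "C * \<eta> \<le> (C + 1) * (A * I * \<tau>\<^sup>2 / (4 * (C + 1)))"
      using C0 \<eta> by (intro mult_mono) (auto simp: \<eta>_def)
    also have "\<dots> = A * I / 4 * \<tau>\<^sup>2"
    proof -
      have "C + 1 \<noteq> 0" using C0 by linarith
      then show ?thesis by (simp add: field_simps)
    qed
    finally show ?thesis using \<tau>(1) by (simp add: divide_le_eq)
  qed
  have Tin: "T \<in> {0..T}" using T by simp
  have ui: "integrable mu (u T)" by (rule L2_integrable[OF real_Hs_imp_L2[OF uH[OF Tin]]])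
  have si: "integrable mu (s \<eta> T)" by (intro integrable_mu_cont C1_perD(4)[OF C1s(1)[OF \<eta>(1)]])
  have zi: "integrable mu (\<lambda>x. pos_part (s \<eta> T x - u T x) ^ 3)"
  proof (rule energy_integrable)
    show "AE x in mu. \<bar>s \<eta> T x - u T x\<bar> \<le> (B0 + BP + 1) + R"
      using uR[OF Tin]
    proof eventually_elim
      fix x assume "\<bar>u T x\<bar> \<le> R"
      moreover have "\<bar>A * q \<eta> (x - c * T)\<bar> \<le> 1 * (BP + 1)"
        unfolding abs_mult using A q0[OF \<eta>(1)] qB[OF \<eta>] by (intro mult_mono) auto
      ultimately show "\<bar>s \<eta> T x - u T x\<bar> \<le> (B0 + BP + 1) + R"
        using B0[of "x - c * T"] by (simp add: s_def \<alpha>T)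
    qed
    show "0 \<le> B0 + BP + 1 + R" using B0[of 0] BP(2) by (simp add: R_def)
  qed (use ui si in measurable)
  have "integral\<^sup>L mu (\<lambda>x. s \<eta> T x - u T x) \<le> integral\<^sup>L mu (\<lambda>x. \<tau> + pos_part (s \<eta> T x - u T x) ^ 3 / \<tau>\<^sup>2)"
    using ui si zi by (intro integral_mono pos_part_interpolate \<tau>) auto
  also have "\<dots> = L * \<tau> + energy (\<lambda>x. s \<eta> T x - u T x) / \<tau>\<^sup>2" using zi by (simp add: energy_def)
  also have "\<dots> \<le> A * I / 4 + C * \<eta> / \<tau>\<^sup>2"
    using small[OF \<eta>] \<tau> by (intro add_mono divide_right_mono) auto
  finally have "integral\<^sup>L mu (s \<eta> T) - integral\<^sup>L mu (u T) \<le> A * I / 4 + C * \<eta> / \<tau>\<^sup>2"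
    using ui si by simp
  with C\<eta> have up: "integral\<^sup>L mu (s \<eta> T) - integral\<^sup>L mu (u T) \<le> A * I / 2" by linarith
  \<comment> \<open>At a fixed time the moving frame is a translation, which the integral over a
    period does not see.\<close>
  have "integral\<^sup>L mu (s \<eta> T) = integral\<^sup>L mu (\<lambda>x. \<phi> (x + (- c * T))) + A * integral\<^sup>L mu (\<lambda>x. q \<eta> (x + (- c * T)))"
    unfolding s_def[abs_def] \<alpha>T
    using integrable_mu_cont[OF C1_perD(4)[OF C1_per_shift[OF phi(1)]], of "- (c * T)"]
      integrable_mu_cont[OF C1_perD(4)[OF C1_per_shift[OF qC1[OF \<eta>(1)]]], of "- (c * T)"] by simp
  also have "\<dots> = integral\<^sup>L mu \<phi> + A * integral\<^sup>L mu (q \<eta>)"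
    using integral_mu_shift[OF C1_perD(1,4)[OF phi(1)], of "- c * T"] integral_mu_shift[OF C1_perD(1,4)[OF qC1[OF \<eta>(1)]], of "- c * T"]
    by simp
  also have "\<dots> \<ge> integral\<^sup>L mu \<phi> + A * I"
  proof -
    have "I \<le> integral\<^sup>L mu (q \<eta>)" unfolding I_def
      by (intro integral_mono integrable_mu_cont continuous_intros Pc C1_perD(4)[OF qC1[OF \<eta>(1)]]) (simp add: q_def mod_reg_ge \<eta>)
    then show ?thesis using A by simp
  qed
  \<comment> \<open>A gain of at least \<open>A * I / 2\<close> meets an allowance of
    \<open>A * I / 4\<close>.\<close>
  finally have "integral\<^sup>L mu \<phi> + A * I / 2 \<le> integral\<^sup>L mu (u T)" using up by linarith
  moreover have "integral\<^sup>L mu (u T) \<le> integral\<^sup>L mu \<phi> + A * I / 4"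
    using integral_near_orbit[OF uH[OF Tin] phi(1,2) close[OF T]] \<epsilon>(3) by linarith
  moreover have "0 < A * I" using A I by simp
  ultimately show False by linarith
qed

end

theorem theorem2p6:
  fixes f g \<phi> :: "real \<Rightarrow> real" and c L :: real
  assumes "C_k 4 f" and "C_k 3 g"
    and "periodic_traveling_wave f g c L \<phi>"
    and "spectrally_unstable f g c L \<phi>"
  shows "orbitally_unstable f g L \<phi>"
proof -
  have phi: "C_k 2 \<phi>" "fundamental_period \<phi> L" "classical_solution f g (\<lambda>t x. \<phi> (x - c * t))"
    using assms(3) by (auto simp: periodic_traveling_wave_def)
  interpret period L by standard (use phi(2) in \<open>simp add: fundamental_period_def\<close>)
  have f: "(f has_real_derivative deriv f x) (at x)" "(deriv f has_real_derivative deriv (deriv f) x) (at x)"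
    "(deriv (deriv f) has_real_derivative deriv (deriv (deriv f)) x) (at x)" for x
    using C_k_has_deriv[OF assms(1), of 0 x] C_k_has_deriv[OF assms(1), of 1 x] C_k_has_deriv[OF assms(1), of 2 x]
    by (simp_all add: numeral_2_eq_2)
  have f3c: "continuous_on UNIV (deriv (deriv (deriv f)))"
    using C_k_continuous[OF assms(1), of 3] by (simp add: numeral_3_eq_3)
  have g: "(g has_real_derivative deriv g x) (at x)" "(deriv g has_real_derivative deriv (deriv g) x) (at x)" for x
    using C_k_has_deriv[OF assms(2), of 0 x] C_k_has_deriv[OF assms(2), of 1 x] by simp_all
  have g2c: "continuous_on UNIV (deriv (deriv g))"
    using C_k_continuous[OF assms(2), of 2] by (simp add: numeral_2_eq_2)
  have d: "(\<phi> has_real_derivative deriv \<phi> x) (at x)" "(deriv \<phi> has_real_derivative deriv (deriv \<phi>) x) (at x)" for x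
    using C_k_has_deriv[OF phi(1), of 0 x] C_k_has_deriv[OF phi(1), of 1 x] by simp_all
  have c2: "continuous_on UNIV (deriv (deriv \<phi>))"
    using C_k_continuous[OF phi(1), of 2] by (simp add: numeral_2_eq_2)
  have c1: "continuous_on UNIV (deriv \<phi>)" using d(2) by (auto intro: DERIV_continuous_on)
  have p0: "C1_per \<phi> (deriv \<phi>)"
    using d(1) c1 phi(2) by (simp add: C1_per_def periodic_def fundamental_period_def)
  have p1: "C1_per (deriv \<phi>) (deriv (deriv \<phi>))"
    using d(2) c2 C1_per_deriv_periodic[OF p0] by (simp add: C1_per_def)
  \<comment> \<open>Chain rule that makes the coefficient \<open>a0\<close> of \<open>lin_op\<close>
    and the flux term of the wave equation explicit products.\<close>
  have df: "((\<lambda>y. h (\<phi> y)) has_real_derivative h' (\<phi> x) * deriv \<phi> x) (at x)"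
    if "\<And>y. (h has_real_derivative h' y) (at y)" for h h' :: "real \<Rightarrow> real" and x
    by (rule DERIV_chain2[OF that d(1)])
  \<comment> \<open>The profile equation is the evolution equation at time 0; the speed enters
    through the time derivative.\<close>
  have wave: "- c * deriv \<phi> x + deriv f (\<phi> x) * deriv \<phi> x = deriv (deriv \<phi>) x + g (\<phi> x)" for x
  proof -
    have "((\<lambda>t. x - c * t) has_real_derivative - c) (at 0)" by (auto intro!: derivative_eq_intros)
    moreover have "(\<phi> has_real_derivative deriv \<phi> (x - c * 0)) (at (x - c * 0))" by (rule d(1))
    ultimately have "((\<lambda>t. \<phi> (x - c * t)) has_real_derivative deriv \<phi> (x - c * 0) * (- c)) (at 0)"
      by (intro DERIV_chain2[where f = \<phi>])
    then have "deriv (\<lambda>t. \<phi> (x - c * t)) 0 = - c * deriv \<phi> x" by (simp add: DERIV_imp_deriv)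
    moreover have "deriv (\<lambda>y. f (\<phi> y)) x = deriv f (\<phi> x) * deriv \<phi> x" by (rule DERIV_imp_deriv[OF df[OF f(1)]])
    moreover have "deriv (\<lambda>s. \<phi> (x - c * s)) 0 + deriv (\<lambda>y. f (\<phi> y)) x = deriv (deriv \<phi>) x + g (\<phi> x)"
      using spec[OF spec[OF phi(3)[unfolded classical_solution_def], of 0], of x] by simp
    ultimately show ?thesis by simp
  qed
  obtain \<mu> \<Psi> where \<mu>: "0 < Re \<mu>" and eig: "is_eigenpair f g c L \<phi> \<mu> \<Psi>"
    using assms(4) by (auto simp: spectrally_unstable_def)
  define a1 where "a1 x = c - deriv f (\<phi> x)" for x
  define a0 where "a0 x = deriv g (\<phi> x) - deriv (deriv f) (\<phi> x) * deriv \<phi> x" for x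
  have fc: "continuous_on UNIV (deriv f)" "continuous_on UNIV (deriv (deriv f))" "continuous_on UNIV (deriv g)"
    using f(2,3) g(2) by (auto intro: DERIV_continuous_on)
  have H2: "\<Psi> \<in> Hs_per L 2" and nz: "\<not> (AE x in lborel. \<Psi> x = 0)"
    using eig by (simp_all add: is_eigenpair_def)
  have lin: "AE x in lborel. weak_deriv L (weak_deriv L \<Psi>) x + of_real (a1 x) * weak_deriv L \<Psi> x + of_real (a0 x) * \<Psi> x = \<mu> * \<Psi> x"
    using eig DERIV_imp_deriv[OF df[OF f(2)]] by (simp add: is_eigenpair_def lin_op_def a1_def a0_def)
  have per: "periodic a1" "periodic a0"
    using C1_perD(1)[OF p0] C1_perD(1)[OF p1] by (simp_all add: periodic_def a1_def a0_def)
  have cont: "continuous_on UNIV a1" "continuous_on UNIV a0"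
    unfolding a1_def a0_def
    by (intro continuous_intros c1 continuous_on_compose2[OF fc(1)] continuous_on_compose2[OF fc(2)]
        continuous_on_compose2[OF fc(3)] C1_perD(4)[OF p0]; simp)+
  obtain P P1 P2 where P: "periodic P" "periodic P1" "periodic P2" "\<And>x. (P has_vector_derivative P1 x) (at x)"
    "\<And>x. (P1 has_vector_derivative P2 x) (at x)" "continuous_on UNIV P2"
    "\<And>x. P2 x + of_real (a1 x) * P1 x + of_real (a0 x) * P x = \<mu> * P x"
    "0 < integral\<^sup>L mu (\<lambda>x. norm (P x))"
    by (rule eigenfunction_regular[OF H2 nz lin per(1) cont(1) per(2) cont(2)]) (rule that)
  show ?thesis
    unfolding orbitally_unstable_def
    by (rule not_orbitally_stable[OF f f3c g g2c p0 p1 wave P(1,2,4-6) P(7)[unfolded a1_def a0_def] P(8) \<mu>])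
qed

end
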